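(* For every $\epsilon>0$ there exists $K_0$ such that for every integer $K\ge K_0$, every $d>(1+\epsilon)\,2^{K-1}\ln^2 K/K$, every even integer $r>0$ and every balanced local rule $\tau:\mathcal{SAT}_r\to[0,1]$ the following holds: $$\lim_{n\to\infty}\mathbb{P}\big(\sigma_{\mathbf{\Phi}(n,dn),\tau}\in\mathbb{SAT}(\mathbf{\Phi}(n,dn))\big)=0,$$ where $\sigma_{\mathbf{\Phi}(n,dn),\tau}$ is the random output of the $\tau$-decimation algorithm run on the random NAE-$K$-SAT formula $\mathbf{\Phi}(n,dn)$, and the probability is over both the random formula and the random choices of the algorithm.
   Context: NAE-$K$-SAT. A (non-reduced) instance $\Phi$ consists of Boolean variables $x_1,\dots,x_n$ and a finite list of clauses, each consisting of $K$ literals (a literal is a variable $x$ or its negation $\bar x$). An assignment $\sigma:\{x_1,\dots,x_n\}\to\{0,1\}$ satisfies $\Phi$ if every clause has at least one literal with value $1$ and at least one literal with value $0$. $\mathbb{SAT}(\Phi)\subset\{0,1\}^n$ is the set of satisfying assignments. Random formula. $\mathbf{\Phi}(n,dn)$ has variables $x_1,\dots,x_n$ and $\lfloor dn\rfloor$ independent clauses; the $K$ variables of each clause are chosen uniformly at random without replacement from $x_1,\dots,x_n$, and each is negated with probability $1/2$, independently over all variables in the clause and over all clauses. $K$ and $d$ do not depend on $n$. Reduced instances. A reduced clause $C$ is a set of at most $K$ literals together with a sign $\mathrm{sign}(C)\in\{+,-,0\}$, where $C$ has exactly $K$ literals if and only if $\mathrm{sign}(C)=0$. An assignment satisfies $C$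 if: $\mathrm{sign}(C)=+$ and some literal of $C$ has value $0$; or $\mathrm{sign}(C)=-$ and some literal of $C$ has value $1$; or $\mathrm{sign}(C)=0$ and $C$ has both a literal of value $0$ and a literal of value $1$. A reduced instance consists of reduced clauses; non-reduced instances are those in which all signs are $0$. The complement $\bar\Phi$ of a reduced instance $\Phi$ is obtained by keeping all literals and flipping the signs of all clauses ($+\leftrightarrow-$, $0$ unchanged). Fixing a variable. When a variable is given a value, it is deleted from the instance. A sign-$0$ clause containing it loses the corresponding literal and gets sign $+$ if that literal has value $1$ and sign $-$ if it has value $0$. A clause with sign $+$ (resp. $-$) in which the literal takes value $0$ (resp. $1$) is satisfied and removed; otherwise it loses that literal and keeps its sign. A clause left with no literals and not satisfied is violated and is removed. Factor graph and neighborhoods. The factor graph $\mathbb{F}(\Phi)$ is the bipartite graph with a node for each variable and each clause; a clause is adjacent to the variables appearing in it, edges being labelled by the polarity of the literal and clause nodes by the sign of the clause. For an even integer $r$, $B_\Phi(x,r)$ is the depth-$r$ neighborhood of $x$ in $\mathbb{F}(\Phi)$, also viewed as the (reduced) instance formed by the clauses in it, rooted at $x$. $\mathcal{SAT}_r$ is the set of all reduced and non-reduced instances $\Psi$ with a designated root variable $x$ such that every variable of $\Psi$ is at distance at most $r$ from $x$ in $\mathbb{F}(\Psi)$. Local rules and the $\tau$-decimation algorithm. A local rule is a function $\tau:\mathcal{SAT}_r\to[0,1]$; it is balanced if $\tau(\bar\Psi)=1-\tau(\Psi)$ for every $\Psi\in\mathcal{SAT}_r$ (with the same root). On input $\Phi$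 with variables $x_1,\dots,x_n$, the $\tau$-decimation algorithm sets $\Phi_0=\Phi$ and, for $i=1,\dots,n$, sets $\sigma(x_i)=1$ with probability $\tau(B_{\Phi_{i-1}}(x_i,r))$ and $\sigma(x_i)=0$ otherwise (using fresh independent randomness), then lets $\Phi_i$ be the reduced instance obtained from $\Phi_{i-1}$ by fixing $x_i$ to the value $\sigma(x_i)$, i.e. by deleting the variable $x_i$ and updating each clause $C$ containing it as follows: if $\mathrm{sign}(C)=0$, the literal of $x_i$ is deleted from $C$ and $C$ gets sign $+$ if that literal has value $1$ under $\sigma(x_i)$ and sign $-$ if it has value $0$; if $\mathrm{sign}(C)=+$ and the literal has value $0$, or $\mathrm{sign}(C)=-$ and the literal has value $1$, then $C$ is satisfied and removed; in the remaining cases the literal is deleted from $C$ and $C$ keeps its sign; and a clause left with no literals and not satisfied is violated and removed. (The algorithm continues even if a clause gets violated.) Its output $(\sigma(x_1),\dots,\sigma(x_n))$ is denoted $\sigma_{\Phi,\tau}$. *)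

theory Defs
  imports "HOL-Probability.Probability"
begin

text \<open>A literal is a variable with a polarity: \<open>(x, True)\<close> is the variable \<open>x\<close> itself,
  \<open>(x, False)\<close> its negation.\<close>

type_synonym lit = "nat \<times> bool"

definition lit_val :: "(nat \<Rightarrow> bool) \<Rightarrow> lit \<Rightarrow> bool" where
  "lit_val \<sigma> l \<longleftrightarrow> \<sigma> (fst l) = snd l"

datatype csign = Plus | Minus | Zero

record clause =
  lits :: "lit set"
  csgn :: csign

definition clause_vars :: "clause \<Rightarrow> nat set" where
  "clause_vars C = fst ` lits C"

text \<open>Clauses are kept in a list, so that equal clauses count with multiplicity.\<close>

record inst =
  vars :: "nat set"
  clauses :: "clause list"

definition reduced_clause :: "nat \<Rightarrow> clause \<Rightarrow> bool" where
  "reduced_clause K C \<longleftrightarrow>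
     finite (lits C) \<and> card (lits C) \<le> K \<and> (card (lits C) = K \<longleftrightarrow> csgn C = Zero)"

text \<open>The non-reduced instances are the reduced instances all of whose signs are \<open>Zero\<close>.\<close>

definition reduced_instance :: "nat \<Rightarrow> inst \<Rightarrow> bool" where
  "reduced_instance K \<Phi> \<longleftrightarrow>
     finite (vars \<Phi>) \<and>
     (\<forall>C\<in>set (clauses \<Phi>). reduced_clause K C \<and> clause_vars C \<subseteq> vars \<Phi>)"

definition satisfies_clause :: "(nat \<Rightarrow> bool) \<Rightarrow> clause \<Rightarrow> bool" where
  "satisfies_clause \<sigma> C \<longleftrightarrow>
     (case csgn C of
        Plus \<Rightarrow> (\<exists>l\<in>lits C. \<not> lit_val \<sigma> l)
      | Minus \<Rightarrow> (\<exists>l\<in>lits C. lit_val \<sigma> l)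
      | Zero \<Rightarrow> (\<exists>l\<in>lits C. lit_val \<sigma> l) \<and> (\<exists>l\<in>lits C. \<not> lit_val \<sigma> l))"

definition SAT :: "inst \<Rightarrow> (nat \<Rightarrow> bool) set" where
  "SAT \<Phi> = {\<sigma> \<in> vars \<Phi> \<rightarrow>\<^sub>E UNIV. \<forall>C\<in>set (clauses \<Phi>). satisfies_clause \<sigma> C}"

primrec flip_sign :: "csign \<Rightarrow> csign" where
  "flip_sign Plus = Minus"
| "flip_sign Minus = Plus"
| "flip_sign Zero = Zero"

definition complement_inst :: "inst \<Rightarrow> inst" where
  "complement_inst \<Phi> =
     \<Phi>\<lparr>clauses := map (\<lambda>C. C\<lparr>csgn := flip_sign (csgn C)\<rparr>) (clauses \<Phi>)\<rparr>"

text \<open>Fixing \<open>x\<close> to \<open>b\<close> gives the literal \<open>(x, b)\<close> the value 1 and \<open>(x, \<not> b)\<close> the value 0.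
  In the instances to which this is applied below, a clause contains at most one of the two.
  The result is \<open>None\<close> if the clause is removed, being either satisfied or violated.\<close>

definition fix_clause :: "nat \<Rightarrow> bool \<Rightarrow> clause \<Rightarrow> clause option" where
  "fix_clause x b C =
     (if x \<notin> clause_vars C then Some C
      else if csgn C = Plus \<and> (x, \<not> b) \<in> lits C \<or> csgn C = Minus \<and> (x, b) \<in> lits C then None
      else
        let L = {l \<in> lits C. fst l \<noteq> x};
            s = (if csgn C = Zero then (if (x, b) \<in> lits C then Plus else Minus) else csgn C)
        in if L = {} then None else Some \<lparr>lits = L, csgn = s\<rparr>)"

definition fix_var :: "nat \<Rightarrow> bool \<Rightarrow> inst \<Rightarrow> inst" where
  "fix_var x b \<Phi> =
     \<lparr>vars = vars \<Phi> - {x}, clauses = List.map_filter (fix_clause x b) (clauses \<Phi>)\<rparr>"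

text \<open>Clause nodes of the factor graph are positions in the clause list. The edge and node
  labels (polarities and signs) are carried by the instance itself.\<close>

datatype node = VNode nat | CNode nat

definition factor_graph :: "inst \<Rightarrow> (node \<times> node) set" where
  "factor_graph \<Phi> =
     (let E = {(VNode x, CNode j) | x j. j < length (clauses \<Phi>) \<and> x \<in> clause_vars (clauses \<Phi> ! j)}
      in E \<union> E\<inverse>)"

definition within_dist :: "inst \<Rightarrow> nat \<Rightarrow> node \<Rightarrow> node \<Rightarrow> bool" where
  "within_dist \<Phi> r u v \<longleftrightarrow> (\<exists>k\<le>r. (u, v) \<in> factor_graph \<Phi> ^^ k)"

text \<open>For even \<open>r\<close>, the clauses at distance at most \<open>r\<close> from a variable are at distance at most
  \<open>r - 1\<close>, so the ball contains all variables of its clauses.\<close>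

definition nbhd :: "inst \<Rightarrow> nat \<Rightarrow> nat \<Rightarrow> inst" where
  "nbhd \<Phi> x r =
     \<lparr>vars = {y \<in> vars \<Phi>. within_dist \<Phi> r (VNode x) (VNode y)},
      clauses = nths (clauses \<Phi>) {j. within_dist \<Phi> r (VNode x) (CNode j)}\<rparr>"

definition rooted_SAT :: "nat \<Rightarrow> nat \<Rightarrow> (inst \<times> nat) set" where
  "rooted_SAT K r =
     {(\<Psi>, x). reduced_instance K \<Psi> \<and> x \<in> vars \<Psi> \<and>
              (\<forall>y\<in>vars \<Psi>. within_dist \<Psi> r (VNode x) (VNode y))}"

definition local_rule :: "nat \<Rightarrow> nat \<Rightarrow> (inst \<times> nat \<Rightarrow> real) \<Rightarrow> bool" where
  "local_rule K r \<tau> \<longleftrightarrow> \<tau> \<in> rooted_SAT K r \<rightarrow> {0..1}"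

definition balanced :: "nat \<Rightarrow> nat \<Rightarrow> (inst \<times> nat \<Rightarrow> real) \<Rightarrow> bool" where
  "balanced K r \<tau> \<longleftrightarrow>
     (\<forall>(\<Psi>, x)\<in>rooted_SAT K r. \<tau> (complement_inst \<Psi>, x) = 1 - \<tau> (\<Psi>, x))"

primrec decimate ::
  "nat \<Rightarrow> (inst \<times> nat \<Rightarrow> real) \<Rightarrow> nat list \<Rightarrow> inst \<Rightarrow> (nat \<Rightarrow> bool) \<Rightarrow> (nat \<Rightarrow> bool) pmf" where
  "decimate r \<tau> [] \<Phi> \<sigma> = return_pmf \<sigma>"
| "decimate r \<tau> (x # xs) \<Phi> \<sigma> =
     do {
       b \<leftarrow> bernoulli_pmf (\<tau> (nbhd \<Phi> x r, x));
       decimate r \<tau> xs (fix_var x b \<Phi>) (\<sigma>(x := b))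
     }"

definition decimation :: "nat \<Rightarrow> (inst \<times> nat \<Rightarrow> real) \<Rightarrow> inst \<Rightarrow> (nat \<Rightarrow> bool) pmf" where
  "decimation r \<tau> \<Phi> = decimate r \<tau> (sorted_list_of_set (vars \<Phi>)) \<Phi> (\<lambda>_. undefined)"

text \<open>Only meaningful for \<open>n \<ge> K\<close>, otherwise the set of variable choices is empty.\<close>

definition random_clause :: "nat \<Rightarrow> nat \<Rightarrow> clause pmf" where
  "random_clause K n =
     do {
       S \<leftarrow> pmf_of_set {S. S \<subseteq> {1..n} \<and> card S = K};
       p \<leftarrow> Pi_pmf S True (\<lambda>_. bernoulli_pmf (1/2));
       return_pmf \<lparr>lits = (\<lambda>x. (x, p x)) ` S, csgn = Zero\<rparr>
     }"

definition random_formula :: "nat \<Rightarrow> real \<Rightarrow> nat \<Rightarrow> inst pmf" where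
  "random_formula K d n =
     map_pmf (\<lambda>cs. \<lparr>vars = {1..n}, clauses = cs\<rparr>)
       (replicate_pmf (nat \<lfloor>d * real n\<rfloor>) (random_clause K n))"

definition formula_and_output ::
  "nat \<Rightarrow> real \<Rightarrow> nat \<Rightarrow> (inst \<times> nat \<Rightarrow> real) \<Rightarrow> nat \<Rightarrow> (inst \<times> (nat \<Rightarrow> bool)) pmf" where
  "formula_and_output K d r \<tau> n =
     do {
       \<Phi> \<leftarrow> random_formula K d n;
       \<sigma> \<leftarrow> decimation r \<tau> \<Phi>;
       return_pmf (\<Phi>, \<sigma>)
     }"

end

theory Submission
  imports Defs "HOL-Real_Asymp.Real_Asymp"
begin

text \<open>Fix the formula and let the algorithm read its coin flips from independent seeds, one per
  variable. The value of a variable \<open>x\<close> depends only on the seeds in its zone, the set of variables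
  from which a chain of increasing indices with steps of length at most \<open>r\<close> in the factor graph
  leads to \<open>x\<close>. Because a chain of \<open>L\<close> steps is increasing with probability only \<open>1 / fact (Suc L)\<close>,
  zones are typically bounded, and almost all pairs of zones are disjoint.

  Now run the algorithm \<open>m\<close> times, with common seeds for the variables up to \<open>s\<close> and independent
  seeds afterwards. Given the common seeds the runs are independent, so if one run succeeds with
  probability bounded away from 0, then so do all \<open>m\<close> runs simultaneously. By disjointness of zones, the
  Hamming distance of two runs is concentrated and its mean changes by \<open>o(n)\<close> when \<open>s\<close> grows by 1. This
  mean is \<open>n / 2\<close> for \<open>s = 0\<close>, because the rule is balanced, and \<open>0\<close> for \<open>s = n\<close>. Hence for some \<open>s\<close> there are
  \<open>m\<close> satisfying assignments with all pairwise distances close to \<open>n * ln K / K\<close>.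
  For \<open>m\<close> about \<open>K / ln K\<close> the first moment method shows that a random formula of the given density
  has no such tuple.\<close>

section \<open>Factor graphs and neighborhoods\<close>

text \<open>The distance \<open>x * n\<close> with \<open>x\<close> about \<open>ln K / K\<close> is
  where two effects balance. Two assignments at this distance violate a random clause simultaneously
  with probability at most \<open>2 * (1/2) ^ K * ((1 - x) ^ K + x ^ K)\<close>, and the bracket is
  at most \<open>2 / K\<close>. The events that a clause is violated by one of \<open>m\<close>
  assignments are therefore nearly disjoint if \<open>m\<close> is of smaller order than
  \<open>K\<close>, and each assignment lowers the exponent of the first moment by about
  \<open>d * 2 * (1/2) ^ K\<close>, which exceeds
  \<open>(1 + \<epsilon>) * (ln K)\<^sup>2 / K\<close>. Choosing it within distance
  \<open>x * n\<close> of the first one contributes only \<open>x * (1 - ln x)\<close>, about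
  \<open>(ln K)\<^sup>2 / K\<close>. What remains, \<open>\<epsilon> * (ln K)\<^sup>2 / K\<close>
  per assignment, must pay for the free choice of the first assignment, which contributes
  \<open>ln 2\<close>. With \<open>m\<close> about \<open>K / ln K\<close> the total gain is about
  \<open>\<epsilon> * ln K\<close>. The formula enters the interpolation only through the number of
  pairs of meeting zones. It bounds the variance of the distance, and also its change from
  \<open>s\<close> to \<open>s + 1\<close>, since all zones that contain a given variable meet
  pairwise.\<close>

definition inc_graph :: "nat set \<Rightarrow> (nat \<Rightarrow> clause) \<Rightarrow> (node \<times> node) set" where
  "inc_graph J G =
     (let E = {(VNode x, CNode j) | x j. j \<in> J \<and> x \<in> clause_vars (G j)} in E \<union> E\<inverse>)"

lemma inc_graph_simps [simp]:
  "(VNode x, CNode j) \<in> inc_graph J G \<longleftrightarrow> j \<in> J \<and> x \<in> clause_vars (G j)"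
  "(CNode j, VNode x) \<in> inc_graph J G \<longleftrightarrow> j \<in> J \<and> x \<in> clause_vars (G j)"
  "(VNode x, VNode y) \<notin> inc_graph J G"
  "(CNode i, CNode j) \<notin> inc_graph J G"
  by (auto simp: inc_graph_def Let_def)

lemma inc_graph_sym: "(u, v) \<in> inc_graph J G \<Longrightarrow> (v, u) \<in> inc_graph J G"
  by (auto simp: inc_graph_def Let_def)

lemma factor_graph_conv: "factor_graph \<Phi> = inc_graph {..<length (clauses \<Phi>)} ((!) (clauses \<Phi>))"
  by (auto simp: factor_graph_def inc_graph_def Let_def)

lemma inc_graph_pow_Suc:
  "(u, VNode y) \<in> inc_graph J G ^^ Suc k \<longleftrightarrow>
     (\<exists>j\<in>J. y \<in> clause_vars (G j) \<and> (u, CNode j) \<in> inc_graph J G ^^ k)"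
  "(u, CNode j) \<in> inc_graph J G ^^ Suc k \<longleftrightarrow>
     j \<in> J \<and> (\<exists>y\<in>clause_vars (G j). (u, VNode y) \<in> inc_graph J G ^^ k)"
proof -
  have "(v, VNode y) \<in> inc_graph J G \<longleftrightarrow> (\<exists>j\<in>J. y \<in> clause_vars (G j) \<and> v = CNode j)" for v
    by (cases v) auto
  then show "(u, VNode y) \<in> inc_graph J G ^^ Suc k \<longleftrightarrow>
     (\<exists>j\<in>J. y \<in> clause_vars (G j) \<and> (u, CNode j) \<in> inc_graph J G ^^ k)"
    by (auto simp: relcomp_unfold)
  have "(v, CNode j) \<in> inc_graph J G \<longleftrightarrow> j \<in> J \<and> (\<exists>y\<in>clause_vars (G j). v = VNode y)" for v
    by (cases v) auto
  then show "(u, CNode j) \<in> inc_graph J G ^^ Suc k \<longleftrightarrow>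
     j \<in> J \<and> (\<exists>y\<in>clause_vars (G j). (u, VNode y) \<in> inc_graph J G ^^ k)"
    by (auto simp: relcomp_unfold)
qed

lemma inc_graph_parity:
  "((VNode x, VNode y) \<in> inc_graph J G ^^ k \<longrightarrow> even k) \<and>
   ((VNode x, CNode j) \<in> inc_graph J G ^^ k \<longrightarrow> odd k)"
proof (induction k arbitrary: y j)
  case (Suc k)
  then show ?case by (simp only: inc_graph_pow_Suc) auto
qed auto

lemma factor_graph_parity:
  "(VNode x, VNode y) \<in> factor_graph \<Phi> ^^ k \<Longrightarrow> even k"
  "(VNode x, CNode j) \<in> factor_graph \<Phi> ^^ k \<Longrightarrow> odd k"
  using inc_graph_parity unfolding factor_graph_conv by blast+

text \<open>\<open>factor_graph\<close> names clauses by their position in the list, and positions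
  shift when clauses are removed. \<open>inc_graph\<close> keeps the entries of \<open>js\<close> as
  names, and mapping \<open>p\<close> to \<open>js ! p\<close> is an isomorphism between the two.
  Variables and clauses are treated together because walks alternate between them.\<close>

lemma factor_graph_map_pow:
  assumes "distinct js"
  shows "((VNode x, VNode y) \<in> factor_graph \<lparr>vars = V, clauses = map G js\<rparr> ^^ k \<longleftrightarrow>
            (VNode x, VNode y) \<in> inc_graph (set js) G ^^ k) \<and>
         (p < length js \<longrightarrow> ((VNode x, CNode p) \<in> factor_graph \<lparr>vars = V, clauses = map G js\<rparr> ^^ k \<longleftrightarrow>
            (VNode x, CNode (js ! p)) \<in> inc_graph (set js) G ^^ k))"
  unfolding factor_graph_conv
proof (induction k arbitrary: y p)
  case (Suc k)
  have "(\<exists>j\<in>{..<length js}. y \<in> clause_vars (G (js ! j)) \<and>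
          (VNode x, CNode j) \<in> inc_graph {..<length (map G js)} ((!) (map G js)) ^^ k) \<longleftrightarrow>
        (\<exists>j\<in>set js. y \<in> clause_vars (G j) \<and> (VNode x, CNode j) \<in> inc_graph (set js) G ^^ k)"
    using Suc.IH by (auto simp: in_set_conv_nth) (metis nth_mem)+
  then show ?case using Suc by (simp only: inc_graph_pow_Suc) auto
qed auto

definition near_in :: "nat set \<Rightarrow> (nat \<Rightarrow> clause) \<Rightarrow> nat \<Rightarrow> nat \<Rightarrow> node \<Rightarrow> bool" where
  "near_in J G r x v \<longleftrightarrow> (\<exists>k\<le>r. (VNode x, v) \<in> inc_graph J G ^^ k)"

lemma nths_cong:
  assumes "\<And>i. i < length xs \<Longrightarrow> i \<in> A \<longleftrightarrow> i \<in> B"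
  shows "nths xs A = nths xs B"
  unfolding nths_def using assms
  by (intro arg_cong[where f = "map fst"] filter_cong refl) (auto simp: set_zip)

lemma nbhd_map:
  assumes "distinct js"
  shows "nbhd \<lparr>vars = V, clauses = map G js\<rparr> x r =
    \<lparr>vars = {y \<in> V. near_in (set js) G r x (VNode y)},
     clauses = map G (filter (\<lambda>j. near_in (set js) G r x (CNode j)) js)\<rparr>"
proof -
  let ?I = "\<lparr>vars = V, clauses = map G js\<rparr>"
  have V: "within_dist ?I r (VNode x) (VNode y) \<longleftrightarrow> near_in (set js) G r x (VNode y)" for y
    unfolding within_dist_def near_in_def using factor_graph_map_pow[OF assms] by blast
  have C: "within_dist ?I r (VNode x) (CNode p) \<longleftrightarrow> near_in (set js) G r x (CNode (js ! p))"
    if "p < length js" for p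
    unfolding within_dist_def near_in_def using factor_graph_map_pow[OF assms] that by blast
  have "nths js {p. within_dist ?I r (VNode x) (CNode p)} =
     filter (\<lambda>j. near_in (set js) G r x (CNode j)) js"
    unfolding filter_eq_nths by (rule nths_cong) (simp add: C)
  then show ?thesis
    by (simp add: nbhd_def nths_map V)
qed

lemma nbhd_conv:
  "nbhd \<Phi> x r = \<lparr>vars = {y \<in> vars \<Phi>. within_dist \<Phi> r (VNode x) (VNode y)},
     clauses = map ((!) (clauses \<Phi>))
       (filter (\<lambda>j. within_dist \<Phi> r (VNode x) (CNode j)) [0..<length (clauses \<Phi>)])\<rparr>"
proof -
  have "\<Phi> = \<lparr>vars = vars \<Phi>, clauses = map ((!) (clauses \<Phi>)) [0..<length (clauses \<Phi>)]\<rparr>"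
    by (simp add: map_nth)
  then have "nbhd \<Phi> x r = nbhd \<lparr>vars = vars \<Phi>, clauses = map ((!) (clauses \<Phi>)) [0..<length (clauses \<Phi>)]\<rparr> x r"
    by (rule arg_cong)
  then show ?thesis
    by (simp add: nbhd_map near_in_def within_dist_def factor_graph_conv lessThan_atLeast0)
qed

text \<open>Induction along the walk. Only clauses that the first graph reaches within
  \<open>r\<close> steps are inspected, so the two graphs need not be comparable outside the
  ball.\<close>

lemma inc_graph_pow_transfer:
  assumes "\<And>j k. k \<le> r \<Longrightarrow> (VNode x, CNode j) \<in> inc_graph J G ^^ k \<Longrightarrow>
             j \<in> J' \<and> clause_vars (G j) \<subseteq> clause_vars (G' j)"
    and "(VNode x, v) \<in> inc_graph J G ^^ k" "k \<le> r"
  shows "(VNode x, v) \<in> inc_graph J' G' ^^ k"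
  using assms(2,3)
proof (induction k arbitrary: v)
  case (Suc k)
  show ?case
  proof (cases v)
    case (VNode y)
    then obtain j where "y \<in> clause_vars (G j)" "(VNode x, CNode j) \<in> inc_graph J G ^^ k"
      using Suc.prems by (auto simp only: inc_graph_pow_Suc)
    then show ?thesis
      using Suc assms(1)[of k j] unfolding VNode inc_graph_pow_Suc by auto
  next
    case (CNode j)
    then obtain y where "y \<in> clause_vars (G j)" "(VNode x, VNode y) \<in> inc_graph J G ^^ k"
      using Suc.prems by (auto simp only: inc_graph_pow_Suc)
    then show ?thesis
      using Suc assms(1)[of "Suc k" j] unfolding CNode inc_graph_pow_Suc by auto
  qed
qed simp

lemma within_dist_refl: "within_dist \<Psi> r u u"
  unfolding within_dist_def by (rule exI[of _ 0]) simp

text \<open>Makes the hypotheses on the rule applicable to neighborhoods. Walks of length at most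
  \<open>r\<close> from \<open>x\<close> stay inside the ball, so distances from \<open>x\<close> do
  not grow when the rest is cut off. By parity, clauses are at distance less than \<open>r\<close>,
  hence the ball contains their variables.\<close>

lemma nbhd_rooted:
  assumes "reduced_instance K \<Psi>" "x \<in> vars \<Psi>" "even r"
  shows "(nbhd \<Psi> x r, x) \<in> rooted_SAT K r"
proof -
  let ?cs = "clauses \<Psi>"
  define js where "js = filter (\<lambda>j. within_dist \<Psi> r (VNode x) (CNode j)) [0..<length ?cs]"
  define V where "V = {y \<in> vars \<Psi>. within_dist \<Psi> r (VNode x) (VNode y)}"
  have nb: "nbhd \<Psi> x r = \<lparr>vars = V, clauses = map ((!) ?cs) js\<rparr>"
    by (simp add: nbhd_conv js_def V_def)
  have "distinct js" by (simp add: js_def)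
  have "reduced_clause K (?cs ! j) \<and> clause_vars (?cs ! j) \<subseteq> V" if "j \<in> set js" for j
  proof -
    have j: "j < length ?cs" "within_dist \<Psi> r (VNode x) (CNode j)"
      using that by (auto simp: js_def)
    then obtain k where k: "k \<le> r" "(VNode x, CNode j) \<in> factor_graph \<Psi> ^^ k"
      by (auto simp: within_dist_def)
    have "odd k" using k(2) by (rule factor_graph_parity)
    then have k': "Suc k \<le> r" using k(1) \<open>even r\<close> by (auto simp: Suc_le_eq le_less)
    have "within_dist \<Psi> r (VNode x) (VNode y)" if "y \<in> clause_vars (?cs ! j)" for y
      unfolding within_dist_def using k k' that j
      by (intro exI[of _ "Suc k"]) (auto simp only: factor_graph_conv inc_graph_pow_Suc lessThan_iff)
    moreover have "reduced_clause K (?cs ! j) \<and> clause_vars (?cs ! j) \<subseteq> vars \<Psi>"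
      using assms(1) j(1) by (auto simp: reduced_instance_def)
    ultimately show ?thesis by (auto simp: V_def)
  qed
  moreover have "finite V"
    using assms(1) by (simp add: V_def reduced_instance_def)
  ultimately have "reduced_instance K (nbhd \<Psi> x r)"
    unfolding reduced_instance_def nb inst.simps set_map by blast
  moreover have "x \<in> V"
    using assms(2) by (simp add: V_def within_dist_refl)
  moreover have "within_dist (nbhd \<Psi> x r) r (VNode x) (VNode y)" if "y \<in> V" for y
  proof -
    obtain k where k: "k \<le> r" "(VNode x, VNode y) \<in> factor_graph \<Psi> ^^ k"
      using \<open>y \<in> V\<close> by (auto simp: V_def within_dist_def)
    have js: "j \<in> set js" if "k' \<le> r" "(VNode x, CNode j) \<in> inc_graph {..<length ?cs} ((!) ?cs) ^^ k'" for j k'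
    proof -
      have "within_dist \<Psi> r (VNode x) (CNode j)"
        using that unfolding within_dist_def factor_graph_conv by blast
      moreover have "j < length ?cs"
      proof (cases k')
        case (Suc i)
        then show ?thesis using that(2) unfolding inc_graph_pow_Suc Suc by blast
      qed (use that(2) in simp)
      ultimately show ?thesis by (simp add: js_def)
    qed
    have "(VNode x, VNode y) \<in> inc_graph (set js) ((!) ?cs) ^^ k"
    proof (rule inc_graph_pow_transfer)
      show "(VNode x, VNode y) \<in> inc_graph {..<length ?cs} ((!) ?cs) ^^ k"
        using k(2) by (simp only: factor_graph_conv)
      show "k \<le> r" by (rule k(1))
    qed (use js in blast)
    then show ?thesis
      unfolding nb within_dist_def using k(1) factor_graph_map_pow[OF \<open>distinct js\<close>] by blast
  qed
  ultimately show ?thesis by (auto simp: rooted_SAT_def nb)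
qed

section \<open>Complements of instances and the fixing of variables\<close>

lemma factor_graph_complement [simp]: "factor_graph (complement_inst \<Psi>) = factor_graph \<Psi>"
proof -
  have "clause_vars (map (\<lambda>C. C\<lparr>csgn := flip_sign (csgn C)\<rparr>) (clauses \<Psi>) ! j) = clause_vars (clauses \<Psi> ! j)"
    if "j < length (clauses \<Psi>)" for j
    using that by (simp add: clause_vars_def)
  then show ?thesis
    by (simp add: factor_graph_def complement_inst_def cong: conj_cong)
qed

lemma nbhd_complement: "nbhd (complement_inst \<Psi>) x r = complement_inst (nbhd \<Psi> x r)"
  by (simp add: nbhd_def within_dist_def) (simp add: complement_inst_def nths_map)

text \<open>Excludes complementary literals. A clause of sign \<open>Zero\<close> with both
  \<open>x\<close> and its negation among its literals gets sign \<open>Plus\<close> for either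
  value of \<open>x\<close> if other literals remain, which would break the symmetry under
  complementation.\<close>

definition proper_clause :: "clause \<Rightarrow> bool" where
  "proper_clause C \<longleftrightarrow> inj_on fst (lits C)"

text \<open>Negating \<open>b\<close> swaps the values of the two literals of \<open>x\<close>, and
  flipping the sign swaps the value that the clause still needs.\<close>

lemma fix_clause_complement:
  assumes "proper_clause C"
  shows "fix_clause x (\<not> b) (C\<lparr>csgn := flip_sign (csgn C)\<rparr>) =
    map_option (\<lambda>C. C\<lparr>csgn := flip_sign (csgn C)\<rparr>) (fix_clause x b C)"
proof (cases "x \<in> clause_vars C")
  case True
  then obtain c where c: "(x, c) \<in> lits C" by (auto simp: clause_vars_def)
  have c': "(x, c') \<in> lits C \<longleftrightarrow> c' = c" for c'
    using inj_onD[of fst "lits C" "(x, c)" "(x, c')"] assms c by (auto simp: proper_clause_def)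
  show ?thesis
    using c' by (cases "csgn C"; cases b; cases c) (auto simp: fix_clause_def clause_vars_def Let_def)
qed (auto simp: fix_clause_def clause_vars_def)

lemma fix_clause_SomeD:
  assumes "fix_clause x b C = Some C'"
  shows "clause_vars C' \<subseteq> clause_vars C - {x}" "lits C' \<subseteq> lits C"
    "reduced_clause K C \<Longrightarrow> reduced_clause K C'"
proof -
  have a: "C' = C \<and> x \<notin> clause_vars C \<or>
    x \<in> clause_vars C \<and> lits C' = {l \<in> lits C. fst l \<noteq> x} \<and> csgn C' \<noteq> Zero"
    using assms by (auto simp: fix_clause_def Let_def split: if_splits)
  show "clause_vars C' \<subseteq> clause_vars C - {x}" "lits C' \<subseteq> lits C"
    using a by (auto simp: clause_vars_def)
  assume r: "reduced_clause K C"
  have "card {l \<in> lits C. fst l \<noteq> x} < card (lits C)" if "x \<in> clause_vars C"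
    using r that by (intro psubset_card_mono) (auto simp: reduced_clause_def clause_vars_def)
  then have "C' = C \<or> finite (lits C') \<and> card (lits C') < K \<and> csgn C' \<noteq> Zero"
    using a r by (auto simp: reduced_clause_def)
  then show "reduced_clause K C'"
    using r by (auto simp: reduced_clause_def)
qed

lemma fix_var_complement:
  assumes "\<forall>C\<in>set (clauses \<Psi>). proper_clause C"
  shows "fix_var x (\<not> b) (complement_inst \<Psi>) = complement_inst (fix_var x b \<Psi>)"
proof -
  have "List.map_filter (fix_clause x (\<not> b)) (map (\<lambda>C. C\<lparr>csgn := flip_sign (csgn C)\<rparr>) cs) =
        map (\<lambda>C. C\<lparr>csgn := flip_sign (csgn C)\<rparr>) (List.map_filter (fix_clause x b) cs)"
    if "\<forall>C\<in>set cs. proper_clause C" for cs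
    using that by (induction cs) (auto simp: fix_clause_complement split: option.splits)
  from this[OF assms] show ?thesis
    by (simp add: fix_var_def complement_inst_def)
qed

definition good_inst :: "nat \<Rightarrow> inst \<Rightarrow> bool" where
  "good_inst K \<Psi> \<longleftrightarrow> reduced_instance K \<Psi> \<and> (\<forall>C\<in>set (clauses \<Psi>). proper_clause C)"

lemma set_map_filter: "set (List.map_filter f xs) = {y. \<exists>x\<in>set xs. f x = Some y}"
  by (induction xs) (auto split: option.splits)

lemma good_inst_fix_var:
  assumes "good_inst K \<Psi>"
  shows "good_inst K (fix_var x b \<Psi>)"
proof -
  have "reduced_clause K C' \<and> clause_vars C' \<subseteq> vars \<Psi> - {x} \<and> proper_clause C'"
    if C: "C \<in> set (clauses \<Psi>)" "fix_clause x b C = Some C'" for C C'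
  proof -
    have "reduced_clause K C" "clause_vars C \<subseteq> vars \<Psi>" "proper_clause C"
      using assms C(1) by (auto simp: good_inst_def reduced_instance_def)
    with fix_clause_SomeD[OF C(2)] show ?thesis
      unfolding proper_clause_def by (blast intro: inj_on_subset)
  qed
  then have "\<forall>C'\<in>set (clauses (fix_var x b \<Psi>)).
      reduced_clause K C' \<and> clause_vars C' \<subseteq> vars \<Psi> - {x} \<and> proper_clause C'"
    unfolding fix_var_def set_map_filter inst.simps by blast
  moreover have "vars (fix_var x b \<Psi>) = vars \<Psi> - {x}" "finite (vars \<Psi>)"
    using assms by (simp_all add: fix_var_def good_inst_def reduced_instance_def)
  ultimately show ?thesis
    unfolding good_inst_def reduced_instance_def by simp
qed

section \<open>The algorithm driven by seeds\<close>

primrec fix_clauses :: "(nat \<Rightarrow> bool) \<Rightarrow> nat list \<Rightarrow> clause \<Rightarrow> clause option" where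
  "fix_clauses \<sigma> [] C = Some C"
| "fix_clauses \<sigma> (x # xs) C = Option.bind (fix_clause x (\<sigma> x) C) (fix_clauses \<sigma> xs)"

definition fix_vars :: "(nat \<Rightarrow> bool) \<Rightarrow> nat list \<Rightarrow> inst \<Rightarrow> inst" where
  "fix_vars \<sigma> xs \<Phi> = fold (\<lambda>x. fix_var x (\<sigma> x)) xs \<Phi>"

lemma fix_vars_simps [simp]:
  "fix_vars \<sigma> [] \<Phi> = \<Phi>"
  "fix_vars \<sigma> (x # xs) \<Phi> = fix_vars \<sigma> xs (fix_var x (\<sigma> x) \<Phi>)"
  by (simp_all add: fix_vars_def)

lemma map_filter_bind:
  "List.map_filter g (List.map_filter f xs) = List.map_filter (\<lambda>x. Option.bind (f x) g) xs"
  by (induction xs) (auto split: option.splits)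

text \<open>Fixing variables acts on each clause separately. Every surviving clause can thus be
  traced to its position in the original list, which makes the reduced instances of two assignments
  comparable.\<close>

lemma fix_vars_conv:
  "fix_vars \<sigma> xs \<Phi> =
     \<lparr>vars = vars \<Phi> - set xs, clauses = List.map_filter (fix_clauses \<sigma> xs) (clauses \<Phi>)\<rparr>"
proof (induction xs arbitrary: \<Phi>)
  case Nil
  have "List.map_filter Some cs = cs" for cs :: "clause list" by (induction cs) auto
  then show ?case by simp
next
  case (Cons x xs)
  then show ?case by (auto simp: fix_var_def map_filter_bind)
qed

lemma fix_clauses_cong:
  assumes "\<And>y. y \<in> set xs \<Longrightarrow> y \<in> clause_vars C \<Longrightarrow> \<sigma> y = \<sigma>' y"
  shows "fix_clauses \<sigma> xs C = fix_clauses \<sigma>' xs C"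
  using assms
proof (induction xs arbitrary: C)
  case (Cons x xs)
  have "fix_clause x (\<sigma> x) C = fix_clause x (\<sigma>' x) C"
    using Cons.prems by (cases "x \<in> clause_vars C") (auto simp: fix_clause_def)
  moreover have "fix_clauses \<sigma> xs C' = fix_clauses \<sigma>' xs C'"
    if "fix_clause x (\<sigma>' x) C = Some C'" for C'
    using fix_clause_SomeD(1)[OF that] Cons.prems by (intro Cons.IH) auto
  ultimately show ?case by (cases "fix_clause x (\<sigma>' x) C") auto
qed simp

lemma fix_clauses_vars: "fix_clauses \<sigma> xs C = Some C' \<Longrightarrow> clause_vars C' \<subseteq> clause_vars C"
proof (induction xs arbitrary: C)
  case (Cons x xs)
  then obtain D where "fix_clause x (\<sigma> x) C = Some D" "fix_clauses \<sigma> xs D = Some C'"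
    by (auto simp: bind_eq_Some_conv)
  then show ?case using Cons.IH fix_clause_SomeD(1) by blast
qed simp

lemma map_filter_index:
  "List.map_filter f cs = map (\<lambda>j. the (f (cs ! j))) (filter (\<lambda>j. f (cs ! j) \<noteq> None) [0..<length cs])"
proof -
  have "List.map_filter f cs = List.map_filter f (map ((!) cs) [0..<length cs])"
    by (simp only: map_nth)
  also have "\<dots> = map (\<lambda>j. the (f (cs ! j))) (filter (\<lambda>j. f (cs ! j) \<noteq> None) [0..<length cs])"
    by (simp add: List.map_filter_def filter_map o_def del: map_nth)
  finally show ?thesis .
qed

lemma nbhd_fix_vars:
  assumes J: "J = {j. j < length (clauses \<Phi>) \<and> fix_clauses \<sigma> xs (clauses \<Phi> ! j) \<noteq> None}"
    and G: "G = (\<lambda>j. the (fix_clauses \<sigma> xs (clauses \<Phi> ! j)))"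
  shows "nbhd (fix_vars \<sigma> xs \<Phi>) x r =
     \<lparr>vars = {y \<in> vars \<Phi> - set xs. near_in J G r x (VNode y)},
      clauses = map G (filter (\<lambda>j. j \<in> J \<and> near_in J G r x (CNode j)) [0..<length (clauses \<Phi>)])\<rparr>"
proof -
  have js: "filter (\<lambda>j. fix_clauses \<sigma> xs (clauses \<Phi> ! j) \<noteq> None) [0..<length (clauses \<Phi>)] =
      filter (\<lambda>j. j \<in> J) [0..<length (clauses \<Phi>)]"
    by (auto simp: J intro!: filter_cong)
  moreover have "set (filter (\<lambda>j. j \<in> J) [0..<length (clauses \<Phi>)]) = J" by (auto simp: J)
  ultimately show ?thesis
    unfolding fix_vars_conv map_filter_index js G[symmetric]
    by (subst nbhd_map) (simp_all add: conj_commute)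
qed

text \<open>Clauses lie at odd distance from a variable, so for even \<open>r\<close> all variables of a clause
  within distance \<open>r\<close> are within distance \<open>r\<close> as well.\<close>

lemma nbhd_fix_vars_cong:
  assumes "even r"
    and agree: "\<And>y. y \<in> set xs \<Longrightarrow> within_dist \<Phi> r (VNode x) (VNode y) \<Longrightarrow> \<sigma> y = \<sigma>' y"
  shows "nbhd (fix_vars \<sigma> xs \<Phi>) x r = nbhd (fix_vars \<sigma>' xs \<Phi>) x r"
proof -
  let ?cs = "clauses \<Phi>"
  define J where "J = (\<lambda>\<sigma>. {j. j < length ?cs \<and> fix_clauses \<sigma> xs (?cs ! j) \<noteq> None})"
  define G where "G = (\<lambda>\<sigma> j. the (fix_clauses \<sigma> xs (?cs ! j)))"
  have sub: "clause_vars (G \<sigma> j) \<subseteq> clause_vars (?cs ! j)" if "j \<in> J \<sigma>" for j \<sigma>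
    using that fix_clauses_vars by (auto simp: J_def G_def)
  have inJ: "j \<in> J \<sigma>" if "(VNode x, CNode j) \<in> inc_graph (J \<sigma>) (G \<sigma>) ^^ k" for j k \<sigma>
    using that by (cases k) (simp, simp only: inc_graph_pow_Suc)
  have orig: "(VNode x, v) \<in> inc_graph {..<length ?cs} ((!) ?cs) ^^ k"
    if "(VNode x, v) \<in> inc_graph (J \<sigma>) (G \<sigma>) ^^ k" for v k \<sigma>
    by (rule inc_graph_pow_transfer[OF _ that order.refl]) (use inJ sub J_def in blast)
  \<comment> \<open>The two reduced graphs grow from \<open>x\<close> in lockstep: a clause reached
    under \<open>\<sigma>1\<close> is reduced in the same way under \<open>\<sigma>2\<close>, so
    that the walk can continue there.\<close>
  have key: "j \<in> J \<sigma>2 \<and> G \<sigma>1 j = G \<sigma>2 j"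
    if agree: "\<And>y. y \<in> set xs \<Longrightarrow> within_dist \<Phi> r (VNode x) (VNode y) \<Longrightarrow> \<sigma>1 y = \<sigma>2 y"
    and k: "k \<le> r" "(VNode x, CNode j) \<in> inc_graph (J \<sigma>1) (G \<sigma>1) ^^ k" for \<sigma>1 \<sigma>2 k j
  proof -
    have o: "(VNode x, CNode j) \<in> inc_graph {..<length ?cs} ((!) ?cs) ^^ k" by (rule orig[OF k(2)])
    have j: "j \<in> J \<sigma>1" by (rule inJ[OF k(2)])
    have "odd k" using o inc_graph_parity by blast
    then have "Suc k \<le> r" using k(1) \<open>even r\<close> by (auto simp: Suc_le_eq le_less)
    moreover have "(VNode x, VNode y) \<in> inc_graph {..<length ?cs} ((!) ?cs) ^^ Suc k"
      if "y \<in> clause_vars (?cs ! j)" for y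
      unfolding inc_graph_pow_Suc using o that j J_def by blast
    ultimately have "within_dist \<Phi> r (VNode x) (VNode y)" if "y \<in> clause_vars (?cs ! j)" for y
      unfolding within_dist_def factor_graph_conv using that by blast
    then have "fix_clauses \<sigma>1 xs (?cs ! j) = fix_clauses \<sigma>2 xs (?cs ! j)"
      by (intro fix_clauses_cong agree)
    then show ?thesis using j by (simp add: J_def G_def)
  qed
  have near: "near_in (J \<sigma>2) (G \<sigma>2) r x v"
    if agree: "\<And>y. y \<in> set xs \<Longrightarrow> within_dist \<Phi> r (VNode x) (VNode y) \<Longrightarrow> \<sigma>1 y = \<sigma>2 y"
    and n: "near_in (J \<sigma>1) (G \<sigma>1) r x v" for \<sigma>1 \<sigma>2 v
  proof -
    obtain k where k: "k \<le> r" "(VNode x, v) \<in> inc_graph (J \<sigma>1) (G \<sigma>1) ^^ k"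
      using n by (auto simp: near_in_def)
    have "(VNode x, v) \<in> inc_graph (J \<sigma>2) (G \<sigma>2) ^^ k"
      by (rule inc_graph_pow_transfer[OF _ k(2) k(1)]) (use key[OF agree] in auto)
    then show ?thesis using k(1) by (auto simp: near_in_def)
  qed
  have near_eq: "near_in (J \<sigma>) (G \<sigma>) r x v \<longleftrightarrow> near_in (J \<sigma>') (G \<sigma>') r x v" for v
    using near[of \<sigma> \<sigma>'] near[of \<sigma>' \<sigma>] agree by metis
  have eq: "G \<sigma> j = G \<sigma>' j" "j \<in> J \<sigma> \<and> j \<in> J \<sigma>'" if "near_in (J \<sigma>) (G \<sigma>) r x (CNode j)" for j
  proof -
    obtain k where "k \<le> r" "(VNode x, CNode j) \<in> inc_graph (J \<sigma>) (G \<sigma>) ^^ k"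
      using \<open>near_in (J \<sigma>) (G \<sigma>) r x (CNode j)\<close> by (auto simp: near_in_def)
    then show "G \<sigma> j = G \<sigma>' j" "j \<in> J \<sigma> \<and> j \<in> J \<sigma>'"
      using key[of \<sigma> \<sigma>'] agree inJ by blast+
  qed
  have "map (G \<sigma>) (filter (\<lambda>j. j \<in> J \<sigma> \<and> near_in (J \<sigma>) (G \<sigma>) r x (CNode j)) [0..<length ?cs]) =
        map (G \<sigma>') (filter (\<lambda>j. j \<in> J \<sigma>' \<and> near_in (J \<sigma>') (G \<sigma>') r x (CNode j)) [0..<length ?cs])"
    using eq near_eq by (intro map_cong filter_cong) auto
  then show ?thesis
    using near_eq
    by (simp add: nbhd_fix_vars[OF fun_cong[OF J_def] fun_cong[OF G_def]])
qed

text \<open>The seed \<open>\<omega> x p\<close> is the value of \<open>x\<close> if the rule asks for probability \<open>p\<close>.\<close>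

primrec run :: "nat \<Rightarrow> (inst \<times> nat \<Rightarrow> real) \<Rightarrow> (nat \<Rightarrow> real \<Rightarrow> bool) \<Rightarrow> nat list \<Rightarrow> inst \<Rightarrow>
    (nat \<Rightarrow> bool) \<Rightarrow> (nat \<Rightarrow> bool)" where
  "run r \<tau> \<omega> [] \<Phi> \<sigma> = \<sigma>"
| "run r \<tau> \<omega> (x # xs) \<Phi> \<sigma> =
     (let b = \<omega> x (\<tau> (nbhd \<Phi> x r, x)) in run r \<tau> \<omega> xs (fix_var x b \<Phi>) (\<sigma>(x := b)))"

lemma run_outside: "y \<notin> set xs \<Longrightarrow> run r \<tau> \<omega> xs \<Phi> \<sigma> y = \<sigma> y"
  by (induction xs arbitrary: \<Phi> \<sigma>) (auto simp: Let_def)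

lemma run_cong:
  "(\<And>x. x \<in> set xs \<Longrightarrow> \<omega> x = \<omega>' x) \<Longrightarrow> run r \<tau> \<omega> xs \<Phi> \<sigma> = run r \<tau> \<omega>' xs \<Phi> \<sigma>"
  by (induction xs arbitrary: \<Phi> \<sigma>) (auto simp: Let_def)

text \<open>Later steps do not overwrite the values of \<open>ys\<close>, so the instance seen at
  \<open>x\<close> can be expressed by the final output. In this self-referential form, dependencies
  can be followed by induction on \<open>x\<close> without intermediate states.\<close>

lemma run_at:
  assumes "distinct (ys @ x # zs)"
  shows "run r \<tau> \<omega> (ys @ x # zs) \<Phi> \<sigma> x =
    \<omega> x (\<tau> (nbhd (fix_vars (run r \<tau> \<omega> (ys @ x # zs) \<Phi> \<sigma>) ys \<Phi>) x r, x))"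
  using assms
proof (induction ys arbitrary: \<Phi> \<sigma>)
  case Nil
  then show ?case by (simp add: Let_def run_outside)
next
  case (Cons y ys)
  let ?b = "\<omega> y (\<tau> (nbhd \<Phi> y r, y))"
  have "run r \<tau> \<omega> ((y # ys) @ x # zs) \<Phi> \<sigma> = run r \<tau> \<omega> (ys @ x # zs) (fix_var y ?b \<Phi>) (\<sigma>(y := ?b))"
    by (simp add: Let_def)
  moreover have "run r \<tau> \<omega> (ys @ x # zs) (fix_var y ?b \<Phi>) (\<sigma>(y := ?b)) y = ?b"
    using Cons.prems by (simp add: run_outside)
  ultimately show ?case using Cons by simp
qed

text \<open>Distances refer to the original formula. Fixing variables only removes edges, so reduced
  instances never bring variables closer to each other.\<close>

definition dep :: "inst \<Rightarrow> nat \<Rightarrow> (nat \<times> nat) set" where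
  "dep \<Phi> r = {(y, x). y \<in> vars \<Phi> \<and> x \<in> vars \<Phi> \<and> y < x \<and> within_dist \<Phi> r (VNode x) (VNode y)}"

definition zone :: "inst \<Rightarrow> nat \<Rightarrow> nat \<Rightarrow> nat set" where
  "zone \<Phi> r x = {y. (y, x) \<in> (dep \<Phi> r)\<^sup>*}"

text \<open>Strong induction on \<open>x\<close>. The rule at \<open>x\<close> sees only the values
  of earlier variables within distance \<open>r\<close>, whose zones are contained in that of
  \<open>x\<close>. The initial assignments may differ because every variable is overwritten before
  its value is read.\<close>

lemma run_zone_cong:
  assumes "even r" "finite (vars \<Phi>)" "x \<in> vars \<Phi>"
    and "\<And>y. y \<in> zone \<Phi> r x \<Longrightarrow> \<omega> y = \<omega>' y"
  shows "run r \<tau> \<omega> (sorted_list_of_set (vars \<Phi>)) \<Phi> \<sigma> x =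
         run r \<tau> \<omega>' (sorted_list_of_set (vars \<Phi>)) \<Phi> \<sigma>' x"
  using assms(3,4)
proof (induction x rule: less_induct)
  case (less x)
  let ?xs = "sorted_list_of_set (vars \<Phi>)"
  have "x \<in> set ?xs" using less.prems assms(2) by simp
  then obtain ys zs where xs: "?xs = ys @ x # zs" by (meson split_list)
  have d: "distinct (ys @ x # zs)" "sorted (ys @ x # zs)" unfolding xs[symmetric] by simp_all
  let ?\<rho> = "run r \<tau> \<omega> ?xs \<Phi> \<sigma>" and ?\<rho>' = "run r \<tau> \<omega>' ?xs \<Phi> \<sigma>'"
  have "?\<rho> y = ?\<rho>' y" if y: "y \<in> set ys" "within_dist \<Phi> r (VNode x) (VNode y)" for y
  proof (rule less.IH)
    have "y \<in> set ?xs" using y by (simp add: xs)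
    then show yv: "y \<in> vars \<Phi>" using assms(2) by simp
    show "y < x" using y d by (auto simp: sorted_append order.strict_iff_order)
    then have "(y, x) \<in> dep \<Phi> r" using y yv less.prems by (auto simp: dep_def)
    then have "zone \<Phi> r y \<subseteq> zone \<Phi> r x" by (auto simp: zone_def)
    then show "\<omega> z = \<omega>' z" if "z \<in> zone \<Phi> r y" for z using less.prems that by auto
  qed
  then have "nbhd (fix_vars ?\<rho> ys \<Phi>) x r = nbhd (fix_vars ?\<rho>' ys \<Phi>) x r"
    by (intro nbhd_fix_vars_cong assms(1))
  moreover have "\<omega> x = \<omega>' x" using less.prems by (auto simp: zone_def)
  ultimately show ?case
    unfolding xs run_at[OF d(1)] by (simp add: xs[symmetric])
qed

text \<open>Both values of each variable are followed, which covers every probability that a run can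
  ask for. As there are finitely many, a seed can be a finite table of coin flips instead of a
  uniform real number, and all distributions remain discrete.\<close>

primrec queries :: "nat \<Rightarrow> (inst \<times> nat \<Rightarrow> real) \<Rightarrow> nat list \<Rightarrow> inst \<Rightarrow> real set" where
  "queries r \<tau> [] \<Phi> = {}"
| "queries r \<tau> (x # xs) \<Phi> =
     insert (\<tau> (nbhd \<Phi> x r, x)) (\<Union>b. queries r \<tau> xs (fix_var x b \<Phi>))"

lemma finite_queries [simp]: "finite (queries r \<tau> xs \<Phi>)"
  by (induction xs arbitrary: \<Phi>) auto

definition seed :: "real set \<Rightarrow> (real \<Rightarrow> bool) pmf" where
  "seed Q = Pi_pmf Q False bernoulli_pmf"

text \<open>Split off the seed of the first variable. The run reads one entry of it, whose marginal
  is the Bernoulli law used by \<open>decimate\<close>; the other seeds are still fresh. The set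
  \<open>Q\<close> is fixed in advance, so that one seed distribution serves all branches of the
  run.\<close>

lemma decimate_run:
  assumes "finite Q" "queries r \<tau> xs \<Phi> \<subseteq> Q" "distinct xs"
  shows "decimate r \<tau> xs \<Phi> \<sigma> =
    map_pmf (\<lambda>\<omega>. run r \<tau> \<omega> xs \<Phi> \<sigma>) (Pi_pmf (set xs) dflt (\<lambda>_. seed Q))"
  using assms(2,3)
proof (induction xs arbitrary: \<Phi> \<sigma>)
  case (Cons x xs)
  let ?p = "\<tau> (nbhd \<Phi> x r, x)"
  have "map_pmf (\<lambda>\<omega>. run r \<tau> \<omega> (x # xs) \<Phi> \<sigma>) (Pi_pmf (set (x # xs)) dflt (\<lambda>_. seed Q)) =
    bind_pmf (seed Q) (\<lambda>f. bind_pmf (Pi_pmf (set xs) dflt (\<lambda>_. seed Q))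
      (\<lambda>\<omega>. return_pmf (run r \<tau> (fun_upd \<omega> x f) (x # xs) \<Phi> \<sigma>)))"
    using Cons.prems
    by (simp add: Pi_pmf_insert' map_bind_pmf del: run.simps)
  also have "\<dots> = bind_pmf (seed Q) (\<lambda>f. decimate r \<tau> xs (fix_var x (f ?p) \<Phi>) (\<sigma>(x := f ?p)))"
  proof (intro bind_pmf_cong refl)
    fix f
    have "run r \<tau> (fun_upd \<omega> x f) (x # xs) \<Phi> \<sigma> = run r \<tau> \<omega> xs (fix_var x (f ?p) \<Phi>) (\<sigma>(x := f ?p))" for \<omega>
      using Cons.prems(2) by (auto simp: Let_def intro!: run_cong)
    moreover have "queries r \<tau> xs (fix_var x (f ?p) \<Phi>) \<subseteq> Q"
      using Cons.prems(1) by auto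
    ultimately show "bind_pmf (Pi_pmf (set xs) dflt (\<lambda>_. seed Q))
        (\<lambda>\<omega>. return_pmf (run r \<tau> (fun_upd \<omega> x f) (x # xs) \<Phi> \<sigma>)) =
      decimate r \<tau> xs (fix_var x (f ?p) \<Phi>) (\<sigma>(x := f ?p))"
      using Cons.prems(2) by (subst Cons.IH) (auto simp: map_pmf_def)
  qed
  also have "\<dots> = bind_pmf (map_pmf (\<lambda>f. f ?p) (seed Q))
      (\<lambda>b. decimate r \<tau> xs (fix_var x b \<Phi>) (\<sigma>(x := b)))"
    by (simp add: bind_map_pmf)
  also have "map_pmf (\<lambda>f. f ?p) (seed Q) = bernoulli_pmf ?p"
    using assms(1) Cons.prems(1) unfolding seed_def by (subst Pi_pmf_component) auto
  finally show ?case by (simp only: decimate.simps)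
qed (simp add: map_pmf_def)

section \<open>Interpolation between independent runs\<close>

lemma prob_bind_pmf:
  "measure_pmf.prob (bind_pmf p f) A = measure_pmf.expectation p (\<lambda>x. measure_pmf.prob (f x) A)"
  unfolding measure_pmf_bind
  by (subst measure_pmf.measure_bind[where N = "count_space UNIV"])
     (auto simp: measure_subprob measure_pmf_in_subprob_algebra)

lemma prob_pair_Collect:
  "measure_pmf.prob (pair_pmf p q) {(a, b). P a b} =
     measure_pmf.expectation p (\<lambda>a. measure_pmf.prob q {b. P a b})"
proof -
  have "measure_pmf.prob (bind_pmf q (\<lambda>y. return_pmf (a, y))) {(a, b). P a b} =
        measure_pmf.prob q {b. P a b}" for a
  proof -
    have "bind_pmf q (\<lambda>y. return_pmf (a, y)) = map_pmf (Pair a) q" by (simp add: map_pmf_def)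
    then show ?thesis by (auto simp: vimage_def)
  qed
  then show ?thesis unfolding pair_pmf_def prob_bind_pmf by simp
qed

lemma prob_pair_Times:
  "measure_pmf.prob (pair_pmf p q) (A \<times> B) = measure_pmf.prob p A * measure_pmf.prob q B"
proof -
  \<comment> \<open>Intersecting with the supports makes both sets countable.\<close>
  have "measure_pmf.prob (pair_pmf p q) ((A \<inter> set_pmf p) \<times> (B \<inter> set_pmf q)) =
        measure_pmf.prob p (A \<inter> set_pmf p) * measure_pmf.prob q (B \<inter> set_pmf q)"
    by (rule measure_pmf_prob_product) (auto intro: countable_subset[OF _ countable_set_pmf])
  moreover have "(A \<inter> set_pmf p) \<times> (B \<inter> set_pmf q) = (A \<times> B) \<inter> set_pmf (pair_pmf p q)" by auto
  ultimately show ?thesis by (simp only: measure_Int_set_pmf)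
qed

lemma integrable_pmf_bounded:
  fixes f :: "'a \<Rightarrow> real"
  assumes "\<And>x. \<bar>f x\<bar> \<le> c"
  shows "integrable (measure_pmf p) f"
  using assms by (intro measure_pmf.integrable_const_bound[where B = c]) auto

lemma Pi_pmf_map_dep:
  assumes "finite A"
  shows "Pi_pmf A d (\<lambda>x. map_pmf (g x) (p x)) =
    map_pmf (\<lambda>f x. if x \<in> A then g x (f x) else d) (Pi_pmf A d' p)"
proof -
  have "Pi_pmf A d (\<lambda>x. map_pmf (g x) (p x)) = Pi_pmf A d (\<lambda>x. bind_pmf (p x) (\<lambda>y. return_pmf (g x y)))"
    by (simp add: map_pmf_def)
  also have "\<dots> = bind_pmf (Pi_pmf A d' p) (\<lambda>f. Pi_pmf A d (\<lambda>x. return_pmf (g x (f x))))"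
    by (rule Pi_pmf_bind[OF assms])
  also have "\<dots> = map_pmf (\<lambda>f x. if x \<in> A then g x (f x) else d) (Pi_pmf A d' p)"
    using assms by (simp add: map_pmf_def)
  finally show ?thesis .
qed

text \<open>Turns several families of seeds into a single product indexed by the variables, so that
  independence across variables can be applied to several runs at once.\<close>

lemma pair_Pi_pmf:
  assumes "finite A"
  shows "pair_pmf (Pi_pmf A d p) (Pi_pmf A d' q) =
    map_pmf (\<lambda>t. (\<lambda>x. fst (t x), \<lambda>x. snd (t x))) (Pi_pmf A (d, d') (\<lambda>x. pair_pmf (p x) (q x)))"
    (is "_ = map_pmf ?h ?T")
proof (rule pmf_eqI, clarify)
  fix f g
  have inj: "inj ?h" by (auto simp: inj_def fun_eq_iff prod_eq_iff)
  have "pmf (map_pmf ?h ?T) (?h (\<lambda>x. (f x, g x))) = pmf ?T (\<lambda>x. (f x, g x))"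
    by (rule pmf_map_inj'[OF inj])
  then have "pmf (map_pmf ?h ?T) (f, g) = pmf ?T (\<lambda>x. (f x, g x))" by simp
  also have "\<dots> = pmf (pair_pmf (Pi_pmf A d p) (Pi_pmf A d' q)) (f, g)"
    using assms by (auto simp: pmf_Pi pmf_pair prod.distrib)
  finally show "pmf (pair_pmf (Pi_pmf A d p) (Pi_pmf A d' q)) (f, g) = pmf (map_pmf ?h ?T) (f, g)" ..
qed

lemma Pi_pmf_pair_component:
  assumes "finite A" "i \<in> A" "j \<in> A" "i \<noteq> j"
  shows "map_pmf (\<lambda>f. (f i, f j)) (Pi_pmf A d p) = pair_pmf (p i) (p j)"
proof -
  have A: "A = insert i (A - {i})" using assms by auto
  have "map_pmf (\<lambda>f. (f i, f j)) (Pi_pmf A d p) =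
    bind_pmf (p i) (\<lambda>y. bind_pmf (Pi_pmf (A - {i}) d p) (\<lambda>f. return_pmf (y, f j)))"
    using assms by (subst A, subst Pi_pmf_insert') (auto simp: map_bind_pmf)
  also have "\<dots> = bind_pmf (p i) (\<lambda>y. bind_pmf (map_pmf (\<lambda>f. f j) (Pi_pmf (A - {i}) d p))
      (\<lambda>z. return_pmf (y, z)))"
    by (simp add: bind_map_pmf)
  also have "map_pmf (\<lambda>f. f j) (Pi_pmf (A - {i}) d p) = p j"
    using assms by (subst Pi_pmf_component) auto
  finally show ?thesis by (simp add: pair_pmf_def)
qed

definition depends_on :: "('i \<Rightarrow> 's) set \<Rightarrow> 'i set \<Rightarrow> bool" where
  "depends_on E A \<longleftrightarrow> (\<forall>\<omega> \<omega>'. (\<forall>i\<in>A. \<omega> i = \<omega>' i) \<longrightarrow> (\<omega> \<in> E \<longleftrightarrow> \<omega>' \<in> E))"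

text \<open>Split \<open>V\<close> into \<open>A\<close> and \<open>V - A\<close>: then
  \<open>E\<close> reads only the first part and \<open>F\<close> only the second.\<close>

lemma prob_Pi_pmf_indep:
  assumes "finite V" "A \<subseteq> V" "B \<subseteq> V" "A \<inter> B = {}" "depends_on E A" "depends_on F B"
  shows "measure_pmf.prob (Pi_pmf V d p) (E \<inter> F) =
    measure_pmf.prob (Pi_pmf V d p) E * measure_pmf.prob (Pi_pmf V d p) F"
proof -
  let ?PA = "Pi_pmf A d p" and ?PB = "Pi_pmf (V - A) d p"
  let ?h = "\<lambda>(f, g) x. if x \<in> A then f x else g x"
  have "A \<union> (V - A) = V" using assms by auto
  then have V: "Pi_pmf V d p = map_pmf ?h (pair_pmf ?PA ?PB)"
    using Pi_pmf_union[of A "V - A" d p] finite_subset[OF assms(2,1)] assms(1) by simp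
  have "?h (f, g) \<in> E \<longleftrightarrow> f \<in> E" for f g
  proof -
    have "\<forall>i\<in>A. ?h (f, g) i = f i" by auto
    then show ?thesis using assms(5) unfolding depends_on_def by blast
  qed
  moreover have "?h (f, g) \<in> F \<longleftrightarrow> g \<in> F" for f g
  proof -
    have "\<forall>i\<in>B. ?h (f, g) i = g i" using assms(4) by auto
    then show ?thesis using assms(6) unfolding depends_on_def by blast
  qed
  ultimately have "?h -` (E \<inter> F) = E \<times> F" "?h -` E = E \<times> UNIV" "?h -` F = UNIV \<times> F"
    by auto
  then show ?thesis
    unfolding V measure_map_pmf by (simp add: prob_pair_Times)
qed

text \<open>The variance of the count is a sum of covariances. Those of pairs outside
  \<open>D\<close> vanish, and the others are at most 1.\<close>

lemma Chebyshev_count: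
  assumes "finite V" "t > 0"
    and "\<And>x y. x \<in> V \<Longrightarrow> y \<in> V \<Longrightarrow> (x, y) \<notin> D \<Longrightarrow>
      measure_pmf.prob p (E x \<inter> E y) = measure_pmf.prob p (E x) * measure_pmf.prob p (E y)"
  shows "measure_pmf.prob p {\<omega>. \<bar>real (card {x \<in> V. \<omega> \<in> E x}) - (\<Sum>x\<in>V. measure_pmf.prob p (E x))\<bar> \<ge> t}
    \<le> card (V \<times> V \<inter> D) / t\<^sup>2"
proof -
  define H where "H = (\<lambda>\<omega>. \<Sum>x\<in>V. indicat_real (E x) \<omega>)"
  have H: "real (card {x \<in> V. \<omega> \<in> E x}) = H \<omega>" for \<omega>
    using assms(1) by (simp add: H_def indicator_def sum.If_cases Int_def conj_commute)
  have Hb: "\<bar>H \<omega>\<bar> \<le> card V" "0 \<le> H \<omega>" for \<omega>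
    using assms(1) unfolding H[symmetric] by (auto intro: card_mono)
  have int: "integrable (measure_pmf p) H" by (rule integrable_pmf_bounded) (rule Hb)
  have "\<bar>(H \<omega>)\<^sup>2\<bar> \<le> (real (card V))\<^sup>2" for \<omega>
    using Hb[of \<omega>] by (simp add: power_mono)
  then have int2: "integrable (measure_pmf p) (\<lambda>\<omega>. (H \<omega>)\<^sup>2)" by (rule integrable_pmf_bounded)
  have int_ind [simp]: "integrable (measure_pmf p) (indicat_real X)" for X
    by (rule integrable_pmf_bounded[where c = 1]) (simp add: indicator_def)
  have EH: "measure_pmf.expectation p H = (\<Sum>x\<in>V. measure_pmf.prob p (E x))"
    unfolding H_def
    by (subst Bochner_Integration.integral_sum) auto
  have H2: "(H \<omega>)\<^sup>2 = (\<Sum>x\<in>V. \<Sum>y\<in>V. indicat_real (E x \<inter> E y) \<omega>)" for \<omega>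
    by (simp add: H_def power2_eq_square sum_product indicator_inter_arith)
  have EH2: "measure_pmf.expectation p (\<lambda>\<omega>. (H \<omega>)\<^sup>2) =
      (\<Sum>x\<in>V. \<Sum>y\<in>V. measure_pmf.prob p (E x \<inter> E y))"
    unfolding H2 by (simp add: Bochner_Integration.integral_sum)
  have "measure_pmf.variance p H =
      (\<Sum>x\<in>V. \<Sum>y\<in>V. measure_pmf.prob p (E x \<inter> E y) - measure_pmf.prob p (E x) * measure_pmf.prob p (E y))"
    by (rule trans[OF measure_pmf.variance_eq[OF int int2]])
       (simp only: EH EH2, simp add: power2_eq_square sum_product sum_subtractf)
  also have "\<dots> \<le> (\<Sum>x\<in>V. \<Sum>y\<in>V. if (x, y) \<in> D then 1 else 0)"
  proof (intro sum_mono)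
    fix x y assume "x \<in> V" "y \<in> V"
    moreover have "measure_pmf.prob p (E x \<inter> E y) \<le> 1" by simp
    moreover have "0 \<le> measure_pmf.prob p (E x) * measure_pmf.prob p (E y)" by simp
    ultimately show "measure_pmf.prob p (E x \<inter> E y) - measure_pmf.prob p (E x) * measure_pmf.prob p (E y)
      \<le> (if (x, y) \<in> D then 1 else 0)"
      using assms(3)[of x y] by (smt (verit))
  qed
  also have "\<dots> = (\<Sum>z\<in>V \<times> V. if z \<in> D then 1 else 0)"
    by (simp only: sum.cartesian_product case_prod_eta case_prod_unfold prod.collapse)
  also have "\<dots> = card (V \<times> V \<inter> D)"
    using assms(1) by (simp add: sum.If_cases Int_def)
  finally have "measure_pmf.variance p H \<le> card (V \<times> V \<inter> D)" .
  moreover have "measure_pmf.prob p {\<omega>. \<bar>H \<omega> - measure_pmf.expectation p H\<bar> \<ge> t} \<le> measure_pmf.variance p H / t\<^sup>2"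
    using measure_pmf.Chebyshev_inequality[OF _ int2 \<open>t > 0\<close>] by simp
  ultimately show ?thesis
    unfolding H EH[symmetric] using divide_right_mono order_trans
    by (smt (verit, best) zero_le_power2)
qed

lemma exists_ge_expectation:
  fixes f :: "'a \<Rightarrow> real"
  assumes "\<And>x. \<bar>f x\<bar> \<le> c" "c' \<le> measure_pmf.expectation p f"
  shows "\<exists>x. c' \<le> f x"
proof (rule ccontr)
  assume "\<not> ?thesis"
  then have "f x < c'" for x by (auto simp: not_le)
  then have "measure_pmf.expectation p f < c'"
    by (intro measure_pmf.expectation_less integrable_pmf_bounded[OF assms(1)]) auto
  then show False using assms(2) by simp
qed

text \<open>With \<open>c = \<theta> / (2 * \<kappa>)\<close> the mean of "good minus
  \<open>c\<close> times bad" is at least \<open>\<theta> / 2\<close>. Any \<open>a\<close> that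
  attains this bound works: good is then at least \<open>\<theta> / 2\<close>, and good being at
  most 1 bounds bad by \<open>1 / c\<close>. The second components differ because success concerns
  one run and closeness of the distance concerns a pair.\<close>

lemma exists_good_condition:
  assumes "\<theta> > 0" "\<kappa> > 0" "\<theta> \<le> measure_pmf.prob (pair_pmf p q) {(a, b). G a b}"
    and "measure_pmf.prob (pair_pmf p q') {(a, b). B a b} \<le> \<kappa>"
  shows "\<exists>a. \<theta> / 2 \<le> measure_pmf.prob q {b. G a b} \<and> measure_pmf.prob q' {b. B a b} \<le> 2 * \<kappa> / \<theta>"
proof -
  let ?u = "\<lambda>a. measure_pmf.prob q {b. G a b}" and ?v = "\<lambda>a. measure_pmf.prob q' {b. B a b}"
  define c where "c = \<theta> / (2 * \<kappa>)"
  have c: "c > 0" using assms by (simp add: c_def)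
  have b: "\<bar>?u a - c * ?v a\<bar> \<le> 1 + c" for a
  proof -
    have "0 \<le> ?u a" by simp
    moreover have "?u a \<le> 1" by simp
    moreover have "0 \<le> c * ?v a" using c by simp
    moreover have "c * ?v a \<le> c * 1" using c by (intro mult_left_mono) auto
    ultimately show ?thesis by linarith
  qed
  have "measure_pmf.expectation p (\<lambda>a. ?u a - c * ?v a) =
     measure_pmf.expectation p ?u - c * measure_pmf.expectation p ?v"
    by (subst Bochner_Integration.integral_diff)
       (auto intro!: integrable_pmf_bounded[where c = 1])
  moreover have "c * measure_pmf.expectation p ?v \<le> c * \<kappa>"
    using assms(4) c unfolding prob_pair_Collect by (intro mult_left_mono) auto
  moreover have "c * \<kappa> = \<theta> / 2" using assms(2) by (simp add: c_def)
  ultimately have "\<theta> / 2 \<le> measure_pmf.expectation p (\<lambda>a. ?u a - c * ?v a)"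
    using assms(3) unfolding prob_pair_Collect by simp
  then obtain a where a: "\<theta> / 2 \<le> ?u a - c * ?v a"
    using exists_ge_expectation[where f = "\<lambda>a. ?u a - c * ?v a", OF b] by blast
  have "0 \<le> c * ?v a" using c by simp
  with a have "\<theta> / 2 \<le> ?u a" by simp
  moreover have "?v a \<le> 2 * \<kappa> / \<theta>"
  proof -
    have "?u a \<le> 1" by simp
    with a assms(1) have "c * ?v a \<le> 1" by linarith
    then show ?thesis using assms(1,2) by (simp add: c_def field_simps)
  qed
  ultimately show ?thesis by blast
qed

text \<open>Sample \<open>m\<close> independent points. All lie in \<open>G\<close> with probability
  \<open>measure_pmf.prob p G ^ m\<close>, and the left side of the assumption bounds the
  probability that some pair is bad.\<close>

lemma exists_tuple:
  assumes "real (m\<^sup>2) * measure_pmf.prob (pair_pmf p p) {(a, b). B a b} < measure_pmf.prob p G ^ m"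
  shows "\<exists>f :: nat \<Rightarrow> 'a. (\<forall>j<m. f j \<in> G) \<and> (\<forall>i<m. \<forall>j<m. i \<noteq> j \<longrightarrow> \<not> B (f i) (f j))"
proof -
  let ?P = "Pi_pmf {..<m} undefined (\<lambda>_. p)"
  let ?v = "measure_pmf.prob (pair_pmf p p) {(a, b). B a b}"
  define I where "I = {(i, j). i < m \<and> j < m \<and> i \<noteq> j}"
  have I: "finite I" "card I \<le> m\<^sup>2"
  proof -
    have "I \<subseteq> {..<m} \<times> {..<m}" by (auto simp: I_def)
    then show "finite I" "card I \<le> m\<^sup>2"
      using finite_subset card_mono[of "{..<m} \<times> {..<m}" I] by (auto simp: power2_eq_square)
  qed
  have v: "measure_pmf.prob ?P {f. B (f i) (f j)} = ?v" if "(i, j) \<in> I" for i j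
  proof -
    have "map_pmf (\<lambda>f. (f i, f j)) ?P = pair_pmf p p"
      using that by (intro Pi_pmf_pair_component) (auto simp: I_def)
    then have "?v = measure_pmf.prob (map_pmf (\<lambda>f. (f i, f j)) ?P) {(a, b). B a b}" by simp
    also have "\<dots> = measure_pmf.prob ?P {f. B (f i) (f j)}" by (simp add: vimage_def)
    finally show ?thesis ..
  qed
  have "measure_pmf.prob ?P (\<Union>(i, j)\<in>I. {f. B (f i) (f j)}) \<le> (\<Sum>(i, j)\<in>I. measure_pmf.prob ?P {f. B (f i) (f j)})"
    using I by (subst case_prod_unfold)+ (intro measure_pmf.finite_measure_subadditive_finite, auto)
  also have "\<dots> = (\<Sum>(i, j)\<in>I. ?v)" by (intro sum.cong) (auto simp: v)
  also have "\<dots> = real (card I) * ?v" by (simp add: case_prod_unfold)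
  also have "\<dots> \<le> real (m\<^sup>2) * ?v" using I by (intro mult_right_mono) (auto simp del: of_nat_power)
  also have "\<dots> < measure_pmf.prob p G ^ m" by (rule assms)
  also have "\<dots> = measure_pmf.prob ?P (Pi {..<m} (\<lambda>_. G))" by (simp add: measure_Pi_pmf_Pi)
  finally have less: "measure_pmf.prob ?P (\<Union>(i, j)\<in>I. {f. B (f i) (f j)}) <
      measure_pmf.prob ?P (Pi {..<m} (\<lambda>_. G))" .
  have "\<not> Pi {..<m} (\<lambda>_. G) \<subseteq> (\<Union>(i, j)\<in>I. {f. B (f i) (f j)})"
  proof
    assume "Pi {..<m} (\<lambda>_. G) \<subseteq> (\<Union>(i, j)\<in>I. {f. B (f i) (f j)})"
    then have "measure_pmf.prob ?P (Pi {..<m} (\<lambda>_. G)) \<le>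
        measure_pmf.prob ?P (\<Union>(i, j)\<in>I. {f. B (f i) (f j)})"
      by (rule measure_pmf.finite_measure_mono) simp
    with less show False by simp
  qed
  then obtain f where "f \<in> Pi {..<m} (\<lambda>_. G)" "f \<notin> (\<Union>(i, j)\<in>I. {f. B (f i) (f j)})" by blast
  then show ?thesis by (intro exI[of _ f]) (auto simp: I_def)
qed

section \<open>Runs with common early seeds\<close>

definition mix :: "nat \<Rightarrow> (nat \<Rightarrow> 's) \<Rightarrow> (nat \<Rightarrow> 's) \<Rightarrow> nat \<Rightarrow> 's" where
  "mix s a b = (\<lambda>i. if i \<le> s then a i else b i)"

text \<open>Choosing in each coordinate one of two independent copies yields the law of a single
  copy, so each interpolated run is distributed like the original algorithm. The outer map resets
  the coordinates outside \<open>V\<close>.\<close>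

lemma Pi_pmf_mix:
  assumes "finite V"
  shows "map_pmf (\<lambda>f x. if x \<in> V then f x else d)
      (map_pmf (\<lambda>(a, b). mix s a b) (pair_pmf (Pi_pmf V d (\<lambda>_. S)) (Pi_pmf V d (\<lambda>_. S)))) =
    Pi_pmf V d (\<lambda>_. S)"
proof -
  have "Pi_pmf V d (\<lambda>_. S) =
      Pi_pmf V d (\<lambda>x. map_pmf (\<lambda>p. if x \<le> s then fst p else snd p) (pair_pmf S S))"
  proof (intro Pi_pmf_cong refl)
    fix x
    show "S = map_pmf (\<lambda>p. if x \<le> s then fst p else snd p) (pair_pmf S S)"
      using map_fst_pair_pmf[of S S] map_snd_pair_pmf[of S S] by (cases "x \<le> s") simp_all
  qed
  also have "\<dots> = map_pmf (\<lambda>f x. if x \<in> V then (if x \<le> s then fst (f x) else snd (f x)) else d)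
      (Pi_pmf V (d, d) (\<lambda>_. pair_pmf S S))"
    by (rule Pi_pmf_map_dep[OF assms])
  also have "\<dots> = map_pmf (\<lambda>f x. if x \<in> V then f x else d)
      (map_pmf (\<lambda>(a, b). mix s a b) (pair_pmf (Pi_pmf V d (\<lambda>_. S)) (Pi_pmf V d (\<lambda>_. S))))"
    by (simp add: pair_Pi_pmf[OF assms] pmf.map_comp o_def mix_def cong: if_cong)
  finally show ?thesis ..
qed

lemma discrete_ivt:
  fixes D :: "nat \<Rightarrow> real"
  assumes "D 0 \<ge> c" "D n \<le> c" "\<And>s. s < n \<Longrightarrow> \<bar>D (Suc s) - D s\<bar> \<le> h" "h \<ge> 0"
  shows "\<exists>s. \<bar>D s - c\<bar> \<le> h"
  using assms
proof (induction n)
  case (Suc n)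
  show ?case
  proof (cases "D n \<le> c")
    case True
    then show ?thesis using Suc by auto
  next
    case False
    then show ?thesis using Suc.prems(2) Suc.prems(3)[of n] by (intro exI[of _ n]) auto
  qed
qed (auto intro: exI[of _ 0])

text \<open>The interpolation for an arbitrary function \<open>out\<close> of the seeds whose
  coordinates are local. The deviation \<open>w * n\<close> is spent half on the choice of
  \<open>s\<close> and half on Chebyshev, whose bound is \<open>4 * \<delta> / w\<^sup>2\<close>.
  Conditioning on the common seeds turns \<open>\<theta>\<close> into \<open>\<theta> / 2\<close>
  and this bound into \<open>8 * \<delta> / (w\<^sup>2 * \<theta>)\<close>; the last assumption is
  what the union bound over pairs then requires.\<close>

lemma interpolation_tuple:
  fixes out :: "(nat \<Rightarrow> 's) \<Rightarrow> nat \<Rightarrow> bool" and Z :: "nat \<Rightarrow> nat set" and n m :: nat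
    and d :: 's and S :: "'s pmf" and \<delta> \<theta> w a :: real
  defines "V \<equiv> {1..n}"
  defines "W \<equiv> Pi_pmf V d (\<lambda>_. S)"
  assumes "n > 0"
    and Zsub: "\<And>x. x \<in> V \<Longrightarrow> Z x \<subseteq> V"
    and local: "\<And>x \<omega> \<omega>'. x \<in> V \<Longrightarrow> (\<And>y. y \<in> Z x \<Longrightarrow> \<omega> y = \<omega>' y) \<Longrightarrow> out \<omega> x = out \<omega>' x"
    and half: "\<And>x. x \<in> V \<Longrightarrow> measure_pmf.prob W {\<omega>. out \<omega> x} = 1 / 2"
    and cardZ: "card (V \<times> V \<inter> {(x, y). Z x \<inter> Z y \<noteq> {}}) \<le> \<delta> * (real n)\<^sup>2"
    and \<delta>: "\<delta> > 0" "4 * \<delta> \<le> w\<^sup>2" and a: "0 < a" "a \<le> 1 / 2" and "w > 0"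
    and \<theta>: "\<theta> > 0" "\<theta> \<le> measure_pmf.prob W {\<omega>. P (out \<omega>)}"
    and P: "\<And>\<omega> \<omega>'. (\<And>x. x \<in> V \<Longrightarrow> \<omega> x = \<omega>' x) \<Longrightarrow> P (out \<omega>) \<longleftrightarrow> P (out \<omega>')"
    and m: "real (m\<^sup>2) * (8 * \<delta> / (w\<^sup>2 * \<theta>)) < (\<theta> / 2) ^ m"
  shows "\<exists>f :: nat \<Rightarrow> nat \<Rightarrow> bool. (\<forall>j<m. P (f j)) \<and>
    (\<forall>i<m. \<forall>j<m. i \<noteq> j \<longrightarrow> (a - w) * n \<le> card {x \<in> V. f i x \<noteq> f j x} \<and>
       card {x \<in> V. f i x \<noteq> f j x} \<le> (a + w) * n)"
proof -
  have V: "finite V" by (simp add: V_def)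
  \<comment> \<open>A single product space for three seed families: \<open>a\<close> supplies the
    common seeds, \<open>b\<close> and \<open>b'\<close> the later seeds of two runs.\<close>
  define U where "U = Pi_pmf V (d, (d, d)) (\<lambda>_. pair_pmf S (pair_pmf S S))"
  define R where "R = (\<lambda>t :: nat \<Rightarrow> 's \<times> 's \<times> 's. (\<lambda>x. fst (t x), (\<lambda>x. fst (snd (t x)), \<lambda>x. snd (snd (t x)))))"
  have U: "pair_pmf W (pair_pmf W W) = map_pmf R U"
    unfolding W_def U_def R_def using V by (simp add: pair_Pi_pmf pair_map_pmf2 pmf.map_comp o_def)
  define D where "D = (\<lambda>s x. {(a, (b, b')). out (mix s a b) x \<noteq> out (mix s a b') x})"
  define E where "E = (\<lambda>s. \<Sum>x\<in>V. measure_pmf.prob U (R -` D s x))"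
  have RD: "t \<in> R -` D s x \<longleftrightarrow>
      out (mix s (\<lambda>x. fst (t x)) (\<lambda>x. fst (snd (t x)))) x \<noteq> out (mix s (\<lambda>x. fst (t x)) (\<lambda>x. snd (snd (t x)))) x" for t s x
    by (simp add: R_def D_def)
  have En: "E n = 0"
  proof -
    have "R -` D n x = {}" if "x \<in> V" for x
    proof -
      have "out (mix n a b) x = out a x" for a b
        using Zsub[OF that] by (intro local[OF that]) (auto simp: mix_def V_def)
      then show ?thesis by (auto simp: D_def)
    qed
    then show ?thesis by (simp add: E_def)
  qed
  have E0: "E 0 = real n / 2"
  proof -
    have "measure_pmf.prob U (R -` D 0 x) = 1 / 2" if "x \<in> V" for x
    proof -
      let ?A = "{\<omega>. out \<omega> x}"
      have 0: "out (mix 0 a b) x = out b x" for a b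
        using Zsub[OF that] by (intro local[OF that]) (auto simp: mix_def V_def)
      have D0: "D 0 x = {(a, p). p \<in> ?A \<times> (- ?A) \<union> (- ?A) \<times> ?A}" by (auto simp: D_def 0)
      have "measure_pmf.prob U (R -` D 0 x) = measure_pmf.prob (pair_pmf W (pair_pmf W W)) (D 0 x)"
        by (simp add: U)
      also have "\<dots> = measure_pmf.prob (pair_pmf W W) (?A \<times> (- ?A) \<union> (- ?A) \<times> ?A)"
        unfolding D0 prob_pair_Collect by (simp add: Un_def del: Un_iff)
      also have "\<dots> = measure_pmf.prob (pair_pmf W W) (?A \<times> (- ?A)) + measure_pmf.prob (pair_pmf W W) ((- ?A) \<times> ?A)"
        by (intro measure_pmf.finite_measure_Union) auto
      also have "\<dots> = 1 / 2"
      proof -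
        have "measure_pmf.prob W (- ?A) = 1 / 2"
          using measure_pmf.prob_compl[of ?A W] half[OF that] by (simp add: Compl_eq_Diff_UNIV)
        then show ?thesis by (simp only: prob_pair_Times half[OF that])
      qed
      finally show ?thesis .
    qed
    then have "E 0 = (\<Sum>x\<in>V. 1 / 2)" unfolding E_def by (intro sum.cong refl)
    then show ?thesis by (simp add: V_def)
  qed
  have jump: "\<bar>E (Suc s) - E s\<bar> \<le> w / 2 * n" for s
  proof -
    \<comment> \<open>Only variables whose zone contains \<open>Suc s\<close> notice the change.
      Their zones meet pairwise, so \<open>cardZ\<close> bounds the square of their number.\<close>
    let ?X = "{x \<in> V. Suc s \<in> Z x}"
    have eq: "R -` D (Suc s) x = R -` D s x" if "x \<in> V" "x \<notin> ?X" for x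
    proof -
      have "out (mix (Suc s) a b) x = out (mix s a b) x" for a b
        using that by (intro local) (auto simp: mix_def le_Suc_eq)
      then show ?thesis by (auto simp: D_def)
    qed
    have "\<bar>E (Suc s) - E s\<bar> \<le> (\<Sum>x\<in>V. \<bar>measure_pmf.prob U (R -` D (Suc s) x) - measure_pmf.prob U (R -` D s x)\<bar>)"
      unfolding E_def sum_subtractf[symmetric] by (rule sum_abs)
    also have "\<dots> \<le> (\<Sum>x\<in>V. if x \<in> ?X then 1 else 0)"
    proof (intro sum_mono)
      fix x assume x: "x \<in> V"
      have "\<bar>measure_pmf.prob U (R -` D (Suc s) x) - measure_pmf.prob U (R -` D s x)\<bar> \<le> 1"
        using measure_pmf.prob_le_1[of U "R -` D (Suc s) x"] measure_pmf.prob_le_1[of U "R -` D s x"]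
          measure_nonneg[of U "R -` D (Suc s) x"] measure_nonneg[of U "R -` D s x"] by linarith
      then show "\<bar>measure_pmf.prob U (R -` D (Suc s) x) - measure_pmf.prob U (R -` D s x)\<bar> \<le> (if x \<in> ?X then 1 else 0)"
        using eq[OF x] by (cases "x \<in> ?X") auto
    qed
    also have "\<dots> = card ?X" using V by (simp add: sum.If_cases Int_def)
    finally have le: "\<bar>E (Suc s) - E s\<bar> \<le> card ?X" .
    have "?X \<times> ?X \<subseteq> V \<times> V \<inter> {(x, y). Z x \<inter> Z y \<noteq> {}}" by auto
    then have "card (?X \<times> ?X) \<le> card (V \<times> V \<inter> {(x, y). Z x \<inter> Z y \<noteq> {}})"
      using V by (intro card_mono) auto
    then have "(real (card ?X))\<^sup>2 \<le> \<delta> * (real n)\<^sup>2"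
      using cardZ by (simp add: card_cartesian_product power2_eq_square flip: of_nat_mult)
    also have "\<dots> \<le> (w / 2 * n)\<^sup>2"
    proof -
      have "\<delta> \<le> w\<^sup>2 / 4" using \<delta> by simp
      then have "\<delta> * (real n)\<^sup>2 \<le> w\<^sup>2 / 4 * (real n)\<^sup>2" by (rule mult_right_mono) simp
      then show ?thesis by (simp add: power_mult_distrib power_divide)
    qed
    finally have "card ?X \<le> w / 2 * n"
      by (rule power2_le_imp_le) (use \<open>w > 0\<close> in auto)
    with le show ?thesis by simp
  qed
  \<comment> \<open>The target lies between \<open>E n = 0\<close> and \<open>E 0 = n / 2\<close>
    because \<open>0 < a \<le> 1 / 2\<close>.\<close>
  obtain s where s: "\<bar>E s - a * n\<bar> \<le> w / 2 * n"
  proof -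
    have "a * n \<le> E 0" using mult_right_mono[OF a(2), of "real n"] E0 by simp
    moreover have "E n \<le> a * n" using En a by simp
    ultimately have "\<exists>s. \<bar>E s - a * n\<bar> \<le> w / 2 * n"
      by (rule discrete_ivt) (use jump \<open>w > 0\<close> in auto)
    then show ?thesis using that by blast
  qed
  define H where "H = (\<lambda>a b b'. real (card {x \<in> V. out (mix s a b) x \<noteq> out (mix s a b') x}))"
  define B where "B = (\<lambda>a b b'. w / 2 * n \<le> \<bar>H a b b' - E s\<bar>)"
  have bad: "measure_pmf.prob (pair_pmf W (pair_pmf W W)) {(a, p). B a (fst p) (snd p)} \<le> 4 * \<delta> / w\<^sup>2"
  proof -
    have "measure_pmf.prob (pair_pmf W (pair_pmf W W)) {(a, p). B a (fst p) (snd p)} =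
       measure_pmf.prob U {t. \<bar>real (card {x \<in> V. t \<in> R -` D s x}) - E s\<bar> \<ge> w / 2 * n}"
      unfolding U measure_map_pmf RD by (simp add: vimage_def B_def H_def R_def)
    also have "\<dots> \<le> card (V \<times> V \<inter> {(x, y). Z x \<inter> Z y \<noteq> {}}) / (w / 2 * n)\<^sup>2"
      unfolding E_def
    proof (rule Chebyshev_count)
      fix x y assume xy: "x \<in> V" "y \<in> V" "(x, y) \<notin> {(x, y). Z x \<inter> Z y \<noteq> {}}"
      have dep: "depends_on (R -` D s x) (Z x)" if "x \<in> V" for x
        unfolding depends_on_def RD
      proof (intro allI impI)
        fix t t' :: "nat \<Rightarrow> 's \<times> 's \<times> 's" assume t: "\<forall>i\<in>Z x. t i = t' i"
        have "out (mix s (\<lambda>x. fst (t x)) (\<lambda>x. fst (snd (t x)))) x = out (mix s (\<lambda>x. fst (t' x)) (\<lambda>x. fst (snd (t' x)))) x"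
          "out (mix s (\<lambda>x. fst (t x)) (\<lambda>x. snd (snd (t x)))) x = out (mix s (\<lambda>x. fst (t' x)) (\<lambda>x. snd (snd (t' x)))) x"
          using t by (auto intro!: local[OF that] simp: mix_def)
        then show "(out (mix s (\<lambda>x. fst (t x)) (\<lambda>x. fst (snd (t x)))) x \<noteq> out (mix s (\<lambda>x. fst (t x)) (\<lambda>x. snd (snd (t x)))) x) =
            (out (mix s (\<lambda>x. fst (t' x)) (\<lambda>x. fst (snd (t' x)))) x \<noteq> out (mix s (\<lambda>x. fst (t' x)) (\<lambda>x. snd (snd (t' x)))) x)"
          by simp
      qed
      show "measure_pmf.prob U (R -` D s x \<inter> R -` D s y) =
         measure_pmf.prob U (R -` D s x) * measure_pmf.prob U (R -` D s y)"
        unfolding U_def by (rule prob_Pi_pmf_indep[OF V Zsub[OF xy(1)] Zsub[OF xy(2)] _ dep[OF xy(1)] dep[OF xy(2)]])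
          (use xy in auto)
    qed (use V \<open>w > 0\<close> \<open>n > 0\<close> in auto)
    also have "\<dots> \<le> \<delta> * (real n)\<^sup>2 / (w / 2 * n)\<^sup>2"
      using cardZ by (intro divide_right_mono) auto
    also have "\<dots> = 4 * \<delta> / w\<^sup>2" using \<open>n > 0\<close> by (simp add: power_mult_distrib field_simps)
    finally show ?thesis .
  qed
  have succ: "\<theta> \<le> measure_pmf.prob (pair_pmf W W) {(a, b). P (out (mix s a b))}"
  proof -
    have "measure_pmf.prob W {\<omega>. P (out \<omega>)} =
       measure_pmf.prob (map_pmf (\<lambda>f x. if x \<in> V then f x else d)
         (map_pmf (\<lambda>(a, b). mix s a b) (pair_pmf W W))) {\<omega>. P (out \<omega>)}"
      unfolding W_def Pi_pmf_mix[OF V] ..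
    also have "\<dots> = measure_pmf.prob (pair_pmf W W) {(a, b). P (out (\<lambda>x. if x \<in> V then mix s a b x else d))}"
      by (simp add: vimage_def case_prod_unfold)
    also have "\<dots> = measure_pmf.prob (pair_pmf W W) {(a, b). P (out (mix s a b))}"
    proof -
      have "P (out (\<lambda>x. if x \<in> V then mix s a b x else d)) \<longleftrightarrow> P (out (mix s a b))" for a b
        by (rule P) simp
      then show ?thesis by (simp only:)
    qed
    finally show ?thesis using \<theta> by simp
  qed
  \<comment> \<open>Fix the common seeds such that a single run still succeeds often enough and two
    runs rarely have an atypical distance. From here on the runs are independent.\<close>
  obtain a0 where a0: "\<theta> / 2 \<le> measure_pmf.prob W {b. P (out (mix s a0 b))}"
      "measure_pmf.prob (pair_pmf W W) {p. B a0 (fst p) (snd p)} \<le> 2 * (4 * \<delta> / w\<^sup>2) / \<theta>"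
    using exists_good_condition[OF \<theta>(1) _ succ bad] \<delta> \<open>w > 0\<close> by auto
  have "real (m\<^sup>2) * measure_pmf.prob (pair_pmf W W) {(b, b'). B a0 b b'} \<le> real (m\<^sup>2) * (8 * \<delta> / (w\<^sup>2 * \<theta>))"
    using a0(2) by (intro mult_left_mono) (auto simp: case_prod_unfold field_simps)
  also have "\<dots> < (\<theta> / 2) ^ m" by (rule m)
  also have "\<dots> \<le> measure_pmf.prob W {b. P (out (mix s a0 b))} ^ m"
    using a0(1) \<theta> by (intro power_mono) auto
  finally obtain f :: "nat \<Rightarrow> nat \<Rightarrow> 's" where f: "\<forall>j<m. f j \<in> {b. P (out (mix s a0 b))}"
      "\<forall>i<m. \<forall>j<m. i \<noteq> j \<longrightarrow> \<not> B a0 (f i) (f j)"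
    using exists_tuple by blast
  show ?thesis
  proof (intro exI[of _ "\<lambda>j. out (mix s a0 (f j))"] conjI allI impI)
    fix i j assume ij: "i < m" "j < m" "i \<noteq> j"
    have "\<not> B a0 (f i) (f j)" using f(2) ij by blast
    then have "\<bar>H a0 (f i) (f j) - E s\<bar> < w / 2 * n" by (simp add: B_def)
    with s have "\<bar>H a0 (f i) (f j) - a * n\<bar> \<le> w * n" by linarith
    then show "(a - w) * n \<le> card {x \<in> V. out (mix s a0 (f i)) x \<noteq> out (mix s a0 (f j)) x}"
      "card {x \<in> V. out (mix s a0 (f i)) x \<noteq> out (mix s a0 (f j)) x} \<le> (a + w) * n"
      by (auto simp: H_def algebra_simps)
  qed (use f(1) in auto)
qed

section \<open>Weighted counting of walks\<close>

text \<open>Candidate walks independent of any formula, with the newest node at the head. A repeated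
  node must be among the \<open>M\<close> most recent ones: a step either discovers a node, and
  hence a new edge, or has at most \<open>M\<close> choices.\<close>

primrec walks :: "nat \<Rightarrow> nat \<Rightarrow> nat \<Rightarrow> nat \<Rightarrow> node list set" where
  "walks M n N 0 = (\<lambda>v. [VNode v]) ` {1..n}"
| "walks M n N (Suc k) = (\<lambda>(q, z). z # q) `
     (SIGMA q:walks M n N k. {z \<in> (if even k then CNode ` {..<N} else VNode ` {1..n}).
        z \<in> set q \<longrightarrow> z \<in> set (take M q)})"

text \<open>A set, so that an edge traversed repeatedly counts once. With
  \<open>\<rho> = K / n\<close>, the weight \<open>\<rho> ^ card (incs q)\<close> will bound the
  probability that all edges of the walk are present.\<close>

fun incs :: "node list \<Rightarrow> node set set" where
  "incs (z # y # q) = insert {z, y} (incs (y # q))"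
| "incs _ = {}"

lemma finite_incs [simp]: "finite (incs q)"
  by (induction q rule: incs.induct) auto

lemma incs_subset: "e \<in> incs q \<Longrightarrow> e \<subseteq> set q"
  by (induction q rule: incs.induct) auto

lemma finite_walks [simp]: "finite (walks M n N k)"
  by (induction k) auto

lemma walks_length: "q \<in> walks M n N k \<Longrightarrow> length q = Suc k"
  by (induction k arbitrary: q) auto

text \<open>Each step multiplies the total by at most \<open>C\<close>: new nodes contribute
  \<open>\<rho>\<close> each, and the at most \<open>M\<close> recent ones contribute at most 1
  each. For \<open>\<rho> = K / n\<close> and \<open>N\<close> at most \<open>d * n\<close> the
  constant \<open>C\<close> does not depend on \<open>n\<close>.\<close>

lemma walks_weight:
  assumes "0 \<le> \<rho>" "\<rho> \<le> 1" "real n * \<rho> + M \<le> C" "real N * \<rho> + M \<le> C"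
  shows "(\<Sum>q\<in>walks M n N k. \<rho> ^ card (incs q)) \<le> n * C ^ k"
proof (induction k)
  case 0
  have "inj_on (\<lambda>v. [VNode v]) {1..n}" by (auto simp: inj_on_def)
  then show ?case by (simp add: sum.reindex)
next
  case (Suc k)
  let ?T = "if even k then CNode ` {..<N} else VNode ` {1..n}"
  let ?Z = "\<lambda>q. {z \<in> ?T. z \<in> set q \<longrightarrow> z \<in> set (take M q)}"
  have T: "finite ?T" "real (card ?T) * \<rho> + M \<le> C"
    using assms by (auto simp: card_image inj_on_def)
  have C: "C \<ge> 0" using T(2) assms(1) by (smt (verit) mult_nonneg_nonneg of_nat_0_le_iff)
  have step: "(\<Sum>z\<in>?Z q. \<rho> ^ card (incs (z # q))) \<le> C * \<rho> ^ card (incs q)" if q: "q \<in> walks M n N k" for q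
  proof -
    obtain y q' where q': "q = y # q'" using walks_length[OF q] by (cases q) auto
    have "(\<Sum>z\<in>?Z q. \<rho> ^ card (incs (z # q))) \<le> (\<Sum>z\<in>?Z q. (if z \<in> set (take M q) then 1 else \<rho>) * \<rho> ^ card (incs q))"
    proof (intro sum_mono)
      fix z assume z: "z \<in> ?Z q"
      show "\<rho> ^ card (incs (z # q)) \<le> (if z \<in> set (take M q) then 1 else \<rho>) * \<rho> ^ card (incs q)"
      proof (cases "z \<in> set (take M q)")
        case True
        have "card (incs q) \<le> card (incs (z # q))" by (auto simp: q' intro: card_mono)
        then show ?thesis using True assms by (simp add: power_decreasing)
      next
        case False
        then have "z \<notin> set q" using z by auto
        then have "{z, y} \<notin> incs q" using incs_subset[of "{z, y}" q] by auto
        then show ?thesis using False by (simp add: q')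
      qed
    qed
    also have "\<dots> = (\<Sum>z\<in>?Z q. if z \<in> set (take M q) then 1 else \<rho>) * \<rho> ^ card (incs q)"
      by (simp add: sum_distrib_right)
    also have "\<dots> \<le> C * \<rho> ^ card (incs q)"
    proof (intro mult_right_mono)
      have "(\<Sum>z\<in>?Z q. if z \<in> set (take M q) then 1 else \<rho>) \<le>
          (\<Sum>z\<in>?Z q. \<rho> + (if z \<in> set (take M q) then 1 else 0))"
        using assms by (intro sum_mono) auto
      also have "\<dots> = card (?Z q) * \<rho> + card (?Z q \<inter> set (take M q))"
        using T by (simp add: sum.distrib sum.If_cases Int_def)
      also have "\<dots> \<le> card ?T * \<rho> + M"
      proof -
        have "card (?Z q) \<le> card ?T" using T by (intro card_mono) auto
        moreover have "card (?Z q \<inter> set (take M q)) \<le> M"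
          by (rule order_trans[OF card_mono[of "set (take M q)"]]) (auto intro: order_trans[OF card_length])
        ultimately show ?thesis using assms(1) by (intro add_mono mult_right_mono) auto
      qed
      finally show "(\<Sum>z\<in>?Z q. if z \<in> set (take M q) then 1 else \<rho>) \<le> C" using T(2) by linarith
    qed (use assms in auto)
    finally show ?thesis .
  qed
  have "(\<Sum>q\<in>walks M n N (Suc k). \<rho> ^ card (incs q)) =
      (\<Sum>(q, z)\<in>(SIGMA q:walks M n N k. ?Z q). \<rho> ^ card (incs (z # q)))"
    by (simp add: sum.reindex inj_on_def case_prod_unfold)
  also have "\<dots> = (\<Sum>q\<in>walks M n N k. \<Sum>z\<in>?Z q. \<rho> ^ card (incs (z # q)))"
    using T by (intro sum.Sigma[symmetric]) auto
  also have "\<dots> \<le> (\<Sum>q\<in>walks M n N k. C * \<rho> ^ card (incs q))" by (intro sum_mono step)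
  also have "\<dots> = C * (\<Sum>q\<in>walks M n N k. \<rho> ^ card (incs q))" by (simp add: sum_distrib_left)
  also have "\<dots> \<le> C * (n * C ^ k)" using Suc C by (intro mult_left_mono)
  finally show ?case by (simp add: mult_ac)
qed

lemma walks_nth:
  assumes "q \<in> walks M n N k" "p \<le> k"
  shows "(even (k - p) \<longrightarrow> q ! p \<in> VNode ` {1..n}) \<and> (odd (k - p) \<longrightarrow> q ! p \<in> CNode ` {..<N})"
  using assms
proof (induction k arbitrary: q p)
  case (Suc k)
  then show ?case by (cases p) (auto split: if_splits)
qed auto

lemma incs_walks:
  assumes "q \<in> walks M n N k" "e \<in> incs q"
  shows "\<exists>v\<in>{1..n}. \<exists>j<N. e = {VNode v, CNode j}"
  using assms
proof (induction k arbitrary: q)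
  case (Suc k)
  then obtain z q' where q: "q = z # q'" "q' \<in> walks M n N k" by auto
  then obtain y q'' where q': "q' = y # q''" using walks_length[OF q(2)] by (cases q') auto
  have "e = {z, y} \<or> e \<in> incs q'" using Suc.prems(2) by (simp add: q q')
  moreover have "\<exists>v\<in>{1..n}. \<exists>j<N. {z, y} = {VNode v, CNode j}"
    using walks_nth[OF Suc.prems(1), of 0] walks_nth[OF Suc.prems(1), of 1]
    by (cases "even k") (auto simp: q q' insert_commute)
  ultimately show ?case using Suc.IH[OF q(2)] by auto
qed auto

section \<open>Averaging over the names of the variables\<close>

primrec relabel :: "(nat \<Rightarrow> nat) \<Rightarrow> node \<Rightarrow> node" where
  "relabel \<pi> (VNode v) = VNode (\<pi> v)"
| "relabel \<pi> (CNode j) = CNode j"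

primrec var_of :: "node \<Rightarrow> nat" where
  "var_of (VNode v) = v"
| "var_of (CNode j) = 0"

lemma inj_relabel: "\<pi> permutes S \<Longrightarrow> inj (relabel \<pi>)"
proof (rule injI)
  fix u v assume "\<pi> permutes S" "relabel \<pi> u = relabel \<pi> v"
  then show "u = v" by (cases u; cases v) (auto dest: permutes_inj injD)
qed

lemma incs_map: "incs (map f q) = image f ` incs q"
  by (induction q rule: incs.induct) auto

lemma card_incs_relabel:
  assumes "\<pi> permutes S"
  shows "card (incs (map (relabel \<pi>) q)) = card (incs q)"
  unfolding incs_map by (intro card_image inj_on_image inj_on_subset[OF inj_relabel[OF assms]]) auto

lemma walks_relabel_subset:
  assumes "\<pi> permutes {1..n}" "q \<in> walks M n N k"
  shows "map (relabel \<pi>) q \<in> walks M n N k"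
  using assms(2)
proof (induction k arbitrary: q)
  case 0
  then show ?case using permutes_in_image[OF assms(1)] by auto
next
  case (Suc k)
  then obtain z q' where q: "q = z # q'" "q' \<in> walks M n N k"
    "z \<in> (if even k then CNode ` {..<N} else VNode ` {1..n})" "z \<in> set q' \<longrightarrow> z \<in> set (take M q')"
    by auto
  have "relabel \<pi> z \<in> (if even k then CNode ` {..<N} else VNode ` {1..n})"
    using q(3) permutes_in_image[OF assms(1)] by (auto split: if_splits)
  moreover have "relabel \<pi> z \<in> set (map (relabel \<pi>) q') \<longrightarrow> relabel \<pi> z \<in> set (take M (map (relabel \<pi>) q'))"
    using q(4) inj_relabel[OF assms(1)] by (auto simp: take_map inj_image_mem_iff)
  ultimately show ?case using Suc.IH[OF q(2)] by (force simp: q(1))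
qed

lemma walks_relabel_bij:
  assumes "\<pi> permutes {1..n}"
  shows "bij_betw (map (relabel \<pi>)) (walks M n N k) (walks M n N k)"
proof -
  have inj: "inj_on (map (relabel \<pi>)) (walks M n N k)"
    using inj_relabel[OF assms] by (auto simp: inj_on_def inj_map_eq_map)
  then have "map (relabel \<pi>) ` walks M n N k = walks M n N k"
    by (intro endo_inj_surj) (use walks_relabel_subset[OF assms] in auto)
  with inj show ?thesis by (simp add: bij_betw_def)
qed

text \<open>Every \<open>r\<close>-th node of the walk: the variables of the dependency chain that
  the walk follows. For even \<open>r\<close> these positions hold variables, so the default of
  \<open>var_of\<close> is not met.\<close>

definition posts :: "nat \<Rightarrow> nat \<Rightarrow> node list \<Rightarrow> nat list" where
  "posts r L q = map (\<lambda>i. var_of (q ! (i * r))) [0..<Suc L]"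

lemma length_posts: "length (posts r L q) = Suc L"
  by (simp add: posts_def)

text \<open>Compose a sorting \<open>\<pi>\<close> with a permutation \<open>\<sigma>\<close> of the
  entries of \<open>vs\<close>. The composite determines the image of \<open>set vs\<close>, hence
  \<open>\<pi>\<close> on the sorted list \<open>vs\<close>, hence \<open>\<sigma>\<close> and
  \<open>\<pi>\<close>. So this map into the permutations of \<open>S\<close> is injective.\<close>

lemma card_sorting_permutations:
  fixes S :: "'a :: linorder set"
  assumes "set vs \<subseteq> S" "finite S"
  shows "card {\<pi>. \<pi> permutes S \<and> sorted_wrt (<) (map \<pi> vs)} * fact (length vs) \<le> (fact (card S) :: nat)"
proof (cases "{\<pi>. \<pi> permutes S \<and> sorted_wrt (<) (map \<pi> vs)} = {}")
  case False
  let ?P = "{\<pi>. \<pi> permutes S \<and> sorted_wrt (<) (map \<pi> vs)}" and ?Q = "{\<sigma>. \<sigma> permutes set vs}"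
  obtain \<pi> :: "'a \<Rightarrow> 'a" where "sorted_wrt (<) (map \<pi> vs)" using False by auto
  then have dist: "distinct vs" by (simp add: strict_sorted_iff distinct_map)
  have "inj_on (\<lambda>(\<pi>, \<sigma>). \<pi> \<circ> \<sigma>) (?P \<times> ?Q)"
  proof (rule inj_onI, clarify)
    fix \<pi> \<sigma> \<pi>' \<sigma>' :: "'a \<Rightarrow> 'a"
    assume P: "\<pi> permutes S" "sorted_wrt (<) (map \<pi> vs)" "\<pi>' permutes S" "sorted_wrt (<) (map \<pi>' vs)"
      and Q: "\<sigma> permutes set vs" "\<sigma>' permutes set vs" and eq: "\<pi> \<circ> \<sigma> = \<pi>' \<circ> \<sigma>'"
    have "\<pi> ` set vs = (\<pi> \<circ> \<sigma>) ` set vs" using permutes_image[OF Q(1)] by (simp only: image_comp[symmetric])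
    also have "\<dots> = \<pi>' ` set vs" using permutes_image[OF Q(2)] by (simp only: eq image_comp[symmetric])
    finally have "map \<pi> vs = map \<pi>' vs"
      using P by (intro strict_sorted_equal) auto
    then have on: "\<pi> v = \<pi>' v" if "v \<in> set vs" for v using that by simp
    have "\<sigma> v = \<sigma>' v" for v
    proof (cases "v \<in> set vs")
      case True
      then have "\<sigma> v \<in> set vs" using permutes_in_image[OF Q(1)] by simp
      then have "\<pi>' (\<sigma> v) = \<pi>' (\<sigma>' v)" using fun_cong[OF eq, of v] on by simp
      then show ?thesis using permutes_inj[OF P(3)] by (auto dest: injD)
    next
      case False
      then show ?thesis using Q by (simp add: permutes_def)
    qed
    then have \<sigma>: "\<sigma> = \<sigma>'" by auto
    have "\<pi> v = \<pi>' v" for v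
      using fun_cong[OF eq, of "inv \<sigma> v"] permutes_surj[OF Q(1)] by (simp add: \<sigma>[symmetric] surj_f_inv_f)
    then show "\<pi> = \<pi>' \<and> \<sigma> = \<sigma>'" using \<sigma> by auto
  qed
  moreover have "(\<lambda>(\<pi>, \<sigma>). \<pi> \<circ> \<sigma>) ` (?P \<times> ?Q) \<subseteq> {\<pi>. \<pi> permutes S}"
    using assms permutes_subset by (auto intro!: permutes_compose)
  ultimately have "card (?P \<times> ?Q) \<le> card {\<pi>. \<pi> permutes S}"
    using finite_permutations[OF assms(2)] by (rule card_inj_on_le)
  moreover have "card ?Q = fact (length vs)"
    using dist by (intro card_permutations) (auto simp: distinct_card)
  moreover have "card {\<pi>. \<pi> permutes S} = fact (card S)"
    using assms by (intro card_permutations) auto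
  ultimately show ?thesis by (simp add: card_cartesian_product)
next
  case True
  then show ?thesis by (simp only: card.empty)
qed

text \<open>Permuting the names of the variables preserves the set of walks and their weights, so
  the sum equals its average over all \<open>fact n\<close> permutations. Each walk has increasing
  posts for at most a fraction \<open>1 / fact (Suc L)\<close> of them.\<close>

lemma sorted_walks_weight:
  assumes "0 \<le> \<rho>" "\<rho> \<le> 1" "real n * \<rho> + M \<le> C" "real N * \<rho> + M \<le> C" "even r"
  shows "(\<Sum>q\<in>{q \<in> walks M n N (L * r). sorted_wrt (<) (posts r L q)}. \<rho> ^ card (incs q))
    \<le> n * C ^ (L * r) / fact (Suc L)"
proof -
  let ?W = "walks M n N (L * r)" and ?P = "{\<pi>. \<pi> permutes {1..n}}"
  let ?s = "\<lambda>q. sorted_wrt (<) (posts r L q)"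
  define X where "X = (\<Sum>q\<in>{q \<in> ?W. ?s q}. \<rho> ^ card (incs q))"
  have fP: "finite ?P" "card ?P = fact n"
    using finite_permutations[of "{1..n}"] card_permutations[of "{1..n}" n] by auto
  have idx: "q ! (i * r) \<in> VNode ` {1..n}" if "q \<in> ?W" "i \<le> L" for q i
    using walks_nth[OF that(1), of "i * r"] that(2) \<open>even r\<close> by (auto simp flip: diff_mult_distrib)
  have posts: "set (posts r L q) \<subseteq> {1..n}" if "q \<in> ?W" for q
  proof
    fix v assume "v \<in> set (posts r L q)"
    then obtain i where "i \<le> L" "v = var_of (q ! (i * r))"
      by (auto simp: posts_def less_Suc_eq_le simp del: upt_Suc)
    then show "v \<in> {1..n}" using idx[OF that] by fastforce
  qed
  have posts_map: "posts r L (map (relabel \<pi>) q) = map \<pi> (posts r L q)" if "q \<in> ?W" for q \<pi>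
  proof -
    have "var_of (map (relabel \<pi>) q ! (i * r)) = \<pi> (var_of (q ! (i * r)))" if "i \<le> L" for i
      using idx[OF \<open>q \<in> ?W\<close> that] walks_length[OF \<open>q \<in> ?W\<close>] that by (subst nth_map) (auto simp: less_Suc_eq_le)
    then show ?thesis by (auto simp: posts_def)
  qed
  have eq: "X = (\<Sum>q\<in>?W. if sorted_wrt (<) (map \<pi> (posts r L q)) then \<rho> ^ card (incs q) else 0)"
    if "\<pi> permutes {1..n}" for \<pi>
  proof -
    have "X = (\<Sum>q\<in>?W. if ?s q then \<rho> ^ card (incs q) else 0)"
      unfolding X_def by (simp add: sum.If_cases Int_def)
    also have "\<dots> = (\<Sum>q\<in>?W. if ?s (map (relabel \<pi>) q) then \<rho> ^ card (incs (map (relabel \<pi>) q)) else 0)"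
      by (rule sum.reindex_bij_betw[OF walks_relabel_bij[OF that], symmetric])
    also have "\<dots> = (\<Sum>q\<in>?W. if sorted_wrt (<) (map \<pi> (posts r L q)) then \<rho> ^ card (incs q) else 0)"
      by (intro sum.cong refl) (simp add: posts_map card_incs_relabel[OF that])
    finally show ?thesis .
  qed
  have "fact n * X = (\<Sum>\<pi>\<in>?P. X)" using fP by simp
  also have "\<dots> = (\<Sum>\<pi>\<in>?P. \<Sum>q\<in>?W. if sorted_wrt (<) (map \<pi> (posts r L q)) then \<rho> ^ card (incs q) else 0)"
    by (intro sum.cong refl) (use eq in auto)
  also have "\<dots> = (\<Sum>q\<in>?W. \<Sum>\<pi>\<in>?P. if sorted_wrt (<) (map \<pi> (posts r L q)) then \<rho> ^ card (incs q) else 0)"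
    by (rule sum.swap)
  also have "\<dots> = (\<Sum>q\<in>?W. real (card {\<pi>. \<pi> permutes {1..n} \<and> sorted_wrt (<) (map \<pi> (posts r L q))}) * \<rho> ^ card (incs q))"
    using fP by (simp add: sum.If_cases Int_def)
  also have "\<dots> \<le> (\<Sum>q\<in>?W. fact n / fact (Suc L) * \<rho> ^ card (incs q))"
  proof (intro sum_mono mult_right_mono)
    fix q assume q: "q \<in> ?W"
    have "card {\<pi>. \<pi> permutes {1..n} \<and> sorted_wrt (<) (map \<pi> (posts r L q))} * fact (Suc L) \<le> (fact n :: nat)"
      using card_sorting_permutations[OF posts[OF q] finite_atLeastAtMost]
      unfolding length_posts by (simp del: fact_Suc)
    then have "real (card {\<pi>. \<pi> permutes {1..n} \<and> sorted_wrt (<) (map \<pi> (posts r L q))}) * fact (Suc L) \<le> fact n"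
      using of_nat_mono[where 'a = real] by (fastforce simp del: fact_Suc)
    then show "real (card {\<pi>. \<pi> permutes {1..n} \<and> sorted_wrt (<) (map \<pi> (posts r L q))}) \<le> fact n / fact (Suc L)"
      by (simp add: pos_le_divide_eq del: fact_Suc)
  qed (use assms in auto)
  also have "\<dots> = fact n / fact (Suc L) * (\<Sum>q\<in>?W. \<rho> ^ card (incs q))"
    by (simp add: sum_distrib_left)
  also have "\<dots> \<le> fact n / fact (Suc L) * (n * C ^ (L * r))"
    by (intro mult_left_mono walks_weight assms) auto
  finally have "fact n * X \<le> fact n * (n * C ^ (L * r) / fact (Suc L))" by simp
  then have "X \<le> n * C ^ (L * r) / fact (Suc L)"
    by (rule mult_left_le_imp_le) simp
  then show ?thesis unfolding X_def .
qed

section \<open>Dependency chains\<close>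

definition walk_in :: "inst \<Rightarrow> node list \<Rightarrow> bool" where
  "walk_in \<Phi> q \<longleftrightarrow> (\<forall>u v. {u, v} \<in> incs q \<longrightarrow> (u, v) \<in> factor_graph \<Phi>)"

lemma factor_graph_sym: "(u, v) \<in> factor_graph \<Phi> \<Longrightarrow> (v, u) \<in> factor_graph \<Phi>"
  unfolding factor_graph_conv by (rule inc_graph_sym)

lemma factor_graph_pow_sym: "(u, v) \<in> factor_graph \<Phi> ^^ k \<Longrightarrow> (v, u) \<in> factor_graph \<Phi> ^^ k"
proof (induction k arbitrary: v)
  case (Suc k)
  then obtain w where "(u, w) \<in> factor_graph \<Phi> ^^ k" "(w, v) \<in> factor_graph \<Phi>" by auto
  then show ?case using Suc.IH factor_graph_sym relpow_Suc_I2 by metis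
qed auto

lemma within_dist_sym: "within_dist \<Phi> r u v \<Longrightarrow> within_dist \<Phi> r v u"
  unfolding within_dist_def using factor_graph_pow_sym by blast

lemma within_dist_trans:
  "within_dist \<Phi> a u v \<Longrightarrow> within_dist \<Phi> b v w \<Longrightarrow> within_dist \<Phi> (a + b) u w"
  unfolding within_dist_def using relpow_trans add_mono by metis

lemma within_dist_mono: "within_dist \<Phi> a u v \<Longrightarrow> a \<le> b \<Longrightarrow> within_dist \<Phi> b u v"
  unfolding within_dist_def using order_trans by metis

text \<open>Go back and forth on the last edge. Dependency steps thereby become walks of length
  exactly \<open>r\<close>, which places the posts at multiples of \<open>r\<close>.\<close>

lemma factor_graph_pow_pad:
  assumes "(u, v) \<in> factor_graph \<Phi> ^^ k" "k > 0"
  shows "(u, v) \<in> factor_graph \<Phi> ^^ (k + 2 * i)"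
proof (induction i)
  case (Suc i)
  obtain m where m: "k + 2 * i = Suc m" using assms(2) by (cases "k + 2 * i") auto
  then obtain w where "(u, w) \<in> factor_graph \<Phi> ^^ m" "(w, v) \<in> factor_graph \<Phi>"
    using Suc by auto
  then have "(v, w) \<in> factor_graph \<Phi>" "(w, v) \<in> factor_graph \<Phi>" using factor_graph_sym by auto
  then have "(u, v) \<in> factor_graph \<Phi> ^^ Suc (Suc (k + 2 * i))"
    using Suc by (meson relpow_Suc_I)
  then show ?case by simp
qed (use assms in simp)

lemma within_dist_exact:
  assumes "within_dist \<Phi> r (VNode x) (VNode y)" "x \<noteq> y" "even r"
  shows "(VNode x, VNode y) \<in> factor_graph \<Phi> ^^ r"
proof -
  obtain k where k: "k \<le> r" "(VNode x, VNode y) \<in> factor_graph \<Phi> ^^ k"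
    using assms(1) by (auto simp: within_dist_def)
  have "k > 0" using k(2) assms(2) by (cases k) auto
  moreover have "even k" using k(2) by (rule factor_graph_parity)
  then have "k + 2 * ((r - k) div 2) = r" using k(1) assms(3) by auto
  ultimately show ?thesis using factor_graph_pow_pad[OF k(2), of "(r - k) div 2"] by simp
qed

definition inst_on :: "nat \<Rightarrow> nat \<Rightarrow> inst \<Rightarrow> bool" where
  "inst_on n N \<Phi> \<longleftrightarrow> vars \<Phi> = {1..n} \<and> length (clauses \<Phi>) = N \<and>
     (\<forall>C\<in>set (clauses \<Phi>). clause_vars C \<subseteq> {1..n})"

lemma factor_graph_types:
  assumes "inst_on n N \<Phi>"
  shows "(VNode y, v) \<in> factor_graph \<Phi> \<Longrightarrow> v \<in> CNode ` {..<N}"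
    "(CNode j, v) \<in> factor_graph \<Phi> \<Longrightarrow> v \<in> VNode ` {1..n}"
  using assms unfolding factor_graph_conv inst_on_def
  by (cases v; force dest: nth_mem)+

lemma sequence_walk:
  assumes \<Phi>: "inst_on n N \<Phi>" and G: "\<And>t. t < k \<Longrightarrow> (G t, G (Suc t)) \<in> factor_graph \<Phi>"
    and G0: "G 0 \<in> VNode ` {1..n}"
    and recall: "\<And>a b. a < b \<Longrightarrow> b \<le> k \<Longrightarrow> G a = G b \<Longrightarrow> b - a \<le> M"
  shows "rev (map G [0..<Suc k]) \<in> walks M n N k \<and> walk_in \<Phi> (rev (map G [0..<Suc k]))"
proof -
  have type: "G t \<in> (if even t then VNode ` {1..n} else CNode ` {..<N})" if "t \<le> k" for t
    using that
  proof (induction t)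
    case (Suc t)
    then have "(G t, G (Suc t)) \<in> factor_graph \<Phi>" using G by simp
    then show ?case using Suc factor_graph_types[OF \<Phi>] by (cases "even t") auto
  qed (use G0 in simp)
  have "rev (map G [0..<Suc i]) \<in> walks M n N i \<and> walk_in \<Phi> (rev (map G [0..<Suc i]))" if "i \<le> k" for i
    using that
  proof (induction i)
    case 0
    then show ?case using G0 by (auto simp: walk_in_def)
  next
    case (Suc i)
    let ?q = "rev (map G [0..<Suc i])"
    have IH: "?q \<in> walks M n N i" "walk_in \<Phi> ?q" using Suc by auto
    have q': "rev (map G [0..<Suc (Suc i)]) = G (Suc i) # ?q" by simp
    have "G (Suc i) \<in> set (take M ?q)" if "G (Suc i) \<in> set ?q"
    proof -
      obtain t where t: "t \<le> i" "G t = G (Suc i)"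
        using \<open>G (Suc i) \<in> set ?q\<close> by (auto simp: less_Suc_eq_le simp del: upt_Suc)
      then have M: "Suc i - t \<le> M" using recall[of t "Suc i"] Suc.prems by auto
      have "?q ! (i - t) = G t" using t by (simp add: rev_nth del: upt_Suc)
      moreover have "i - t < length (take M ?q)" using M t by auto
      ultimately show ?thesis using t by (metis nth_mem nth_take length_take min_less_iff_conj)
    qed
    then have "rev (map G [0..<Suc (Suc i)]) \<in> walks M n N (Suc i)"
      using IH(1) type[OF Suc.prems] unfolding q' by (force split: if_splits)
    moreover have "walk_in \<Phi> (rev (map G [0..<Suc (Suc i)]))"
    proof -
      have "?q = G i # rev (map G [0..<i])" by simp
      then have "incs (G (Suc i) # ?q) = insert {G (Suc i), G i} (incs ?q)" by simp
      moreover have "(G i, G (Suc i)) \<in> factor_graph \<Phi>" using G Suc.prems by simp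
      ultimately show ?thesis
        using IH(2) factor_graph_sym unfolding walk_in_def q' by (auto simp: doubleton_eq_iff)
    qed
    ultimately show ?case by blast
  qed
  then show ?thesis by blast
qed

text \<open>A shortest dependency chain does not revisit the surroundings of its posts. A walk along
  it can therefore only return to nodes which it has visited at most \<open>3 * r\<close> steps ago.\<close>

lemma induced_chain_walk:
  assumes \<Phi>: "inst_on n N \<Phi>" and r: "even r" "r > 0"
    and dep: "\<And>i. i < L \<Longrightarrow> (c (Suc i), c i) \<in> dep \<Phi> r"
    and far: "\<And>i j. j \<le> L \<Longrightarrow> i + 2 \<le> j \<Longrightarrow> \<not> within_dist \<Phi> r (VNode (c i)) (VNode (c j))"
    and c0: "c 0 \<in> vars \<Phi>"
  shows "\<exists>q\<in>walks (3 * r) n N (L * r). sorted_wrt (<) (posts r L q) \<and> walk_in \<Phi> q \<and> last q = VNode (c 0)"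
proof -
  have "\<exists>f. f 0 = VNode (c i) \<and> f r = VNode (c (Suc i)) \<and> (\<forall>s<r. (f s, f (Suc s)) \<in> factor_graph \<Phi>)" if "i < L" for i
    using dep[OF that] within_dist_exact[OF _ _ \<open>even r\<close>] unfolding dep_def relpow_fun_conv[symmetric] by auto
  then obtain g where g: "\<And>i. i < L \<Longrightarrow> g i 0 = VNode (c i)" "\<And>i. i < L \<Longrightarrow> g i r = VNode (c (Suc i))"
      "\<And>i s. i < L \<Longrightarrow> s < r \<Longrightarrow> (g i s, g i (Suc s)) \<in> factor_graph \<Phi>"
    by metis
  \<comment> \<open>Concatenation of the \<open>L\<close> segments. The endpoint needs its own case,
    since at time \<open>L * r\<close> the formula would refer to a further segment.\<close>
  define G where "G = (\<lambda>t. if t < L * r then g (t div r) (t mod r) else VNode (c L))"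
  have div: "t div r < L" if "t < L * r" for t using that by (simp add: less_mult_imp_div_less)
  have Gpost: "G (i * r) = VNode (c i)" if "i \<le> L" for i
    using that r g(1) by (auto simp: G_def le_less)
  have edge: "(G t, G (Suc t)) \<in> factor_graph \<Phi>" if t: "t < L * r" for t
  proof -
    have m: "t mod r < r" using r by simp
    have "G (Suc t) = g (t div r) (Suc (t mod r))"
    proof (cases "Suc (t mod r) = r")
      case True
      then have "Suc t = Suc (t div r) * r" by (metis add_Suc_right div_mult_mod_eq mult_Suc add.commute)
      then show ?thesis using Gpost[of "Suc (t div r)"] g(2)[OF div[OF t]] div[OF t] True by simp
    next
      case False
      then have s: "Suc t div r = t div r" "Suc t mod r = Suc (t mod r)"
        using m by (simp_all add: div_Suc mod_Suc)
      have "Suc t < L * r"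
      proof (rule ccontr)
        assume "\<not> Suc t < L * r"
        then have "Suc t = L * r" using t by simp
        then have "Suc t mod r = 0" by simp
        then show False using s by simp
      qed
      then show ?thesis using s by (simp add: G_def)
    qed
    then show ?thesis using g(3)[OF div[OF t] m] t by (simp add: G_def)
  qed
  have within: "within_dist \<Phi> s (g i 0) (g i s)" "within_dist \<Phi> (r - s) (g i s) (g i r)"
    if "i < L" "s \<le> r" for i s
  proof -
    have "(g i 0, g i s) \<in> factor_graph \<Phi> ^^ s"
      unfolding relpow_fun_conv using g(3)[OF that(1)] that(2) by (intro exI[of _ "g i"]) auto
    then show "within_dist \<Phi> s (g i 0) (g i s)" by (auto simp: within_dist_def)
    have "(g i s, g i r) \<in> factor_graph \<Phi> ^^ (r - s)"
      unfolding relpow_fun_conv using g(3)[OF that(1)] that(2) by (intro exI[of _ "\<lambda>k. g i (s + k)"]) auto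
    then show "within_dist \<Phi> (r - s) (g i s) (g i r)" by (auto simp: within_dist_def)
  qed
  \<comment> \<open>The first half of a segment is within \<open>r div 2\<close> of the post where
    it starts, the second half within \<open>r div 2\<close> of the post where it ends.\<close>
  have close: "\<exists>i\<le>L. (i = t div r \<or> i = Suc (t div r)) \<and> within_dist \<Phi> (r div 2) (VNode (c i)) (G t)" if "t \<le> L * r" for t
  proof (cases "t < L * r")
    case True
    let ?i = "t div r" and ?s = "t mod r"
    have i: "?i < L" and s: "?s \<le> r" using div[OF True] r by (auto intro: less_imp_le)
    have Gt: "G t = g ?i ?s" using True by (simp add: G_def)
    show ?thesis
    proof (cases "?s \<le> r div 2")
      case True
      then have "within_dist \<Phi> (r div 2) (VNode (c ?i)) (G t)"
        using within_dist_mono[OF within(1)[OF i s]] g(1)[OF i] by (simp add: Gt)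
      then show ?thesis using i by (intro exI[of _ ?i]) auto
    next
      case False
      then have "r - ?s \<le> r div 2" by linarith
      then have "within_dist \<Phi> (r div 2) (VNode (c (Suc ?i))) (G t)"
        using within_dist_sym[OF within_dist_mono[OF within(2)[OF i s]]] g(2)[OF i] by (simp add: Gt)
      then show ?thesis using i by (intro exI[of _ "Suc ?i"]) auto
    qed
  next
    case False
    then have "t = L * r" using that by simp
    then show ?thesis using r within_dist_refl by (intro exI[of _ L]) (auto simp: G_def)
  qed
  \<comment> \<open>A node visited at both times is close to a post of either time, so these two
    posts are within distance \<open>r\<close>. By \<open>far\<close> the later post index exceeds
    the earlier one by at most 1, and rounding each time to a post costs at most one further segment
    in total.\<close>
  have recall: "b - a \<le> 3 * r" if ab: "a < b" "b \<le> L * r" "G a = G b" for a b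
  proof -
    obtain i where i: "i \<le> L" "i = a div r \<or> i = Suc (a div r)" "within_dist \<Phi> (r div 2) (VNode (c i)) (G a)"
      using close[of a] ab by auto
    obtain j where j: "j \<le> L" "j = b div r \<or> j = Suc (b div r)" "within_dist \<Phi> (r div 2) (VNode (c j)) (G b)"
      using close[of b] ab by auto
    have "within_dist \<Phi> (r div 2 + r div 2) (VNode (c i)) (VNode (c j))"
      using within_dist_trans[OF i(3)] within_dist_sym[OF j(3)] ab(3) by simp
    moreover have "r div 2 + r div 2 = r" using r by auto
    ultimately have "\<not> i + 2 \<le> j" using far[OF j(1)] by auto
    then have "b div r \<le> a div r + 2" using i(2) j(2) by auto
    then have "(b div r) * r \<le> (a div r + 2) * r" by (rule mult_right_mono) simp
    moreover have "b = (b div r) * r + b mod r" "b mod r < r" using r by auto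
    moreover have "(a div r) * r \<le> a" by simp
    ultimately show ?thesis unfolding add_mult_distrib by linarith
  qed
  let ?q = "rev (map G [0..<Suc (L * r)])"
  have "G 0 \<in> VNode ` {1..n}" using Gpost[of 0] c0 \<Phi> by (auto simp: inst_on_def)
  then have q: "?q \<in> walks (3 * r) n N (L * r) \<and> walk_in \<Phi> ?q"
    by (intro sequence_walk[OF \<Phi>] edge recall)
  have "last ?q = VNode (c 0)" using Gpost[of 0] by (simp add: last_rev hd_map del: upt_Suc)
  \<comment> \<open>The chain descends from \<open>c 0\<close>, and the list has the newest node
    first, so the posts ascend.\<close>
  moreover have "sorted_wrt (<) (posts r L ?q)"
  proof -
    have decr: "c j < c i" if "i < j" "j \<le> L" for i j
      using that
    proof (induction j)
      case (Suc j)
      have "c (Suc j) < c j" using dep[of j] Suc.prems by (simp add: dep_def)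
      then show ?case using Suc by (cases "i = j") auto
    qed simp
    have "?q ! (i * r) = VNode (c (L - i))" if "i \<le> L" for i
    proof -
      define m where "m = L * r - i * r"
      have m: "m < Suc (L * r)" "length (map G [0..<Suc (L * r)]) - Suc (i * r) = m"
        by (simp_all add: m_def)
      have "i * r < length (map G [0..<Suc (L * r)])" using that by (simp add: less_Suc_eq_le)
      then have "?q ! (i * r) = map G [0..<Suc (L * r)] ! m" by (simp only: rev_nth m)
      also have "\<dots> = G m" using m(1) by (simp del: upt_Suc)
      finally have "?q ! (i * r) = G (L * r - i * r)" by (simp only: m_def)
      also have "\<dots> = VNode (c (L - i))" using Gpost[of "L - i"] by (simp add: diff_mult_distrib)
      finally show ?thesis .
    qed
    then have "posts r L ?q = map (\<lambda>i. c (L - i)) [0..<Suc L]"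
      unfolding posts_def by (intro map_cong refl) (auto simp del: upt_Suc)
    then show ?thesis
      using decr by (auto simp: sorted_wrt_iff_nth_less simp del: upt_Suc)
  qed
  ultimately show ?thesis using q by blast
qed

lemma dep_pow_within: "(z, x) \<in> dep \<Phi> r ^^ k \<Longrightarrow> within_dist \<Phi> (k * r) (VNode x) (VNode z)"
proof (induction k arbitrary: x)
  case (Suc k)
  then obtain y where "(z, y) \<in> dep \<Phi> r ^^ k" "(y, x) \<in> dep \<Phi> r" by auto
  then show ?case using Suc.IH within_dist_trans by (fastforce simp: dep_def)
qed (auto intro: within_dist_refl)

definition long_at :: "nat \<Rightarrow> nat \<Rightarrow> nat \<Rightarrow> nat \<Rightarrow> inst \<Rightarrow> nat \<Rightarrow> bool" where
  "long_at r L n N \<Phi> x \<longleftrightarrow>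
     (\<exists>q\<in>walks (3 * r) n N (L * r). sorted_wrt (<) (posts r L q) \<and> walk_in \<Phi> q \<and> last q = VNode x)"

text \<open>Take a shortest dependency chain from \<open>z\<close> to \<open>x\<close>. If it has at
  most \<open>L\<close> steps, then \<open>z\<close> is near \<open>x\<close>. Otherwise consider
  its \<open>L\<close> steps next to \<open>x\<close>: non-consecutive members are more than
  \<open>r\<close> apart, as a dependency between them would be a shortcut.\<close>

lemma zone_cases:
  assumes \<Phi>: "inst_on n N \<Phi>" and r: "even r" "r > 0" and x: "x \<in> vars \<Phi>" and z: "z \<in> zone \<Phi> r x"
  shows "long_at r L n N \<Phi> x \<or> within_dist \<Phi> (L * r) (VNode x) (VNode z)"
proof -
  define k where "k = (LEAST k. (z, x) \<in> dep \<Phi> r ^^ k)"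
  have ex: "\<exists>k. (z, x) \<in> dep \<Phi> r ^^ k" using z by (auto simp: zone_def rtrancl_power)
  have k: "(z, x) \<in> dep \<Phi> r ^^ k" unfolding k_def using LeastI_ex[OF ex] .
  have min: "k \<le> k'" if "(z, x) \<in> dep \<Phi> r ^^ k'" for k' unfolding k_def using that by (rule Least_le)
  show ?thesis
  proof (cases "k \<le> L")
    case True
    then show ?thesis using dep_pow_within[OF k] within_dist_mono by fastforce
  next
    case False
    obtain f where f: "f 0 = z" "f k = x" "\<And>i. i < k \<Longrightarrow> (f i, f (Suc i)) \<in> dep \<Phi> r"
      using k unfolding relpow_fun_conv by auto
    define c where "c = (\<lambda>i. f (k - i))"
    have dep: "(c (Suc i), c i) \<in> dep \<Phi> r" if "i < k" for i
      using f(3)[of "k - Suc i"] that by (simp add: c_def Suc_diff_Suc)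
    have decr: "c j < c i" if "i < j" "j \<le> k" for i j
      using that
    proof (induction j)
      case (Suc j)
      have "c (Suc j) < c j" using dep[of j] Suc.prems by (simp add: dep_def)
      then show ?case using Suc by (cases "i = j") auto
    qed simp
    have vars: "c i \<in> vars \<Phi>" if "i \<le> k" for i
      using that x f(2) dep[of "i - 1"] by (cases i) (auto simp: c_def dep_def)
    have path: "(f a, f b) \<in> dep \<Phi> r ^^ (b - a)" if "a \<le> b" "b \<le> k" for a b
      unfolding relpow_fun_conv using f(3) that by (intro exI[of _ "\<lambda>i. f (a + i)"]) auto
    have far: "\<not> within_dist \<Phi> r (VNode (c i)) (VNode (c j))" if ij: "j \<le> L" "i + 2 \<le> j" for i j
    proof
      assume "within_dist \<Phi> r (VNode (c i)) (VNode (c j))"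
      then have "(c j, c i) \<in> dep \<Phi> r"
        using vars decr[of i j] ij False by (auto simp: dep_def)
      then have "(f 0, f (k - i)) \<in> dep \<Phi> r ^^ Suc (k - j)"
        using path[of 0 "k - j"] by (auto simp: c_def intro: relpow_Suc_I)
      then have "(f 0, f k) \<in> dep \<Phi> r ^^ (Suc (k - j) + (k - (k - i)))"
        using path[of "k - i" k] by (intro relpow_trans) auto
      then have "k \<le> Suc (k - j) + (k - (k - i))" unfolding f by (rule min)
      then show False using ij False by simp
    qed
    have "c 0 = x" using f by (simp add: c_def)
    then have "long_at r L n N \<Phi> x"
      using induced_chain_walk[OF \<Phi> r, of L c] dep far False x unfolding long_at_def by auto
    then show ?thesis ..
  qed
qed

text \<open>If zones meet, then one of the two variables has a long chain, or the variables
  coincide, or they are joined by a walk of length exactly \<open>2 * L * r\<close>. For the latter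
  walks the recall bound equals the length and is no restriction.\<close>

lemma card_zones_meet:
  assumes \<Phi>: "inst_on n N \<Phi>" and r: "even r" "r > 0"
  shows "card (vars \<Phi> \<times> vars \<Phi> \<inter> {(x, y). zone \<Phi> r x \<inter> zone \<Phi> r y \<noteq> {}}) \<le>
    2 * n * card {q \<in> walks (3 * r) n N (L * r). sorted_wrt (<) (posts r L q) \<and> walk_in \<Phi> q} + n +
    card {q \<in> walks (2 * L * r) n N (2 * L * r). walk_in \<Phi> q}"
proof -
  let ?V = "vars \<Phi>"
  let ?Q = "{q \<in> walks (3 * r) n N (L * r). sorted_wrt (<) (posts r L q) \<and> walk_in \<Phi> q}"
  let ?Q' = "{q \<in> walks (2 * L * r) n N (2 * L * r). walk_in \<Phi> q}"
  let ?X = "{x \<in> ?V. long_at r L n N \<Phi> x}"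
  have V: "?V = {1..n}" using \<Phi> by (simp add: inst_on_def)
  have "?X \<subseteq> (\<lambda>q. var_of (last q)) ` ?Q"
  proof
    fix x assume "x \<in> ?X"
    then obtain q where "q \<in> ?Q" "last q = VNode x" by (auto simp: long_at_def)
    then show "x \<in> (\<lambda>q. var_of (last q)) ` ?Q" by (intro image_eqI[of _ _ q]) auto
  qed
  then have X: "card ?X \<le> card ?Q"
    by (rule order_trans[OF card_mono card_image_le, rotated 1]) auto
  have "?V \<times> ?V \<inter> {(x, y). zone \<Phi> r x \<inter> zone \<Phi> r y \<noteq> {}} \<subseteq>
    (?X \<times> ?V \<union> ?V \<times> ?X) \<union> (\<lambda>x. (x, x)) ` ?V \<union> (\<lambda>q. (var_of (last q), var_of (hd q))) ` ?Q'"
    (is "_ \<subseteq> ?A \<union> ?B \<union> ?C")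
  proof (rule subsetI, rule ccontr)
    fix p assume p: "p \<in> ?V \<times> ?V \<inter> {(x, y). zone \<Phi> r x \<inter> zone \<Phi> r y \<noteq> {}}" "p \<notin> ?A \<union> ?B \<union> ?C"
    then obtain x y z where xy: "p = (x, y)" and x: "x \<in> ?V" and y: "y \<in> ?V"
      and z: "z \<in> zone \<Phi> r x" "z \<in> zone \<Phi> r y" by auto
    have nl: "\<not> long_at r L n N \<Phi> x" "\<not> long_at r L n N \<Phi> y" and B: "(x, y) \<notin> ?B" and C: "(x, y) \<notin> ?C"
      using p(2) x y unfolding xy by blast+
    show False
    proof -
      have "within_dist \<Phi> (L * r) (VNode x) (VNode z)" "within_dist \<Phi> (L * r) (VNode y) (VNode z)"
        using zone_cases[OF \<Phi> r x z(1)] zone_cases[OF \<Phi> r y z(2)] nl by blast+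
      then have "within_dist \<Phi> (L * r + L * r) (VNode x) (VNode y)"
        using within_dist_trans within_dist_sym by blast
      moreover have "L * r + L * r = 2 * L * r" by simp
      ultimately have "(VNode x, VNode y) \<in> factor_graph \<Phi> ^^ (2 * L * r)"
        using B x by (intro within_dist_exact) auto
      then obtain G where G: "G 0 = VNode x" "G (2 * L * r) = VNode y"
          "\<forall>i<2 * L * r. (G i, G (Suc i)) \<in> factor_graph \<Phi>"
        unfolding relpow_fun_conv by auto
      let ?q = "rev (map G [0..<Suc (2 * L * r)])"
      have "?q \<in> walks (2 * L * r) n N (2 * L * r) \<and> walk_in \<Phi> ?q"
        using G x V by (intro sequence_walk[OF \<Phi>]) auto
      moreover have "last ?q = VNode x" using G by (simp add: last_rev hd_map del: upt_Suc)
      moreover have "hd ?q = VNode y" using G by simp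
      ultimately have "(x, y) \<in> ?C" by (intro image_eqI[of _ _ ?q]) auto
      then show ?thesis using C by simp
    qed
  qed
  then have "card (?V \<times> ?V \<inter> {(x, y). zone \<Phi> r x \<inter> zone \<Phi> r y \<noteq> {}}) \<le> card (?A \<union> ?B \<union> ?C)"
    by (intro card_mono) (auto simp: V)
  also have "\<dots> \<le> card (?X \<times> ?V) + card (?V \<times> ?X) + card ?B + card ?C"
    by (intro order_trans[OF card_Un_le] add_mono order.refl)
  also have "\<dots> \<le> card ?Q * n + n * card ?Q + n + card ?Q'"
    using X by (intro add_mono) (auto simp: card_cartesian_product V intro: order_trans[OF card_image_le] mult_right_mono)
  finally show ?thesis by (simp add: algebra_simps)
qed

section \<open>Random formulas\<close>

lemma prob_replicate_pmf:
  "measure_pmf.prob (replicate_pmf N p) {xs. length xs = N \<and> (\<forall>j<N. xs ! j \<in> B j)} =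
     (\<Prod>j<N. measure_pmf.prob p (B j))"
proof (induction N arbitrary: B)
  case (Suc N)
  have "replicate_pmf (Suc N) p = map_pmf (\<lambda>(x, xs). x # xs) (pair_pmf p (replicate_pmf N p))"
    by (simp add: map_pmf_def pair_pmf_def bind_assoc_pmf bind_return_pmf)
  moreover have "(\<lambda>(x, xs). x # xs) -` {xs. length xs = Suc N \<and> (\<forall>j<Suc N. xs ! j \<in> B j)} =
      B 0 \<times> {xs. length xs = N \<and> (\<forall>j<N. xs ! j \<in> B (Suc j))}"
    by (auto simp: All_less_Suc2)
  ultimately show ?case
    by (simp add: prob_pair_Times Suc.IH prod.lessThan_Suc_shift del: replicate_pmf.simps prod.lessThan_Suc)
qed simp

section \<open>Random variable sets and random clauses\<close>

definition ksets :: "nat \<Rightarrow> nat \<Rightarrow> nat set set" where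
  "ksets K n = {S. S \<subseteq> {1..n} \<and> card S = K}"

lemma ksets:
  assumes "K \<le> n"
  shows "finite (ksets K n)" "ksets K n \<noteq> {}" "card (ksets K n) = n choose K"
proof -
  have "ksets K n \<subseteq> Pow {1..n}" by (auto simp: ksets_def)
  then show f: "finite (ksets K n)" by (rule finite_subset) simp
  show c: "card (ksets K n) = n choose K" using n_subsets[of "{1..n}" K] by (simp add: ksets_def)
  then show "ksets K n \<noteq> {}" using assms by (metis card.empty binomial_eq_0_iff not_less)
qed

lemma prob_ksets:
  assumes "K \<le> n"
  shows "measure_pmf.prob (pmf_of_set (ksets K n)) A = card (ksets K n \<inter> A) / (n choose K)"
  using ksets[OF assms] by (simp add: measure_pmf_of_set)

text \<open>Factor by factor, \<open>(a - i) / (n - i)\<close> is at most \<open>a / n\<close>;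
  written without division.\<close>

lemma binomial_ratio_le: "a \<le> n \<Longrightarrow> (a choose K) * n ^ K \<le> a ^ K * (n choose K)"
proof (induction K)
  case (Suc K)
  have *: "(m choose Suc K) * Suc K = (m choose K) * (m - K)" for m
    using binomial_absorb_comp[of m K] binomial_absorption[of K m] by (simp add: mult_ac)
  have "(a - K) * n \<le> a * (n - K)"
    using Suc.prems by (simp add: diff_mult_distrib diff_mult_distrib2 diff_le_mono2)
  then have "((a choose K) * n ^ K) * ((a - K) * n) \<le> (a ^ K * (n choose K)) * (a * (n - K))"
    by (rule mult_le_mono[OF Suc.IH[OF Suc.prems]])
  then have "((a choose Suc K) * Suc K) * n ^ Suc K \<le> a ^ Suc K * ((n choose Suc K) * Suc K)"
    unfolding * by (simp add: mult_ac)
  then have "Suc K * ((a choose Suc K) * n ^ Suc K) \<le> Suc K * (a ^ Suc K * (n choose Suc K))"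
    by (simp only: mult_ac)
  then show ?case by (simp only: mult_le_cancel1)
qed simp

lemma prob_ksets_within:
  assumes "K \<le> n" "D \<subseteq> {1..n}" "n > 0"
  shows "measure_pmf.prob (pmf_of_set (ksets K n)) {S. S \<subseteq> D} \<le> (card D / n) ^ K"
proof -
  have D: "finite D" "card D \<le> n" using assms finite_subset card_mono[of "{1..n}" D] by auto
  have "ksets K n \<inter> {S. S \<subseteq> D} = {S. S \<subseteq> D \<and> card S = K}" using assms(2) by (auto simp: ksets_def)
  then have c: "card (ksets K n \<inter> {S. S \<subseteq> D}) = card D choose K" using n_subsets[OF D(1)] by simp
  have "real ((card D choose K) * n ^ K) \<le> real (card D ^ K * (n choose K))"
    using binomial_ratio_le[OF D(2)] of_nat_mono by blast
  moreover have "n choose K > 0" using assms(1) by simp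
  ultimately show ?thesis
    using assms(3) unfolding prob_ksets[OF assms(1)] c by (simp add: field_simps)
qed

text \<open>Factor by factor, \<open>(K - i) / (n - i)\<close> is at most \<open>K / n\<close>;
  written without division.\<close>

lemma binomial_diff_ratio_le:
  assumes "a \<le> K" "K \<le> n"
  shows "((n - a) choose (K - a)) * n ^ a \<le> K ^ a * (n choose K)"
  using assms(1)
proof (induction a)
  case (Suc a)
  let ?b = "(n - a) choose (K - a)" and ?b' = "(n - Suc a) choose (K - Suc a)"
  have eq: "(K - a) * ?b = (n - a) * ?b'"
    using times_binomial_minus1_eq[of "K - a" "n - a"] Suc.prems by simp
  have "K * a \<le> n * a" using assms(2) by (rule mult_right_mono) simp
  then have le: "n * (K - a) \<le> K * (n - a)"
    by (simp add: diff_mult_distrib2 mult.commute diff_le_mono2)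
  have "(n - a) * (?b' * n) = n * ((n - a) * ?b')" by (simp only: mult_ac)
  also have "\<dots> = ?b * (n * (K - a))" unfolding eq[symmetric] by (simp only: mult_ac)
  also have "\<dots> \<le> ?b * (K * (n - a))" by (rule mult_left_mono[OF le]) simp
  also have "\<dots> = (n - a) * (K * ?b)" by (simp only: mult_ac)
  finally have "(n - a) * (?b' * n) \<le> (n - a) * (K * ?b)" .
  then have "?b' * n \<le> K * ?b" using Suc.prems assms(2) by simp
  then have "(?b' * n) * n ^ a \<le> (K * ?b) * n ^ a" by (rule mult_right_mono) simp
  also have "\<dots> \<le> K * (K ^ a * (n choose K))" using Suc by (simp add: mult.assoc)
  finally show ?case by (simp add: mult_ac)
qed simp

lemma prob_ksets_contains:
  assumes "K \<le> n" "n > 0" "A \<subseteq> {1..n}"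
  shows "measure_pmf.prob (pmf_of_set (ksets K n)) {S. A \<subseteq> S} \<le> (K / n) ^ card A"
proof (cases "card A \<le> K")
  case True
  have fA: "finite A" using assms(3) finite_subset by auto
  have fin: "finite S" if "S \<subseteq> {1..n}" for S using that finite_subset by auto
  have "bij_betw (\<lambda>S. S - A) (ksets K n \<inter> {S. A \<subseteq> S}) {S. S \<subseteq> {1..n} - A \<and> card S = K - card A}"
    by (rule bij_betw_byWitness[where f' = "\<lambda>S. S \<union> A"])
       (use assms(3) fA True fin in \<open>auto simp: ksets_def card_Diff_subset card_Un_disjoint Int_commute disjoint_iff subset_iff\<close>)
  then have "card (ksets K n \<inter> {S. A \<subseteq> S}) = card {S. S \<subseteq> {1..n} - A \<and> card S = K - card A}"
    by (rule bij_betw_same_card)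
  also have "\<dots> = (n - card A) choose (K - card A)"
    using n_subsets[of "{1..n} - A" "K - card A"] card_Diff_subset[OF fA assms(3)] by simp
  finally have c: "card (ksets K n \<inter> {S. A \<subseteq> S}) = (n - card A) choose (K - card A)" .
  have "real (((n - card A) choose (K - card A)) * n ^ card A) \<le> real (K ^ card A * (n choose K))"
    using binomial_diff_ratio_le[OF True assms(1)] of_nat_mono by blast
  moreover have "n choose K > 0" using assms(1) by simp
  ultimately show ?thesis
    using assms(2) unfolding prob_ksets[OF assms(1)] c by (simp add: field_simps)
next
  case False
  have "card A \<le> card S" if "S \<subseteq> {1..n}" "A \<subseteq> S" for S
    using that finite_subset by (intro card_mono) auto
  then have "ksets K n \<inter> {S. A \<subseteq> S} = {}" using False by (auto simp: ksets_def)
  then show ?thesis unfolding prob_ksets[OF assms(1)] by simp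
qed

definition mk_clause :: "nat set \<Rightarrow> (nat \<Rightarrow> bool) \<Rightarrow> clause" where
  "mk_clause S p = \<lparr>lits = (\<lambda>x. (x, p x)) ` S, csgn = Zero\<rparr>"

lemma random_clause_conv:
  "random_clause K n = bind_pmf (pmf_of_set (ksets K n))
     (\<lambda>S. map_pmf (mk_clause S) (Pi_pmf S True (\<lambda>_. bernoulli_pmf (1 / 2))))"
  by (simp add: random_clause_def ksets_def map_pmf_def mk_clause_def)

lemma mk_clause_vars [simp]: "clause_vars (mk_clause S p) = S"
  by (force simp: mk_clause_def clause_vars_def)

lemma set_random_clause:
  assumes "K \<le> n" "C \<in> set_pmf (random_clause K n)"
  shows "\<exists>S\<in>ksets K n. \<exists>p. C = mk_clause S p"
  using assms ksets[OF assms(1)] by (auto simp: random_clause_conv)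

lemma prob_random_clause_le:
  assumes "K \<le> n"
    and "\<And>S. S \<in> ksets K n \<Longrightarrow>
      measure_pmf.prob (Pi_pmf S True (\<lambda>_. bernoulli_pmf (1 / 2))) {p. mk_clause S p \<in> X} \<le> (if S \<in> Y then c else 0)"
  shows "measure_pmf.prob (random_clause K n) X \<le> c * measure_pmf.prob (pmf_of_set (ksets K n)) Y"
proof -
  let ?P = "\<lambda>S. Pi_pmf S True (\<lambda>_. bernoulli_pmf (1 / 2))"
  have "measure_pmf.prob (random_clause K n) X =
     measure_pmf.expectation (pmf_of_set (ksets K n)) (\<lambda>S. measure_pmf.prob (?P S) {p. mk_clause S p \<in> X})"
    by (simp add: random_clause_conv prob_bind_pmf vimage_def)
  also have "\<dots> \<le> measure_pmf.expectation (pmf_of_set (ksets K n)) (\<lambda>S. c * indicat_real Y S)"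
  proof (rule integral_mono_AE)
    show "integrable (measure_pmf (pmf_of_set (ksets K n))) (\<lambda>S. measure_pmf.prob (?P S) {p. mk_clause S p \<in> X})"
      by (rule integrable_pmf_bounded[where c = 1]) simp
    show "integrable (measure_pmf (pmf_of_set (ksets K n))) (\<lambda>S. c * indicat_real Y S)"
      by (rule integrable_pmf_bounded[where c = "\<bar>c\<bar>"]) (simp add: indicator_def)
    have "measure_pmf.prob (?P S) {p. mk_clause S p \<in> X} \<le> c * indicat_real Y S" if "S \<in> ksets K n" for S
      using assms(2)[OF that] by (cases "S \<in> Y") simp_all
    then show "AE S in measure_pmf (pmf_of_set (ksets K n)). measure_pmf.prob (?P S) {p. mk_clause S p \<in> X} \<le> c * indicat_real Y S"
      using ksets[OF assms(1)] by (simp add: AE_measure_pmf_iff)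
  qed
  also have "\<dots> = c * measure_pmf.prob (pmf_of_set (ksets K n)) Y" by simp
  finally show ?thesis .
qed

lemma prob_clause_contains:
  assumes "K \<le> n" "n > 0" "A \<subseteq> {1..n}"
  shows "measure_pmf.prob (random_clause K n) {C. A \<subseteq> clause_vars C} \<le> (K / n) ^ card A"
proof -
  have "measure_pmf.prob (random_clause K n) {C. A \<subseteq> clause_vars C} \<le>
      1 * measure_pmf.prob (pmf_of_set (ksets K n)) {S. A \<subseteq> S}"
    by (rule prob_random_clause_le[OF assms(1)]) simp
  then show ?thesis using prob_ksets_contains[OF assms] by simp
qed

lemma satisfies_mk_clause:
  "satisfies_clause \<sigma> (mk_clause S p) \<longleftrightarrow> (\<exists>x\<in>S. p x = \<sigma> x) \<and> (\<exists>x\<in>S. p x \<noteq> \<sigma> x)"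
  by (auto simp: satisfies_clause_def mk_clause_def lit_val_def)

lemma prob_violates_given:
  assumes "finite S" "card S = K" "K > 0"
  shows "measure_pmf.prob (Pi_pmf S True (\<lambda>_. bernoulli_pmf (1 / 2))) {p. \<not> satisfies_clause \<sigma> (mk_clause S p)} =
    2 * (1 / 2) ^ K"
proof -
  let ?P = "Pi_pmf S True (\<lambda>_. bernoulli_pmf (1 / 2))"
  have S: "S \<noteq> {}" using assms by auto
  have half: "measure_pmf.prob ?P (Pi S (\<lambda>x. {f x})) = (1 / 2) ^ K" for f
    using assms by (simp add: measure_Pi_pmf_Pi measure_pmf_single)
  have "{p. \<not> satisfies_clause \<sigma> (mk_clause S p)} = Pi S (\<lambda>x. {\<not> \<sigma> x}) \<union> Pi S (\<lambda>x. {\<sigma> x})"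
    by (auto simp: satisfies_mk_clause Pi_def)
  also have "measure_pmf.prob ?P \<dots> =
     measure_pmf.prob ?P (Pi S (\<lambda>x. {\<not> \<sigma> x})) + measure_pmf.prob ?P (Pi S (\<lambda>x. {\<sigma> x}))"
    using S by (intro measure_pmf.finite_measure_Union) (auto simp: Pi_def)
  finally show ?thesis by (simp add: half)
qed

lemma ksetsD:
  assumes "S \<in> ksets K n" shows "finite S" "card S = K" "S \<subseteq> {1..n}"
  using assms finite_subset by (auto simp: ksets_def)

lemma prob_violates:
  assumes "K \<le> n" "K > 0"
  shows "measure_pmf.prob (random_clause K n) {C. \<not> satisfies_clause \<sigma> C} = 2 * (1 / 2) ^ K"
proof -
  have "measure_pmf.prob (random_clause K n) {C. \<not> satisfies_clause \<sigma> C} =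
     measure_pmf.expectation (pmf_of_set (ksets K n))
       (\<lambda>S. measure_pmf.prob (Pi_pmf S True (\<lambda>_. bernoulli_pmf (1 / 2))) {p. \<not> satisfies_clause \<sigma> (mk_clause S p)})"
    by (simp add: random_clause_conv prob_bind_pmf vimage_def)
  also have "\<dots> = measure_pmf.expectation (pmf_of_set (ksets K n)) (\<lambda>S. 2 * (1 / 2) ^ K)"
    using prob_violates_given ksetsD ksets[OF assms(1)] assms(2)
    by (intro integral_cong_AE) (auto simp: AE_measure_pmf_iff)
  finally show ?thesis by simp
qed

text \<open>A clause violated by \<open>\<sigma>\<close> has polarities equal to
  \<open>\<sigma>\<close> on all of \<open>S\<close> or opposite to it on all of \<open>S\<close>.
  If this also holds for \<open>\<sigma>'\<close>, then the two assignments agree on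
  \<open>S\<close> or are opposite on \<open>S\<close>, so \<open>S\<close> avoids \<open>D\<close>
  or lies inside it.\<close>

lemma prob_both_violated:
  fixes \<sigma> \<sigma>' :: "nat \<Rightarrow> bool"
  assumes "K \<le> n" "K > 0"
  defines "D \<equiv> {x \<in> {1..n}. \<sigma> x \<noteq> \<sigma>' x}"
  shows "measure_pmf.prob (random_clause K n) {C. \<not> satisfies_clause \<sigma> C \<and> \<not> satisfies_clause \<sigma>' C} \<le>
    2 * (1 / 2) ^ K * ((1 - card D / n) ^ K + (card D / n) ^ K)"
proof -
  let ?U = "pmf_of_set (ksets K n)"
  have n: "n > 0" using assms by simp
  have D: "D \<subseteq> {1..n}" "finite D" by (auto simp: D_def)
  have "measure_pmf.prob (random_clause K n) {C. \<not> satisfies_clause \<sigma> C \<and> \<not> satisfies_clause \<sigma>' C} \<le>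
     2 * (1 / 2) ^ K * measure_pmf.prob ?U ({S. S \<subseteq> {1..n} - D} \<union> {S. S \<subseteq> D})"
  proof (rule prob_random_clause_le[OF assms(1)])
    fix S assume "S \<in> ksets K n"
    note S = ksetsD[OF this]
    let ?P = "Pi_pmf S True (\<lambda>_. bernoulli_pmf (1 / 2))"
    let ?X = "{p. mk_clause S p \<in> {C. \<not> satisfies_clause \<sigma> C \<and> \<not> satisfies_clause \<sigma>' C}}"
    show "measure_pmf.prob ?P ?X \<le> (if S \<in> {S. S \<subseteq> {1..n} - D} \<union> {S. S \<subseteq> D} then 2 * (1 / 2) ^ K else 0)"
    proof (cases "S \<in> {S. S \<subseteq> {1..n} - D} \<union> {S. S \<subseteq> D}")
      case True
      have "measure_pmf.prob ?P ?X \<le> measure_pmf.prob ?P {p. \<not> satisfies_clause \<sigma> (mk_clause S p)}"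
        by (rule measure_pmf.finite_measure_mono) auto
      then show ?thesis using True prob_violates_given[OF S(1,2) assms(2)] by simp
    next
      case False
      then obtain x y where xy: "x \<in> S" "x \<in> D" "y \<in> S" "y \<notin> D" using S by auto
      then have "\<sigma> x \<noteq> \<sigma>' x" "\<sigma> y = \<sigma>' y" using S by (auto simp: D_def)
      then have "?X = {}" using xy by (auto simp: satisfies_mk_clause)
      then show ?thesis using False by (simp del: mem_Collect_eq Un_iff)
    qed
  qed
  also have "\<dots> \<le> 2 * (1 / 2) ^ K * ((1 - card D / n) ^ K + (card D / n) ^ K)"
  proof (intro mult_left_mono)
    have "measure_pmf.prob ?U ({S. S \<subseteq> {1..n} - D} \<union> {S. S \<subseteq> D}) \<le>
        measure_pmf.prob ?U {S. S \<subseteq> {1..n} - D} + measure_pmf.prob ?U {S. S \<subseteq> D}"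
      by (rule measure_Un_le) auto
    also have "\<dots> \<le> (card ({1..n} - D) / n) ^ K + (card D / n) ^ K"
      using D n by (intro add_mono prob_ksets_within assms) auto
    also have "card ({1..n} - D) / n = 1 - card D / n"
      using D n card_mono[OF _ D(1)] by (simp add: card_Diff_subset of_nat_diff field_simps)
    finally show "measure_pmf.prob ?U ({S. S \<subseteq> {1..n} - D} \<union> {S. S \<subseteq> D}) \<le> (1 - card D / n) ^ K + (card D / n) ^ K" .
  qed simp
  finally show ?thesis .
qed

text \<open>Bonferroni inequality of second order.\<close>

lemma prob_Union_ge:
  fixes m :: nat
  shows
  "measure_pmf.prob p (\<Union>i<m. E i) \<ge>
     (\<Sum>i<m. measure_pmf.prob p (E i)) - (\<Sum>i<m. \<Sum>j<i. measure_pmf.prob p (E j \<inter> E i))"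
proof (induction m)
  case (Suc m)
  have "measure_pmf.prob p (\<Union>i<Suc m. E i) = measure_pmf.prob p ((\<Union>i<m. E i) \<union> E m)"
    by (simp add: lessThan_Suc Un_commute)
  also have "\<dots> = measure_pmf.prob p (\<Union>i<m. E i) + measure_pmf.prob p (E m) - measure_pmf.prob p ((\<Union>i<m. E i) \<inter> E m)"
    by (rule measure_Un3) (auto simp: measure_pmf.fmeasurable_eq_sets)
  finally have "measure_pmf.prob p (\<Union>i<Suc m. E i) = measure_pmf.prob p (\<Union>i<m. E i) + measure_pmf.prob p (E m) - measure_pmf.prob p ((\<Union>i<m. E i) \<inter> E m)" .
  moreover have "measure_pmf.prob p ((\<Union>i<m. E i) \<inter> E m) \<le> (\<Sum>j<m. measure_pmf.prob p (E j \<inter> E m))"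
  proof -
    have eq: "(\<Union>i<m. E i) \<inter> E m = (\<Union>j<m. E j \<inter> E m)" by auto
    show ?thesis unfolding eq by (rule measure_pmf.finite_measure_subadditive_finite) auto
  qed
  ultimately show ?case using Suc by simp
qed simp

lemma prob_all_satisfied:
  fixes f :: "nat \<Rightarrow> nat \<Rightarrow> bool"
  assumes "K \<le> n" "K > 0" "\<eta> \<ge> 0"
    and \<eta>: "\<And>i j. i < m \<Longrightarrow> j < m \<Longrightarrow> i \<noteq> j \<Longrightarrow>
      (1 - card {x \<in> {1..n}. f i x \<noteq> f j x} / n) ^ K + (card {x \<in> {1..n}. f i x \<noteq> f j x} / n) ^ K \<le> \<eta>"
  shows "measure_pmf.prob (random_clause K n) {C. \<forall>j<m. satisfies_clause (f j) C} \<le>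
    1 - 2 * (1 / 2) ^ K * (m - (real m)\<^sup>2 * \<eta>)"
proof -
  let ?P = "random_clause K n"
  let ?E = "\<lambda>j. {C. \<not> satisfies_clause (f j) C}"
  have "(\<Sum>i<m. \<Sum>j<i. measure_pmf.prob ?P (?E j \<inter> ?E i)) \<le> (\<Sum>i<m. \<Sum>j<i. 2 * (1 / 2) ^ K * \<eta>)"
  proof (intro sum_mono)
    fix i j assume "i \<in> {..<m}" "j \<in> {..<i}"
    then have "(1 - card {x \<in> {1..n}. f j x \<noteq> f i x} / n) ^ K + (card {x \<in> {1..n}. f j x \<noteq> f i x} / n) ^ K \<le> \<eta>"
      by (intro \<eta>) auto
    then have le: "2 * (1 / 2) ^ K * ((1 - card {x \<in> {1..n}. f j x \<noteq> f i x} / n) ^ K +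
        (card {x \<in> {1..n}. f j x \<noteq> f i x} / n) ^ K) \<le> 2 * (1 / 2) ^ K * \<eta>"
      by (rule mult_left_mono) simp
    have eq: "?E j \<inter> ?E i = {C. \<not> satisfies_clause (f j) C \<and> \<not> satisfies_clause (f i) C}" by auto
    show "measure_pmf.prob ?P (?E j \<inter> ?E i) \<le> 2 * (1 / 2) ^ K * \<eta>"
      unfolding eq by (rule order_trans[OF prob_both_violated[OF assms(1,2)] le])
  qed
  also have "\<dots> \<le> 2 * (1 / 2) ^ K * ((real m)\<^sup>2 * \<eta>)"
  proof -
    have "(\<Sum>i<m. \<Sum>j<i. 2 * (1 / 2) ^ K * \<eta>) \<le> (\<Sum>i<m. \<Sum>j<m. 2 * (1 / 2) ^ K * \<eta>)"
      using assms(3) by (intro sum_mono sum_mono2) auto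
    then show ?thesis by (simp add: power2_eq_square mult_ac)
  qed
  finally have "2 * (1 / 2) ^ K * (m - (real m)\<^sup>2 * \<eta>) \<le> measure_pmf.prob ?P (\<Union>j<m. ?E j)"
    using prob_Union_ge[where E = ?E and m = m and p = ?P] by (simp add: prob_violates[OF assms(1,2)] algebra_simps)
  moreover have "{C. \<forall>j<m. satisfies_clause (f j) C} = UNIV - (\<Union>j<m. ?E j)" by auto
  ultimately show ?thesis
    using measure_pmf.prob_compl[of "\<Union>j<m. ?E j" ?P] by simp
qed

section \<open>First moment bounds for walks and for tuples of assignments\<close>

lemma prob_mono_support:
  assumes "\<And>x. x \<in> set_pmf p \<Longrightarrow> x \<in> A \<Longrightarrow> x \<in> B"
  shows "measure_pmf.prob p A \<le> measure_pmf.prob p B"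
  using assms by (intro measure_pmf.finite_measure_mono_AE) (auto simp: AE_measure_pmf_iff)

text \<open>Group the edges of the walk by their clause. Clauses are independent, clause
  \<open>j\<close> contains the prescribed variables \<open>A j\<close> with probability at most
  \<open>(K / n) ^ card (A j)\<close>, and the exponents add up to the number of distinct
  edges.\<close>

lemma prob_walk_in:
  assumes "K \<le> n" "n > 0" "N = nat \<lfloor>d * real n\<rfloor>" "q \<in> walks M n N k"
  shows "measure_pmf.prob (random_formula K d n) {\<Phi>. walk_in \<Phi> q} \<le> (K / n) ^ card (incs q)"
proof -
  define A where "A = (\<lambda>j. {v. {VNode v, CNode j} \<in> incs q})"
  have A: "A j \<subseteq> {1..n}" for j
    using incs_walks[OF assms(4)] by (fastforce simp: A_def doubleton_eq_iff)
  have "measure_pmf.prob (random_formula K d n) {\<Phi>. walk_in \<Phi> q} =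
      measure_pmf.prob (replicate_pmf N (random_clause K n)) {cs. walk_in \<lparr>vars = {1..n}, clauses = cs\<rparr> q}"
    by (simp add: random_formula_def assms(3) vimage_def)
  also have "\<dots> \<le> measure_pmf.prob (replicate_pmf N (random_clause K n))
      {cs. length cs = N \<and> (\<forall>j<N. cs ! j \<in> {C. A j \<subseteq> clause_vars C})}"
  proof (rule prob_mono_support)
    fix cs assume "cs \<in> set_pmf (replicate_pmf N (random_clause K n))"
      and w: "cs \<in> {cs. walk_in \<lparr>vars = {1..n}, clauses = cs\<rparr> q}"
    then have l: "length cs = N" by (auto simp: set_replicate_pmf)
    have "v \<in> clause_vars (cs ! j)" if "v \<in> A j" for v j
      using that w unfolding A_def walk_in_def factor_graph_conv by fastforce
    with l show "cs \<in> {cs. length cs = N \<and> (\<forall>j<N. cs ! j \<in> {C. A j \<subseteq> clause_vars C})}" by auto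
  qed
  also have "\<dots> = (\<Prod>j<N. measure_pmf.prob (random_clause K n) {C. A j \<subseteq> clause_vars C})"
    by (rule prob_replicate_pmf)
  also have "\<dots> \<le> (\<Prod>j<N. (K / n) ^ card (A j))"
    by (intro prod_mono conjI prob_clause_contains assms A) auto
  also have "\<dots> = (K / n) ^ (\<Sum>j<N. card (A j))" by (simp add: power_sum)
  also have "(\<Sum>j<N. card (A j)) = card (incs q)"
  proof -
    have fin: "finite (A j)" for j using A finite_subset by blast
    have "incs q = (\<lambda>(j, v). {VNode v, CNode j}) ` (SIGMA j:{..<N}. A j)"
    proof (intro equalityI subsetI)
      fix e assume "e \<in> incs q"
      with incs_walks[OF assms(4)] obtain v j where "j < N" "e = {VNode v, CNode j}" by blast
      with \<open>e \<in> incs q\<close> show "e \<in> (\<lambda>(j, v). {VNode v, CNode j}) ` (SIGMA j:{..<N}. A j)"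
        by (intro image_eqI[of _ _ "(j, v)"]) (auto simp: A_def)
    qed (auto simp: A_def)
    moreover have "inj_on (\<lambda>(j, v). {VNode v, CNode j}) (SIGMA j:{..<N}. A j)"
      by (auto simp: inj_on_def doubleton_eq_iff)
    ultimately have "card (incs q) = card (SIGMA j:{..<N}. A j)" by (simp add: card_image)
    then show ?thesis using fin by simp
  qed
  finally show ?thesis .
qed

text \<open>Exponential Markov bound: each counted set has weight
  \<open>l ^ card D \<ge> l powr h\<close>, and the weights of all subsets add up to
  \<open>(1 + l) ^ card V\<close>.\<close>

lemma card_small_subsets:
  fixes h l :: real
  assumes "finite V" "0 < l" "l \<le> 1"
  shows "card {D. D \<subseteq> V \<and> card D \<le> h} \<le> l powr (- h) * (1 + l) ^ card V"
proof -
  have "(\<Prod>x\<in>V. l + 1) = (\<Sum>D\<in>Pow V. (\<Prod>x\<in>D. l) * (\<Prod>x\<in>V - D. 1))"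
    by (rule prod_add[OF assms(1)])
  then have eq: "(1 + l) ^ card V = (\<Sum>D\<in>Pow V. l ^ card D)" by (simp add: add.commute)
  have "card {D. D \<subseteq> V \<and> card D \<le> h} * l powr h = (\<Sum>D\<in>{D. D \<subseteq> V \<and> card D \<le> h}. l powr h)" by simp
  also have "\<dots> \<le> (\<Sum>D\<in>{D. D \<subseteq> V \<and> card D \<le> h}. l ^ card D)"
  proof (intro sum_mono)
    fix D assume "D \<in> {D. D \<subseteq> V \<and> card D \<le> h}"
    then have "l powr h \<le> l powr (card D)" using assms by (intro powr_mono') auto
    then show "l powr h \<le> l ^ card D" using assms by (simp add: powr_realpow)
  qed
  also have "\<dots> \<le> (\<Sum>D\<in>Pow V. l ^ card D)" using assms by (intro sum_mono2) auto
  finally have "card {D. D \<subseteq> V \<and> card D \<le> h} * l powr h \<le> (1 + l) ^ card V" unfolding eq .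
  then show ?thesis using assms by (simp add: powr_minus field_simps)
qed

lemma prob_formula_all_satisfied:
  assumes "K \<le> n" "K > 0" "\<eta> \<ge> 0" "N = nat \<lfloor>d * real n\<rfloor>"
    and "\<And>i j. i < m \<Longrightarrow> j < m \<Longrightarrow> i \<noteq> j \<Longrightarrow>
      (1 - card {x \<in> {1..n}. f i x \<noteq> f j x} / n) ^ K + (card {x \<in> {1..n}. f i x \<noteq> f j x} / n) ^ K \<le> \<eta>"
  shows "measure_pmf.prob (random_formula K d n) {\<Phi>. \<forall>j<m. f j \<in> SAT \<Phi>} \<le>
    (1 - 2 * (1 / 2) ^ K * (m - (real m)\<^sup>2 * \<eta>)) ^ N"
proof -
  let ?G = "{C. \<forall>j<m. satisfies_clause (f j) C}"
  have "measure_pmf.prob (random_formula K d n) {\<Phi>. \<forall>j<m. f j \<in> SAT \<Phi>} =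
      measure_pmf.prob (replicate_pmf N (random_clause K n)) {cs. \<forall>j<m. f j \<in> SAT \<lparr>vars = {1..n}, clauses = cs\<rparr>}"
    by (simp add: random_formula_def assms(4) vimage_def)
  also have "\<dots> \<le> measure_pmf.prob (replicate_pmf N (random_clause K n)) {cs. length cs = N \<and> (\<forall>j<N. cs ! j \<in> ?G)}"
    by (rule prob_mono_support) (auto simp: set_replicate_pmf SAT_def)
  also have "\<dots> = measure_pmf.prob (random_clause K n) ?G ^ N"
    unfolding prob_replicate_pmf by simp
  also have "\<dots> \<le> (1 - 2 * (1 / 2) ^ K * (m - (real m)\<^sup>2 * \<eta>)) ^ N"
    by (intro power_mono prob_all_satisfied assms) auto
  finally show ?thesis .
qed

text \<open>Union bound over tuples: \<open>2 ^ n\<close> choices for the first assignment and a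
  Hamming ball around it for every entry. The lower bound \<open>lo\<close> on the distances makes
  \<open>\<eta>\<close> small.\<close>

lemma prob_tuple_le:
  fixes lo hi l \<eta> :: real
  assumes "K \<le> n" "K > 0" "\<eta> \<ge> 0" "N = nat \<lfloor>d * real n\<rfloor>" "m > 0" "hi \<ge> 0" "0 < l" "l \<le> 1"
    and "0 \<le> 1 - 2 * (1 / 2) ^ K * (m - (real m)\<^sup>2 * \<eta>)"
    and \<eta>: "\<And>k. lo \<le> real k \<Longrightarrow> real k \<le> hi \<Longrightarrow> k \<le> n \<Longrightarrow> (1 - k / n) ^ K + (k / n) ^ K \<le> \<eta>"
  shows "measure_pmf.prob (random_formula K d n) {\<Phi>. \<exists>f :: nat \<Rightarrow> nat \<Rightarrow> bool. (\<forall>j<m. f j \<in> SAT \<Phi>) \<and>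
      (\<forall>i<m. \<forall>j<m. i \<noteq> j \<longrightarrow> lo \<le> card {x \<in> {1..n}. f i x \<noteq> f j x} \<and> card {x \<in> {1..n}. f i x \<noteq> f j x} \<le> hi)} \<le>
    2 ^ n * (l powr (- hi) * (1 + l) ^ n) ^ m * (1 - 2 * (1 / 2) ^ K * (m - (real m)\<^sup>2 * \<eta>)) ^ N"
    (is "measure_pmf.prob ?R ?E \<le> 2 ^ n * ?B ^ m * ?p ^ N")
proof -
  let ?dist = "\<lambda>\<sigma> \<sigma>'. card {x \<in> {1..n}. (\<sigma> x :: bool) \<noteq> \<sigma>' x}"
  define cube where "cube = ({1..n} \<rightarrow>\<^sub>E UNIV :: (nat \<Rightarrow> bool) set)"
  define ball where "ball = (\<lambda>\<sigma>. {\<sigma>' \<in> cube. ?dist \<sigma> \<sigma>' \<le> hi})"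
  define T where "T = {f \<in> {..<m} \<rightarrow>\<^sub>E cube. \<forall>i<m. \<forall>j<m. i \<noteq> j \<longrightarrow> lo \<le> ?dist (f i) (f j) \<and> ?dist (f i) (f j) \<le> hi}"
  have cube: "finite cube" "card cube = 2 ^ n" by (auto simp: cube_def card_PiE finite_PiE)
  have finT: "finite T"
    by (rule finite_subset[of _ "{..<m} \<rightarrow>\<^sub>E cube"]) (auto simp: T_def finite_PiE cube)
  have ball: "card (ball \<sigma>) \<le> ?B" for \<sigma>
  proof -
    have "inj_on (\<lambda>\<sigma>'. {x \<in> {1..n}. \<sigma> x \<noteq> \<sigma>' x}) (ball \<sigma>)"
    proof (rule inj_onI)
      fix \<sigma>1 \<sigma>2 assume s: "\<sigma>1 \<in> ball \<sigma>" "\<sigma>2 \<in> ball \<sigma>"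
        and eq: "{x \<in> {1..n}. \<sigma> x \<noteq> \<sigma>1 x} = {x \<in> {1..n}. \<sigma> x \<noteq> \<sigma>2 x}"
      have "\<sigma>1 x = \<sigma>2 x" if "x \<in> {1..n}" for x using eq that by blast
      then show "\<sigma>1 = \<sigma>2" using s by (auto simp: ball_def cube_def intro: PiE_ext)
    qed
    then have "card (ball \<sigma>) \<le> card {D. D \<subseteq> {1..n} \<and> card D \<le> hi}"
      by (rule card_inj_on_le[where f = "\<lambda>\<sigma>'. {x \<in> {1..n}. \<sigma> x \<noteq> \<sigma>' x}"])
         (auto simp: ball_def intro: finite_subset[of _ "Pow {1..n}"])
    also have "\<dots> \<le> ?B" using card_small_subsets[of "{1..n}" l hi] assms by simp
    finally show ?thesis by simp
  qed
  have "T \<subseteq> (\<Union>\<sigma>\<in>cube. {..<m} \<rightarrow>\<^sub>E ball \<sigma>)"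
  proof
    fix f assume f: "f \<in> T"
    then have c: "f i \<in> cube" if "i < m" for i using that by (auto simp: T_def)
    have "f i \<in> ball (f 0)" if "i < m" for i
      using f c[OF that] that assms(5,6) by (cases "i = 0") (auto simp: T_def ball_def)
    then have "f \<in> {..<m} \<rightarrow>\<^sub>E ball (f 0)" using f by (auto simp: T_def)
    then show "f \<in> (\<Union>\<sigma>\<in>cube. {..<m} \<rightarrow>\<^sub>E ball \<sigma>)" using c[OF assms(5)] by blast
  qed
  then have "card T \<le> card (\<Union>\<sigma>\<in>cube. {..<m} \<rightarrow>\<^sub>E ball \<sigma>)"
    using cube by (intro card_mono finite_UN_I finite_PiE) (auto simp: ball_def)
  also have "\<dots> \<le> (\<Sum>\<sigma>\<in>cube. card ({..<m} \<rightarrow>\<^sub>E ball \<sigma>))" by (rule card_UN_le[OF cube(1)])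
  finally have "real (card T) \<le> (\<Sum>\<sigma>\<in>cube. real (card (ball \<sigma>)) ^ m)"
    by (simp add: card_PiE flip: of_nat_power of_nat_sum)
  also have "\<dots> \<le> (\<Sum>\<sigma>\<in>cube. ?B ^ m)" by (intro sum_mono power_mono ball) auto
  also have "\<dots> = 2 ^ n * ?B ^ m" by (simp add: cube)
  finally have cardT: "real (card T) \<le> 2 ^ n * ?B ^ m" .
  have "measure_pmf.prob ?R ?E \<le> measure_pmf.prob ?R (\<Union>f\<in>T. {\<Phi>. \<forall>j<m. f j \<in> SAT \<Phi>})"
  proof (rule prob_mono_support)
    fix \<Phi> assume \<Phi>: "\<Phi> \<in> set_pmf ?R" "\<Phi> \<in> ?E"
    then obtain f :: "nat \<Rightarrow> nat \<Rightarrow> bool" where f: "\<forall>j<m. f j \<in> SAT \<Phi>"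
      "\<forall>i<m. \<forall>j<m. i \<noteq> j \<longrightarrow> lo \<le> ?dist (f i) (f j) \<and> ?dist (f i) (f j) \<le> hi" by blast
    have v: "vars \<Phi> = {1..n}" using \<Phi>(1) by (auto simp: random_formula_def)
    have "restrict f {..<m} \<in> T" using f v by (auto simp: T_def SAT_def cube_def)
    moreover have "\<forall>j<m. restrict f {..<m} j \<in> SAT \<Phi>" using f(1) by simp
    ultimately show "\<Phi> \<in> (\<Union>f\<in>T. {\<Phi>. \<forall>j<m. f j \<in> SAT \<Phi>})" by blast
  qed
  also have "\<dots> \<le> (\<Sum>f\<in>T. measure_pmf.prob ?R {\<Phi>. \<forall>j<m. f j \<in> SAT \<Phi>})"
    using finT by (intro measure_pmf.finite_measure_subadditive_finite) auto
  also have "\<dots> \<le> (\<Sum>f\<in>T. ?p ^ N)"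
  proof (intro sum_mono prob_formula_all_satisfied assms(1-4))
    fix f i j assume f: "f \<in> T" "i < m" "j < m" "i \<noteq> j"
    have "?dist (f i) (f j) \<le> card {1..n}" by (rule card_mono) auto
    then show "(1 - ?dist (f i) (f j) / n) ^ K + (?dist (f i) (f j) / n) ^ K \<le> \<eta>"
      using f by (intro \<eta>) (auto simp: T_def)
  qed
  also have "\<dots> = card T * ?p ^ N" by simp
  also have "\<dots> \<le> 2 ^ n * ?B ^ m * ?p ^ N"
    by (intro mult_right_mono[OF cardT] zero_le_power assms(9))
  finally show ?thesis .
qed

section \<open>Balanced rules\<close>

lemma bernoulli_pmf_compl:
  assumes "0 \<le> p" "p \<le> 1"
  shows "bernoulli_pmf (1 - p) = map_pmf Not (bernoulli_pmf p)"
proof (rule pmf_eqI)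
  fix b
  have "pmf (map_pmf Not (bernoulli_pmf p)) (\<not> \<not> b) = pmf (bernoulli_pmf p) (\<not> b)"
    by (rule pmf_map_inj') (auto simp: inj_def)
  then show "pmf (bernoulli_pmf (1 - p)) b = pmf (map_pmf Not (bernoulli_pmf p)) b"
    using assms by (cases b) auto
qed

text \<open>Couple the runs so that they always choose opposite values; their instances then stay
  complementary. Only the value at a single \<open>x\<close> is compared, because both runs of the
  actual algorithm start from the same default assignment and cannot be opposite outside the
  instance.\<close>

lemma decimate_complement:
  assumes "good_inst K \<Psi>" "set xs \<subseteq> vars \<Psi>" "distinct xs" "even r" "local_rule K r \<tau>" "balanced K r \<tau>"
    and "x \<in> set xs \<or> \<sigma>1 x = (\<not> \<sigma>2 x)"
  shows "map_pmf (\<lambda>\<sigma>. \<sigma> x) (decimate r \<tau> xs (complement_inst \<Psi>) \<sigma>1) =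
    map_pmf (\<lambda>\<sigma>. \<not> \<sigma> x) (decimate r \<tau> xs \<Psi> \<sigma>2)"
  using assms(1,2,3,7)
proof (induction xs arbitrary: \<Psi> \<sigma>1 \<sigma>2)
  case (Cons y ys)
  let ?p = "\<tau> (nbhd \<Psi> y r, y)"
  have rooted: "(nbhd \<Psi> y r, y) \<in> rooted_SAT K r"
    using Cons.prems assms(4) by (intro nbhd_rooted) (auto simp: good_inst_def)
  have p: "0 \<le> ?p" "?p \<le> 1" using assms(5) rooted by (auto simp: local_rule_def Pi_def)
  have "\<tau> (nbhd (complement_inst \<Psi>) y r, y) = 1 - ?p"
    using assms(6) rooted by (auto simp: balanced_def nbhd_complement)
  then have "map_pmf (\<lambda>\<sigma>. \<sigma> x) (decimate r \<tau> (y # ys) (complement_inst \<Psi>) \<sigma>1) =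
    bind_pmf (bernoulli_pmf ?p) (\<lambda>b. map_pmf (\<lambda>\<sigma>. \<sigma> x)
      (decimate r \<tau> ys (fix_var y (\<not> b) (complement_inst \<Psi>)) (fun_upd \<sigma>1 y (\<not> b))))"
    by (simp add: bernoulli_pmf_compl[OF p] map_bind_pmf bind_map_pmf)
  also have "\<dots> = bind_pmf (bernoulli_pmf ?p) (\<lambda>b. map_pmf (\<lambda>\<sigma>. \<not> \<sigma> x)
      (decimate r \<tau> ys (fix_var y b \<Psi>) (fun_upd \<sigma>2 y b)))"
  proof (intro bind_pmf_cong refl)
    fix b
    have "fix_var y (\<not> b) (complement_inst \<Psi>) = complement_inst (fix_var y b \<Psi>)"
      using Cons.prems(1) by (intro fix_var_complement) (auto simp: good_inst_def)
    moreover have "map_pmf (\<lambda>\<sigma>. \<sigma> x) (decimate r \<tau> ys (complement_inst (fix_var y b \<Psi>)) (fun_upd \<sigma>1 y (\<not> b))) =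
      map_pmf (\<lambda>\<sigma>. \<not> \<sigma> x) (decimate r \<tau> ys (fix_var y b \<Psi>) (fun_upd \<sigma>2 y b))"
      using Cons.prems good_inst_fix_var
      by (intro Cons.IH) (auto simp: fix_var_def)
    ultimately show "map_pmf (\<lambda>\<sigma>. \<sigma> x)
        (decimate r \<tau> ys (fix_var y (\<not> b) (complement_inst \<Psi>)) (fun_upd \<sigma>1 y (\<not> b))) =
      map_pmf (\<lambda>\<sigma>. \<not> \<sigma> x) (decimate r \<tau> ys (fix_var y b \<Psi>) (fun_upd \<sigma>2 y b))" by simp
  qed
  also have "\<dots> = map_pmf (\<lambda>\<sigma>. \<not> \<sigma> x) (decimate r \<tau> (y # ys) \<Psi> \<sigma>2)"
    by (simp add: map_bind_pmf)
  finally show ?case .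
qed (auto simp: map_pmf_def bind_return_pmf)

text \<open>A formula with all signs \<open>Zero\<close> is its own complement, so the value of
  \<open>x\<close> and its negation have the same law.\<close>

lemma decimation_half:
  assumes "good_inst K \<Phi>" "complement_inst \<Phi> = \<Phi>" "even r" "local_rule K r \<tau>" "balanced K r \<tau>" "x \<in> vars \<Phi>"
  shows "measure_pmf.prob (decimation r \<tau> \<Phi>) {\<sigma>. \<sigma> x} = 1 / 2"
proof -
  let ?D = "decimation r \<tau> \<Phi>"
  have "finite (vars \<Phi>)" using assms(1) by (auto simp: good_inst_def reduced_instance_def)
  then have "map_pmf (\<lambda>\<sigma>. \<sigma> x) (decimate r \<tau> (sorted_list_of_set (vars \<Phi>)) (complement_inst \<Phi>) (\<lambda>_. undefined)) =
     map_pmf (\<lambda>\<sigma>. \<not> \<sigma> x) ?D"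
    unfolding decimation_def using assms by (intro decimate_complement) auto
  then have "map_pmf (\<lambda>\<sigma>. \<sigma> x) ?D = map_pmf (\<lambda>\<sigma>. \<not> \<sigma> x) ?D"
    by (simp add: assms(2) decimation_def)
  then have "measure_pmf.prob (map_pmf (\<lambda>\<sigma>. \<sigma> x) ?D) {True} = measure_pmf.prob (map_pmf (\<lambda>\<sigma>. \<not> \<sigma> x) ?D) {True}"
    by simp
  then have "measure_pmf.prob ?D {\<sigma>. \<sigma> x} = measure_pmf.prob ?D (UNIV - {\<sigma>. \<sigma> x})"
    by (simp add: vimage_def Compl_eq_Diff_UNIV[symmetric] Compl_eq)
  then show ?thesis using measure_pmf.prob_compl[of "{\<sigma>. \<sigma> x}" ?D] by simp
qed

lemma success_tuple:
  fixes \<delta> \<theta> w a :: real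
  assumes "good_inst K \<Phi>" "inst_on n N \<Phi>" "complement_inst \<Phi> = \<Phi>" "even r"
    and "local_rule K r \<tau>" "balanced K r \<tau>" "n > 0"
    and cardZ: "card (vars \<Phi> \<times> vars \<Phi> \<inter> {(x, y). zone \<Phi> r x \<inter> zone \<Phi> r y \<noteq> {}}) \<le> \<delta> * (real n)\<^sup>2"
    and \<delta>: "\<delta> > 0" "4 * \<delta> \<le> w\<^sup>2" and a: "0 < a" "a \<le> 1 / 2" "w > 0"
    and \<theta>: "\<theta> > 0" "\<theta> \<le> measure_pmf.prob (decimation r \<tau> \<Phi>) (SAT \<Phi>)"
    and m: "real (m\<^sup>2) * (8 * \<delta> / (w\<^sup>2 * \<theta>)) < (\<theta> / 2) ^ m"
  shows "\<exists>f :: nat \<Rightarrow> nat \<Rightarrow> bool. (\<forall>j<m. f j \<in> SAT \<Phi>) \<and>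
    (\<forall>i<m. \<forall>j<m. i \<noteq> j \<longrightarrow> (a - w) * n \<le> card {x \<in> {1..n}. f i x \<noteq> f j x} \<and>
       card {x \<in> {1..n}. f i x \<noteq> f j x} \<le> (a + w) * n)"
proof -
  have V: "vars \<Phi> = {1..n}" using assms(2) by (simp add: inst_on_def)
  let ?xs = "sorted_list_of_set {1..n}"
  define Q where "Q = queries r \<tau> ?xs \<Phi>"
  define out where "out = (\<lambda>\<omega>. run r \<tau> \<omega> ?xs \<Phi> (\<lambda>_. undefined))"
  let ?W = "Pi_pmf {1..n} (\<lambda>_. False) (\<lambda>_. seed Q)"
  have D: "decimation r \<tau> \<Phi> = map_pmf out ?W"
    unfolding decimation_def V out_def
    using decimate_run[of Q r \<tau> ?xs \<Phi> _ "\<lambda>_. False"] by (simp add: Q_def)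
  show ?thesis
  proof (rule interpolation_tuple[where Z = "zone \<Phi> r" and out = out and d = "\<lambda>_. False" and S = "seed Q"
        and \<delta> = \<delta> and \<theta> = \<theta> and P = "\<lambda>\<sigma>. \<sigma> \<in> SAT \<Phi>"])
    fix x assume x: "x \<in> {1..n}"
    show "zone \<Phi> r x \<subseteq> {1..n}"
    proof
      fix y assume "y \<in> zone \<Phi> r x"
      then have "(y, x) \<in> (dep \<Phi> r)\<^sup>*" by (simp add: zone_def)
      then show "y \<in> {1..n}" by (rule converse_rtranclE) (use x V in \<open>auto simp: dep_def\<close>)
    qed
    show "out \<omega> x = out \<omega>' x" if "\<And>y. y \<in> zone \<Phi> r x \<Longrightarrow> \<omega> y = \<omega>' y" for \<omega> \<omega>'
      unfolding out_def V[symmetric]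
      using run_zone_cong[OF assms(4), of \<Phi> x \<omega> \<omega>'] that x by (simp add: V)
    have "measure_pmf.prob ?W {\<omega>. out \<omega> x} = measure_pmf.prob (decimation r \<tau> \<Phi>) {\<sigma>. \<sigma> x}"
      by (simp add: D vimage_def)
    then show "measure_pmf.prob ?W {\<omega>. out \<omega> x} = 1 / 2"
      using decimation_half[OF assms(1,3-6), of x] x V by simp
  next
    show "\<theta> \<le> measure_pmf.prob ?W {\<omega>. out \<omega> \<in> SAT \<Phi>}"
      using \<theta>(2) by (simp add: D vimage_def)
    show "out \<omega> \<in> SAT \<Phi> \<longleftrightarrow> out \<omega>' \<in> SAT \<Phi>" if "\<And>x. x \<in> {1..n} \<Longrightarrow> \<omega> x = \<omega>' x" for \<omega> \<omega>'
    proof -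
      have "out \<omega> = out \<omega>'" unfolding out_def by (rule run_cong) (use that in auto)
      then show ?thesis by simp
    qed
    show "real (card ({1..n} \<times> {1..n} \<inter> {(x, y). zone \<Phi> r x \<inter> zone \<Phi> r y \<noteq> {}})) \<le> \<delta> * (real n)\<^sup>2"
      using cardZ by (simp only: V)
  qed (use assms in auto)
qed

lemma mk_clause_good:
  assumes "S \<in> ksets K n"
  shows "reduced_clause K (mk_clause S p)" "proper_clause (mk_clause S p)"
proof -
  have "inj_on (\<lambda>x. (x, p x)) S" by (auto simp: inj_on_def)
  then show "reduced_clause K (mk_clause S p)"
    using ksetsD[OF assms] by (auto simp: reduced_clause_def mk_clause_def card_image)
  show "proper_clause (mk_clause S p)"
    by (auto simp: proper_clause_def mk_clause_def inj_on_def)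
qed

lemma set_random_formula:
  assumes "K \<le> n" "\<Phi> \<in> set_pmf (random_formula K d n)"
  shows "good_inst K \<Phi>" "inst_on n (nat \<lfloor>d * real n\<rfloor>) \<Phi>" "complement_inst \<Phi> = \<Phi>"
proof -
  obtain cs where \<Phi>: "\<Phi> = \<lparr>vars = {1..n}, clauses = cs\<rparr>"
    and cs: "length cs = nat \<lfloor>d * real n\<rfloor>" "set cs \<subseteq> set_pmf (random_clause K n)"
    using assms(2) by (auto simp: random_formula_def set_replicate_pmf)
  have C: "\<exists>S\<in>ksets K n. \<exists>p. C = mk_clause S p" if "C \<in> set cs" for C
    using that cs(2) set_random_clause[OF assms(1)] by blast
  have C': "reduced_clause K C" "proper_clause C" "clause_vars C \<subseteq> {1..n}" "C\<lparr>csgn := flip_sign (csgn C)\<rparr> = C"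
    if "C \<in> set cs" for C
  proof -
    obtain S p where "S \<in> ksets K n" "C = mk_clause S p" using C[OF \<open>C \<in> set cs\<close>] by blast
    then show "reduced_clause K C" "proper_clause C" "clause_vars C \<subseteq> {1..n}" "C\<lparr>csgn := flip_sign (csgn C)\<rparr> = C"
      using mk_clause_good ksetsD(3) by (simp_all, simp add: mk_clause_def)
  qed
  show "good_inst K \<Phi>" using C' by (auto simp: \<Phi> good_inst_def reduced_instance_def)
  show "inst_on n (nat \<lfloor>d * real n\<rfloor>) \<Phi>" using C' cs by (auto simp: \<Phi> inst_on_def)
  have "map (\<lambda>C. C\<lparr>csgn := flip_sign (csgn C)\<rparr>) cs = cs" using C'(4) by (intro map_idI)
  then show "complement_inst \<Phi> = \<Phi>" by (simp add: \<Phi> complement_inst_def)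
qed

section \<open>Asymptotics\<close>

text \<open>Markov's inequality for the bound of \<open>card_zones_meet\<close>. The bases come from
  \<open>walks_weight\<close> with \<open>\<rho> = K / n\<close>: new variables contribute
  \<open>K\<close>, new clauses at most \<open>d * K\<close>, and the last summand is the recall
  bound.\<close>

lemma prob_zones_meet:
  fixes t d :: real
  assumes "K \<le> n" "n > 0" "d \<ge> 0" "even r" "r > 0" "t > 0"
  shows "measure_pmf.prob (random_formula K d n)
      {\<Phi>. t \<le> card (vars \<Phi> \<times> vars \<Phi> \<inter> {(x, y). zone \<Phi> r x \<inter> zone \<Phi> r y \<noteq> {}})} \<le>
    (2 * real n * (n * (K + d * K + 3 * real r) ^ (L * r) / fact (Suc L)) + n + n * (K + d * K + 2 * real L * real r) ^ (2 * L * r)) / t"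
    (is "measure_pmf.prob ?R ?E \<le> ?b / t")
proof -
  define N where "N = nat \<lfloor>d * real n\<rfloor>"
  let ?W = "\<lambda>q. {\<Phi>. walk_in \<Phi> q}" and ?\<rho> = "real K / real n"
  define Q where "Q = {q \<in> walks (3 * r) n N (L * r). sorted_wrt (<) (posts r L q)}"
  define Q' where "Q' = walks (2 * L * r) n N (2 * L * r)"
  define Y where "Y = (\<lambda>\<Phi>. 2 * real n * (\<Sum>q\<in>Q. indicat_real (?W q) \<Phi>) + n + (\<Sum>q\<in>Q'. indicat_real (?W q) \<Phi>))"
  have fin: "finite Q" "finite Q'" by (auto simp: Q_def Q'_def)
  have int: "integrable (measure_pmf ?R) (indicat_real X)" for X
    by (rule integrable_pmf_bounded[where c = 1]) (simp add: indicator_def)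
  have count: "(\<Sum>q\<in>A. indicat_real (?W q) \<Phi>) = card {q \<in> A. walk_in \<Phi> q}" if "finite A" for A \<Phi>
    using that by (simp add: indicator_def sum.If_cases Int_def)
  have le: "card (vars \<Phi> \<times> vars \<Phi> \<inter> {(x, y). zone \<Phi> r x \<inter> zone \<Phi> r y \<noteq> {}}) \<le> Y \<Phi>"
    if "\<Phi> \<in> set_pmf ?R" for \<Phi>
  proof -
    have "card (vars \<Phi> \<times> vars \<Phi> \<inter> {(x, y). zone \<Phi> r x \<inter> zone \<Phi> r y \<noteq> {}}) \<le>
        2 * n * card {q \<in> Q. walk_in \<Phi> q} + n + card {q \<in> Q'. walk_in \<Phi> q}"
      using card_zones_meet[OF set_random_formula(2)[OF assms(1) that] assms(4,5), of L]
      by (simp add: Q_def Q'_def N_def conj_assoc)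
    then have "real (card (vars \<Phi> \<times> vars \<Phi> \<inter> {(x, y). zone \<Phi> r x \<inter> zone \<Phi> r y \<noteq> {}})) \<le>
        real (2 * n * card {q \<in> Q. walk_in \<Phi> q} + n + card {q \<in> Q'. walk_in \<Phi> q})"
      by (rule of_nat_mono)
    also have "\<dots> = Y \<Phi>" by (simp add: Y_def count fin)
    finally show ?thesis .
  qed
  have "measure_pmf.prob ?R ?E \<le> measure_pmf.prob ?R {\<Phi>. t \<le> Y \<Phi>}"
    by (rule prob_mono_support) (use le in \<open>auto intro: order_trans\<close>)
  also have "\<dots> \<le> measure_pmf.expectation ?R Y / t"
  proof -
    have "integrable (measure_pmf ?R) Y" unfolding Y_def using int by auto
    moreover have "0 \<le> Y \<Phi>" for \<Phi> unfolding Y_def by (intro add_nonneg_nonneg mult_nonneg_nonneg sum_nonneg) auto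
    ultimately show ?thesis
      using integral_Markov_inequality_measure[of "measure_pmf ?R" Y UNIV t] assms(6) by simp
  qed
  also have "\<dots> \<le> ?b / t"
  proof (intro divide_right_mono)
    have \<rho>: "0 \<le> ?\<rho>" "?\<rho> \<le> 1" using assms(1,2) by auto
    have N: "real N * ?\<rho> \<le> d * K"
    proof -
      have "real N \<le> d * n" using assms(3) by (simp add: N_def)
      then have "real N * ?\<rho> \<le> d * n * ?\<rho>" using \<rho>(1) by (rule mult_right_mono)
      then show ?thesis using assms(2) by simp
    qed
    have n: "real n * ?\<rho> = K" using assms(2) by simp
    have W: "measure_pmf.prob ?R (?W q) \<le> ?\<rho> ^ card (incs q)" if "q \<in> walks M n N k" for q M k
      by (rule prob_walk_in[OF assms(1,2) N_def that])
    have dK: "0 \<le> d * K" using assms(3) by simp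
    have Q: "(\<Sum>q\<in>Q. measure_pmf.prob ?R (?W q)) \<le> n * (K + d * K + 3 * real r) ^ (L * r) / fact (Suc L)"
    proof -
      have "(\<Sum>q\<in>Q. measure_pmf.prob ?R (?W q)) \<le> (\<Sum>q\<in>Q. ?\<rho> ^ card (incs q))"
        by (intro sum_mono W) (auto simp: Q_def)
      also have "\<dots> \<le> n * (K + d * K + 3 * real r) ^ (L * r) / fact (Suc L)"
        unfolding Q_def by (rule sorted_walks_weight[OF \<rho> _ _ assms(4)]) (use n N dK in auto)
      finally show ?thesis .
    qed
    have Q': "(\<Sum>q\<in>Q'. measure_pmf.prob ?R (?W q)) \<le> n * (K + d * K + 2 * real L * real r) ^ (2 * L * r)"
    proof -
      have "(\<Sum>q\<in>Q'. measure_pmf.prob ?R (?W q)) \<le> (\<Sum>q\<in>Q'. ?\<rho> ^ card (incs q))"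
        by (intro sum_mono W) (auto simp: Q'_def)
      also have "\<dots> \<le> n * (K + d * K + 2 * real L * real r) ^ (2 * L * r)"
        unfolding Q'_def by (rule walks_weight[OF \<rho>]) (use n N dK in auto)
      finally show ?thesis .
    qed
    have "measure_pmf.expectation ?R Y =
      2 * real n * (\<Sum>q\<in>Q. measure_pmf.prob ?R (?W q)) + n + (\<Sum>q\<in>Q'. measure_pmf.prob ?R (?W q))"
      unfolding Y_def using int by (simp add: Bochner_Integration.integral_sum)
    also have "\<dots> \<le> ?b" by (intro add_mono mult_left_mono Q Q' order.refl) auto
    finally show "measure_pmf.expectation ?R Y \<le> ?b" .
  qed (use assms in auto)
  finally show ?thesis .
qed

lemma power_div_fact_Suc_tendsto_0: "(\<lambda>L. (x :: real) ^ L / fact (Suc L)) \<longlonglongrightarrow> 0"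
proof -
  have "(\<lambda>L. inverse (fact L) * (\<bar>x\<bar> ^ L) :: real) \<longlonglongrightarrow> 0"
    using summable_LIMSEQ_zero[OF summable_exp] .
  then show ?thesis
  proof (rule Lim_null_comparison[rotated], intro always_eventually allI)
    fix L
    have "\<bar>x\<bar> ^ L / fact (Suc L) \<le> \<bar>x\<bar> ^ L / (fact L :: real)"
      by (intro divide_left_mono fact_mono mult_pos_pos) auto
    then show "norm (x ^ L / fact (Suc L)) \<le> inverse (fact L) * \<bar>x\<bar> ^ L"
      by (simp add: power_abs field_simps del: fact_Suc)
  qed
qed

text \<open>First choose \<open>L\<close> so large that the factorial beats the exponential number
  of walks; this makes the contribution of long chains less than \<open>e / 2\<close>. With
  \<open>L\<close> fixed, the remaining terms are linear in \<open>n\<close> and vanish against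
  \<open>n\<^sup>2\<close>.\<close>

lemma zones_meet_tendsto:
  fixes \<delta> d :: real
  assumes "d \<ge> 0" "even r" "r > 0" "\<delta> > 0"
  shows "(\<lambda>n. measure_pmf.prob (random_formula K d n)
      {\<Phi>. \<delta> * (real n)\<^sup>2 \<le> card (vars \<Phi> \<times> vars \<Phi> \<inter> {(x, y). zone \<Phi> r x \<inter> zone \<Phi> r y \<noteq> {}})}) \<longlonglongrightarrow> 0"
proof (rule tendstoI)
  fix e :: real assume e: "e > 0"
  define C where "C = K + d * K + 3 * real r"
  have "(\<lambda>L. (C ^ r) ^ L / fact (Suc L)) \<longlonglongrightarrow> 0" by (rule power_div_fact_Suc_tendsto_0)
  then have "eventually (\<lambda>L. (C ^ r) ^ L / fact (Suc L) < e * \<delta> / 4) sequentially"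
    by (rule order_tendstoD) (use e assms in auto)
  then obtain L where L: "(C ^ r) ^ L / fact (Suc L) < e * \<delta> / 4"
    by (auto simp: eventually_sequentially)
  define D where "D = 1 + (K + d * K + 2 * real L * real r) ^ (2 * L * r)"
  have "(\<lambda>n. D / \<delta> / real n) \<longlonglongrightarrow> 0" by (rule lim_const_over_n)
  then have "eventually (\<lambda>n. D / \<delta> / real n < e / 2) sequentially"
    by (rule order_tendstoD) (use e in auto)
  then show "eventually (\<lambda>n. dist (measure_pmf.prob (random_formula K d n)
      {\<Phi>. \<delta> * (real n)\<^sup>2 \<le> card (vars \<Phi> \<times> vars \<Phi> \<inter> {(x, y). zone \<Phi> r x \<inter> zone \<Phi> r y \<noteq> {}})}) 0 < e) sequentially"
    using eventually_ge_at_top[of "max K 1"]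
  proof eventually_elim
    case (elim n)
    then have n: "K \<le> n" "n > 0" by auto
    have "measure_pmf.prob (random_formula K d n)
      {\<Phi>. \<delta> * (real n)\<^sup>2 \<le> card (vars \<Phi> \<times> vars \<Phi> \<inter> {(x, y). zone \<Phi> r x \<inter> zone \<Phi> r y \<noteq> {}})} \<le>
      (2 * real n * (n * C ^ (L * r) / fact (Suc L)) + n + n * (K + d * K + 2 * real L * real r) ^ (2 * L * r)) / (\<delta> * (real n)\<^sup>2)"
      unfolding C_def by (rule prob_zones_meet) (use assms n in auto)
    also have "\<dots> = 2 / \<delta> * ((C ^ r) ^ L / fact (Suc L)) + D / \<delta> / n"
      using assms(4) n(2) unfolding D_def
      by (simp add: power_mult[symmetric] mult.commute[of r L] field_simps power2_eq_square del: fact_Suc)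
    also have "\<dots> < e"
    proof -
      have "2 / \<delta> * ((C ^ r) ^ L / fact (Suc L)) < 2 / \<delta> * (e * \<delta> / 4)"
        using L assms(4) by (intro mult_strict_left_mono) auto
      also have "\<dots> = e / 2" using assms(4) by simp
      finally show ?thesis using elim(1) by linarith
    qed
    finally show ?case by simp
  qed
qed

text \<open>The assumption \<open>neg\<close> concerns the exponent per variable:
  \<open>ln 2\<close> for the first assignment, \<open>\<alpha> * (1 - ln \<alpha>)\<close> for each
  ball (from \<open>card_small_subsets\<close> with \<open>l = \<alpha>\<close>), and
  \<open>- s * d\<close> for the clauses. Rounding \<open>d * n\<close> down costs a factor
  \<open>exp s\<close>.\<close>

lemma tuple_tendsto:
  fixes \<alpha> \<beta> \<eta> d :: real
  assumes "K > 0" "m > 0" "0 < \<alpha>" "\<alpha> \<le> 1" "\<eta> \<ge> 0"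
    and \<eta>: "\<And>x. \<beta> \<le> x \<Longrightarrow> x \<le> \<alpha> \<Longrightarrow> (1 - x) ^ K + x ^ K \<le> \<eta>"
  defines "s \<equiv> 2 * (1 / 2) ^ K * (m - (real m)\<^sup>2 * \<eta>)"
  assumes s: "0 \<le> s" "s \<le> 1" and neg: "ln 2 + m * (\<alpha> * (1 - ln \<alpha>)) - s * d < 0"
  shows "(\<lambda>n. measure_pmf.prob (random_formula K d n)
      {\<Phi>. \<exists>f :: nat \<Rightarrow> nat \<Rightarrow> bool. (\<forall>j<m. f j \<in> SAT \<Phi>) \<and>
        (\<forall>i<m. \<forall>j<m. i \<noteq> j \<longrightarrow> \<beta> * n \<le> card {x \<in> {1..n}. f i x \<noteq> f j x} \<and>
           card {x \<in> {1..n}. f i x \<noteq> f j x} \<le> \<alpha> * n)}) \<longlonglongrightarrow> 0"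
    (is "(\<lambda>n. ?P n) \<longlonglongrightarrow> 0")
proof -
  define \<gamma> where "\<gamma> = ln 2 + m * (\<alpha> * (1 - ln \<alpha>)) - s * d"
  have "(\<lambda>n. exp s * exp \<gamma> ^ n) \<longlonglongrightarrow> exp s * 0"
    using neg by (intro tendsto_mult_left LIMSEQ_power_zero) (auto simp: \<gamma>_def)
  then have lim: "(\<lambda>n. exp s * exp \<gamma> ^ n) \<longlonglongrightarrow> 0" by simp
  show ?thesis
  proof (rule Lim_null_comparison[OF _ lim])
    show "eventually (\<lambda>n. norm (?P n) \<le> exp s * exp \<gamma> ^ n) sequentially"
      using eventually_ge_at_top[of K]
    proof eventually_elim
      case (elim n)
      then have n: "K \<le> n" "n > 0" using assms(1) by auto
      define N where "N = nat \<lfloor>d * real n\<rfloor>"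
      have "?P n \<le> 2 ^ n * (\<alpha> powr (- (\<alpha> * n)) * (1 + \<alpha>) ^ n) ^ m * (1 - s) ^ N"
        unfolding s_def
      proof (rule prob_tuple_le[OF n(1) assms(1) assms(5) N_def assms(2)])
        show "0 \<le> 1 - 2 * (1 / 2) ^ K * (real m - (real m)\<^sup>2 * \<eta>)" using s(2) by (simp add: s_def)
        fix k :: nat assume "\<beta> * n \<le> k" "k \<le> \<alpha> * n"
        then show "(1 - k / n) ^ K + (k / n) ^ K \<le> \<eta>"
          using n by (intro \<eta>) (auto simp: field_simps)
      qed (use assms in auto)
      also have "\<dots> \<le> exp (n * ln 2) * exp (m * (n * (\<alpha> * (1 - ln \<alpha>)))) * exp (- (s * (d * n - 1)))"
      proof (intro mult_mono)
        show "(2 :: real) ^ n \<le> exp (n * ln 2)" by (simp add: exp_of_nat_mult)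
        have "\<alpha> powr (- (\<alpha> * n)) = exp (- (\<alpha> * n) * ln \<alpha>)" using assms(3) by (simp add: powr_def)
        moreover have "(1 + \<alpha>) ^ n \<le> exp (n * \<alpha>)"
          using assms(3) by (simp add: exp_of_nat_mult power_mono exp_ge_add_one_self)
        ultimately have "\<alpha> powr (- (\<alpha> * n)) * (1 + \<alpha>) ^ n \<le> exp (- (\<alpha> * n) * ln \<alpha>) * exp (n * \<alpha>)"
          by simp
        also have "\<dots> = exp (n * (\<alpha> * (1 - ln \<alpha>)))" by (simp add: exp_add[symmetric] algebra_simps)
        finally have "(\<alpha> powr (- (\<alpha> * n)) * (1 + \<alpha>) ^ n) ^ m \<le> exp (n * (\<alpha> * (1 - ln \<alpha>))) ^ m"
          using assms(3) by (intro power_mono) auto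
        then show "(\<alpha> powr (- (\<alpha> * n)) * (1 + \<alpha>) ^ n) ^ m \<le> exp (m * (n * (\<alpha> * (1 - ln \<alpha>))))"
          by (simp add: exp_of_nat_mult)
        have "(1 - s) ^ N \<le> exp (- s) ^ N"
          using s exp_ge_add_one_self[of "- s"] by (intro power_mono) auto
        also have "\<dots> = exp (- (s * N))" by (simp add: exp_of_nat_mult[symmetric] mult.commute)
        also have "\<dots> \<le> exp (- (s * (d * n - 1)))"
        proof -
          have "d * n - 1 \<le> N" unfolding N_def by linarith
          then show ?thesis using s by (simp add: mult_left_mono)
        qed
        finally show "(1 - s) ^ N \<le> exp (- (s * (d * n - 1)))" .
      qed (use s assms in auto)
      also have "\<dots> = exp s * exp \<gamma> ^ n"
        by (simp add: exp_of_nat_mult[symmetric] exp_add[symmetric] \<gamma>_def algebra_simps)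
      finally show ?case by simp
    qed
  qed
qed

text \<open>In the last inequality \<open>(ln K + 1) / K\<close> is the maximal relative distance
  and \<open>1 - 2 / ln K - 2 / K\<close> bounds the loss from simultaneous violations. The outer
  bracket is of order \<open>\<epsilon> * (ln K)\<^sup>2 / K\<close>, so the left side grows like
  \<open>\<epsilon> * ln K\<close>.\<close>

lemma eventually_parameters:
  assumes "(\<epsilon> :: real) > 0"
  shows "eventually (\<lambda>K :: nat. K \<ge> 3 \<and> ln K \<ge> 1 \<and> (ln K + 1) / K \<le> 1 / 2 \<and> K / ln K + 1 \<le> K / 2 \<and>
    K / ln K * ((1 - 2 / ln K - 2 / K) * (1 + \<epsilon>) * (ln K)\<^sup>2 / K - (ln K + 1) / K * (1 - ln ((ln K + 1) / K))) > ln 2)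
    sequentially"
proof -
  have "eventually (\<lambda>x :: real. ln x \<ge> 1) at_top"
    "eventually (\<lambda>x :: real. (ln x + 1) / x \<le> 1 / 2) at_top"
    "eventually (\<lambda>x :: real. x / ln x + 1 \<le> x / 2) at_top"
    by real_asymp+
  moreover have "eventually (\<lambda>x :: real. x / ln x * ((1 - 2 / ln x - 2 / x) * (1 + \<epsilon>) * (ln x)\<^sup>2 / x -
      (ln x + 1) / x * (1 - ln ((ln x + 1) / x))) > ln 2) at_top"
    using assms by real_asymp
  ultimately have "eventually (\<lambda>x :: real. ln x \<ge> 1 \<and> (ln x + 1) / x \<le> 1 / 2 \<and> x / ln x + 1 \<le> x / 2 \<and>
      x / ln x * ((1 - 2 / ln x - 2 / x) * (1 + \<epsilon>) * (ln x)\<^sup>2 / x - (ln x + 1) / x * (1 - ln ((ln x + 1) / x))) > ln 2) at_top"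
    by eventually_elim auto
  from eventually_compose_filterlim[OF this filterlim_real_sequentially] eventually_ge_at_top[of 3]
  show ?thesis by eventually_elim auto
qed

lemma prob_success_le:
  assumes "\<theta> \<ge> 0"
    and "\<And>\<Phi>. \<Phi> \<in> set_pmf (random_formula K d n) \<Longrightarrow>
      \<theta> \<le> measure_pmf.prob (decimation r \<tau> \<Phi>) (SAT \<Phi>) \<Longrightarrow> \<Phi> \<in> A \<union> B"
  shows "measure_pmf.prob (formula_and_output K d r \<tau> n) {(\<Phi>, \<sigma>). \<sigma> \<in> SAT \<Phi>} \<le>
    \<theta> + (measure_pmf.prob (random_formula K d n) A + measure_pmf.prob (random_formula K d n) B)"
proof -
  let ?R = "random_formula K d n" and ?g = "\<lambda>\<Phi>. measure_pmf.prob (decimation r \<tau> \<Phi>) (SAT \<Phi>)"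
  have g: "measure_pmf.prob (bind_pmf (decimation r \<tau> \<Phi>) (\<lambda>\<sigma>. return_pmf (\<Phi>, \<sigma>))) {(\<Phi>, \<sigma>). \<sigma> \<in> SAT \<Phi>} = ?g \<Phi>" for \<Phi>
  proof -
    have "bind_pmf (decimation r \<tau> \<Phi>) (\<lambda>\<sigma>. return_pmf (\<Phi>, \<sigma>)) = map_pmf (Pair \<Phi>) (decimation r \<tau> \<Phi>)"
      by (simp add: map_pmf_def)
    then show ?thesis by (simp add: vimage_def)
  qed
  have "measure_pmf.prob (formula_and_output K d r \<tau> n) {(\<Phi>, \<sigma>). \<sigma> \<in> SAT \<Phi>} = measure_pmf.expectation ?R ?g"
    unfolding formula_and_output_def prob_bind_pmf[of ?R] g ..
  also have "\<dots> \<le> measure_pmf.expectation ?R (\<lambda>\<Phi>. \<theta> + indicat_real (A \<union> B) \<Phi>)"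
  proof (rule integral_mono_AE)
    show "integrable (measure_pmf ?R) ?g" by (rule integrable_pmf_bounded[where c = 1]) simp
    show "integrable (measure_pmf ?R) (\<lambda>\<Phi>. \<theta> + indicat_real (A \<union> B) \<Phi>)"
      by (rule integrable_pmf_bounded[where c = "\<theta> + 1"]) (use assms(1) in \<open>simp add: indicator_def\<close>)
    have "?g \<Phi> \<le> \<theta> + indicat_real (A \<union> B) \<Phi>" if "\<Phi> \<in> set_pmf ?R" for \<Phi>
    proof (cases "\<theta> \<le> ?g \<Phi>")
      case True
      have "?g \<Phi> \<le> 1" by simp
      then have "?g \<Phi> \<le> \<theta> + 1" using assms(1) by linarith
      then show ?thesis using assms(2)[OF that True] by simp
    next
      case False
      moreover have "0 \<le> indicat_real (A \<union> B) \<Phi>" by simp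
      ultimately show ?thesis by linarith
    qed
    then show "AE \<Phi> in measure_pmf ?R. ?g \<Phi> \<le> \<theta> + indicat_real (A \<union> B) \<Phi>"
      by (simp add: AE_measure_pmf_iff)
  qed
  also have "\<dots> = \<theta> + measure_pmf.prob ?R (A \<union> B)"
  proof -
    have "integrable (measure_pmf ?R) (indicat_real (A \<union> B))"
      by (rule integrable_pmf_bounded[where c = 1]) (simp add: indicator_def)
    then show ?thesis by simp
  qed
  also have "\<dots> \<le> \<theta> + (measure_pmf.prob ?R A + measure_pmf.prob ?R B)"
    by (intro add_left_mono measure_Un_le) auto
  finally show ?thesis .
qed

theorem theorem2p4:
  fixes \<epsilon> :: real
  assumes "\<epsilon> > 0"
  shows "\<exists>K0 :: nat. \<forall>K \<ge> K0. \<forall>d :: real. d > (1 + \<epsilon>) * 2 ^ (K - 1) * (ln (real K))\<^sup>2 / real K \<longrightarrow>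
    (\<forall>r :: nat. even r \<and> r > 0 \<longrightarrow>
      (\<forall>\<tau>. local_rule K r \<tau> \<and> balanced K r \<tau> \<longrightarrow>
        (\<lambda>n. measure_pmf.prob (formula_and_output K d r \<tau> n) {(\<Phi>, \<sigma>). \<sigma> \<in> SAT \<Phi>})
          \<longlonglongrightarrow> 0))"
proof -
  from eventually_parameters[OF assms] obtain K0 :: nat where K0: "\<forall>K\<ge>K0. real K \<ge> 3 \<and> ln K \<ge> 1 \<and>
      (ln K + 1) / K \<le> 1 / 2 \<and> K / ln K + 1 \<le> K / 2 \<and>
      K / ln K * ((1 - 2 / ln K - 2 / K) * (1 + \<epsilon>) * (ln K)\<^sup>2 / K - (ln K + 1) / K * (1 - ln ((ln K + 1) / K))) > ln 2"
    unfolding eventually_sequentially by blast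
  show ?thesis
  proof (intro exI[of _ K0] allI impI, elim conjE)
    fix K d r \<tau>
    assume K: "K \<ge> K0" and d: "(1 + \<epsilon>) * 2 ^ (K - 1) * (ln (real K))\<^sup>2 / real K < d"
      and r: "even r" "r > 0" and \<tau>: "local_rule K r \<tau>" "balanced K r \<tau>"
    define l where "l = ln (real K)"
    have p: "real K \<ge> 3" "l \<ge> 1" "(l + 1) / K \<le> 1 / 2" "K / l + 1 \<le> K / 2"
      and num: "K / l * ((1 - 2 / l - 2 / K) * (1 + \<epsilon>) * l\<^sup>2 / K - (l + 1) / K * (1 - ln ((l + 1) / K))) > ln 2"
      using K0[rule_format, OF K] by (simp_all only: l_def)
    define m where "m = nat \<lceil>K / l\<rceil>"
    define \<alpha> where "\<alpha> = (l + 1) / K"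
    define s where "s = 2 * (1 / 2) ^ K * (m - (real m)\<^sup>2 * (2 / K))"
    have Kl: "K / l > 0" using p by simp
    have m: "K / l \<le> m" "m \<le> K / l + 1" unfolding m_def using Kl by linarith+
    have m0: "m > 0" using m(1) Kl by (cases m) auto
    \<comment> \<open>Cancels the factor \<open>2 ^ (K - 1)\<close> of the density against the
      probability that a clause is violated.\<close>
    have two: "2 * (1 / 2) ^ K * 2 ^ (K - 1) = (1 :: real)"
      using p(1) by (cases K) (auto simp: power_one_over)
    have d0: "d \<ge> 0"
    proof -
      have "0 \<le> (1 + \<epsilon>) * 2 ^ (K - 1) * (ln (real K))\<^sup>2 / real K" using assms by simp
      then show ?thesis using d by simp
    qed
    have half: "(1 / 2) ^ K \<le> (1 :: real) / K"
      using less_imp_le[OF of_nat_less_two_power[of K, where 'a = real]] p(1)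
      by (simp add: power_one_over field_simps)
    \<comment> \<open>The lower end \<open>l / K\<close> is chosen such that
      \<open>exp (- K * x)\<close> is at most \<open>1 / K\<close>; the other summand is at most
      \<open>(1 / 2) ^ K\<close>.\<close>
    have \<eta>: "(1 - x) ^ K + x ^ K \<le> 2 / K" if x: "l / K \<le> x" "x \<le> \<alpha>" for x
    proof -
      have "0 \<le> l / K" using p by simp
      then have x0: "0 \<le> x" "x \<le> 1 / 2" using x p(3) unfolding \<alpha>_def by linarith+
      have "(1 - x) ^ K \<le> exp (- x) ^ K"
        using x0 exp_ge_add_one_self[of "- x"] by (intro power_mono) auto
      also have "\<dots> = exp (- (K * x))" by (simp add: exp_of_nat_mult[symmetric])
      also have "\<dots> \<le> exp (- l)" using x(1) p(1) by (simp add: field_simps)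
      also have "\<dots> = 1 / K" using p(1) by (simp add: l_def exp_minus inverse_eq_divide)
      finally have "(1 - x) ^ K \<le> 1 / K" .
      moreover have "x ^ K \<le> (1 / 2) ^ K" using x0 by (intro power_mono) auto
      ultimately show ?thesis using half by simp
    qed
    have s_alt: "s = 2 * (1 / 2) ^ K * (m * (1 - 2 * real m / K))"
      by (simp add: s_def power2_eq_square algebra_simps)
    have mK: "2 * real m / K \<le> 1"
    proof -
      have "2 * m \<le> real K" using m(2) p(4) by linarith
      then show ?thesis using p(1) by simp
    qed
    have s: "0 \<le> s" "s \<le> 1"
    proof -
      show "0 \<le> s" unfolding s_alt using mK by simp
      have "m * (1 - 2 * real m / K) \<le> real m * 1" by (intro mult_left_mono) auto
      also have "\<dots> \<le> K / 2" using m(2) p(4) by linarith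
      finally have "s \<le> 2 * (1 / 2) ^ K * (K / 2)" unfolding s_alt by (intro mult_left_mono) auto
      also have "\<dots> \<le> 2 * (1 / K) * (K / 2)" using half by (intro mult_right_mono mult_left_mono) auto
      also have "\<dots> = 1" using p(1) by simp
      finally show "s \<le> 1" .
    qed
    have neg: "ln 2 + m * (\<alpha> * (1 - ln \<alpha>)) - s * d < 0"
    proof -
      \<comment> \<open>A lower bound for the gain per assignment. As \<open>c\<close> is positive,
        rounding \<open>K / l\<close> up to \<open>m\<close> only helps here; the loss from rounding
        is covered by \<open>2 / K\<close>.\<close>
      define c where "c = (1 - 2 / l - 2 / K) * (1 + \<epsilon>) * l\<^sup>2 / K - \<alpha> * (1 - ln \<alpha>)"
      have Kc: "K / l * c > ln 2" using num by (simp add: c_def \<alpha>_def)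
      then have "K / l * c > 0" using ln_2_less_1 ln_gt_zero[of "2 :: real"] by linarith
      then have c0: "c > 0" using Kl by (rule zero_less_mult_pos)
      have "2 * real m / K \<le> 2 * (K / l + 1) / K" using m(2) by (intro divide_right_mono) auto
      also have "\<dots> = 2 / l + 2 / K" using p(1,2) by (simp add: field_simps)
      finally have "m * (1 - 2 / l - 2 / K) \<le> m * (1 - 2 * real m / K)"
        by (intro mult_left_mono) auto
      then have "m * (1 - 2 / l - 2 / K) * ((1 + \<epsilon>) * l\<^sup>2 / K) \<le> m * (1 - 2 * real m / K) * ((1 + \<epsilon>) * l\<^sup>2 / K)"
        using assms by (intro mult_right_mono) auto
      also have "\<dots> = 2 * (1 / 2) ^ K * 2 ^ (K - 1) * (m * (1 - 2 * real m / K) * ((1 + \<epsilon>) * l\<^sup>2 / K))"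
        unfolding two by simp
      also have "\<dots> = s * ((1 + \<epsilon>) * 2 ^ (K - 1) * l\<^sup>2 / K)"
        unfolding s_alt by (simp add: mult_ac)
      also have "\<dots> \<le> s * d" using s d by (intro mult_left_mono) (auto simp: l_def)
      finally have "m * (1 - 2 / l - 2 / K) * ((1 + \<epsilon>) * l\<^sup>2 / K) \<le> s * d" .
      moreover have "m * (1 - 2 / l - 2 / K) * ((1 + \<epsilon>) * l\<^sup>2 / K) = m * c + m * (\<alpha> * (1 - ln \<alpha>))"
        by (simp add: c_def right_diff_distrib mult.assoc)
      moreover have "K / l * c \<le> m * c" using m(1) c0 by (intro mult_right_mono) auto
      ultimately show ?thesis using Kc by linarith
    qed
    let ?T = "\<lambda>n :: nat. {\<Phi>. \<exists>f :: nat \<Rightarrow> nat \<Rightarrow> bool. (\<forall>j<m. f j \<in> SAT \<Phi>) \<and>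
        (\<forall>i<m. \<forall>j<m. i \<noteq> j \<longrightarrow> l / K * n \<le> card {x \<in> {1..n}. f i x \<noteq> f j x} \<and>
           card {x \<in> {1..n}. f i x \<noteq> f j x} \<le> \<alpha> * n)}"
    have tuple: "(\<lambda>n. measure_pmf.prob (random_formula K d n) (?T n)) \<longlonglongrightarrow> 0"
    proof (rule tuple_tendsto[where \<eta> = "2 / K", OF _ m0 _ _ _ \<eta>])
      show "0 \<le> 2 * (1 / 2) ^ K * (m - (real m)\<^sup>2 * (2 / K))" "2 * (1 / 2) ^ K * (m - (real m)\<^sup>2 * (2 / K)) \<le> 1"
        "ln 2 + m * (\<alpha> * (1 - ln \<alpha>)) - 2 * (1 / 2) ^ K * (m - (real m)\<^sup>2 * (2 / K)) * d < 0"
        using s neg by (simp_all only: s_def)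
      show "0 < \<alpha>" "\<alpha> \<le> 1" using p by (simp_all add: \<alpha>_def)
    qed (use p in simp_all)
    \<comment> \<open>The target \<open>a\<close> is the midpoint of the window from
      \<open>l / K\<close> to \<open>\<alpha>\<close>, which has width \<open>1 / K\<close>, and
      \<open>w\<close> is half of that width.\<close>
    define w where "w = 1 / (2 * real K)"
    define a where "a = (l + 1 / 2) / K"
    have w: "w > 0" and a: "0 < a" "a \<le> 1 / 2" and aw: "a - w = l / K" "a + w = \<alpha>"
      using p by (auto simp: w_def a_def \<alpha>_def field_simps)
    show "(\<lambda>n. measure_pmf.prob (formula_and_output K d r \<tau> n) {(\<Phi>, \<sigma>). \<sigma> \<in> SAT \<Phi>}) \<longlonglongrightarrow> 0"
    proof (rule tendstoI)
      fix e :: real assume e: "e > 0"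
      \<comment> \<open>One third each for formulas with small success probability, for those with
        too many meeting zones, and for those with a forbidden tuple.\<close>
      define \<theta> where "\<theta> = e / 3"
      have \<theta>: "\<theta> > 0" using e by (simp add: \<theta>_def)
      \<comment> \<open>The first bound serves the jump estimate. The 16 in the second leaves a
        factor 1/2, which makes the inequality \<open>small\<close> strict. The number
        \<open>m\<close> depends only on \<open>K\<close>, so \<open>\<delta>\<close> is fixed
        before \<open>n\<close> grows.\<close>
      define \<delta> where "\<delta> = min (w\<^sup>2 / 4) ((\<theta> / 2) ^ m * (w\<^sup>2 * \<theta>) / (16 * (real m)\<^sup>2))"
      have \<delta>: "\<delta> > 0" "4 * \<delta> \<le> w\<^sup>2" using w \<theta> m0 by (auto simp: \<delta>_def)
      have small: "real (m\<^sup>2) * (8 * \<delta> / (w\<^sup>2 * \<theta>)) < (\<theta> / 2) ^ m"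
      proof -
        have "\<delta> \<le> (\<theta> / 2) ^ m * (w\<^sup>2 * \<theta>) / (16 * (real m)\<^sup>2)" by (simp add: \<delta>_def)
        then have "real (m\<^sup>2) * (8 * \<delta> / (w\<^sup>2 * \<theta>)) \<le>
            real (m\<^sup>2) * (8 * ((\<theta> / 2) ^ m * (w\<^sup>2 * \<theta>) / (16 * (real m)\<^sup>2)) / (w\<^sup>2 * \<theta>))"
          using w \<theta> by (intro mult_left_mono divide_right_mono) auto
        also have "\<dots> = (\<theta> / 2) ^ m / 2" using w \<theta> m0 by (simp add: field_simps)
        also have "\<dots> < (\<theta> / 2) ^ m" using \<theta> by simp
        finally show ?thesis .
      qed
      let ?Z = "\<lambda>n :: nat. {\<Phi>. \<delta> * (real n)\<^sup>2 \<le> card (vars \<Phi> \<times> vars \<Phi> \<inter> {(x, y). zone \<Phi> r x \<inter> zone \<Phi> r y \<noteq> {}})}"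
      have "eventually (\<lambda>n. measure_pmf.prob (random_formula K d n) (?Z n) < e / 3) sequentially"
        by (rule order_tendstoD(2)[OF zones_meet_tendsto[OF d0 r \<delta>(1)]]) (use e in simp)
      moreover have "eventually (\<lambda>n. measure_pmf.prob (random_formula K d n) (?T n) < e / 3) sequentially"
        by (rule order_tendstoD(2)[OF tuple]) (use e in simp)
      ultimately show "eventually (\<lambda>n. dist (measure_pmf.prob (formula_and_output K d r \<tau> n) {(\<Phi>, \<sigma>). \<sigma> \<in> SAT \<Phi>}) 0 < e) sequentially"
        using eventually_ge_at_top[of K]
      proof eventually_elim
        case (elim n)
        then have n: "K \<le> n" "n > 0" using p(1) by auto
        have "measure_pmf.prob (formula_and_output K d r \<tau> n) {(\<Phi>, \<sigma>). \<sigma> \<in> SAT \<Phi>} \<le>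
          \<theta> + (measure_pmf.prob (random_formula K d n) (?Z n) + measure_pmf.prob (random_formula K d n) (?T n))"
        proof (rule prob_success_le)
          fix \<Phi> assume \<Phi>: "\<Phi> \<in> set_pmf (random_formula K d n)"
            and succ: "\<theta> \<le> measure_pmf.prob (decimation r \<tau> \<Phi>) (SAT \<Phi>)"
          show "\<Phi> \<in> ?Z n \<union> ?T n"
          proof (cases "\<Phi> \<in> ?Z n")
            case False
            then have "card (vars \<Phi> \<times> vars \<Phi> \<inter> {(x, y). zone \<Phi> r x \<inter> zone \<Phi> r y \<noteq> {}}) \<le> \<delta> * (real n)\<^sup>2"
              by simp
            from success_tuple[OF set_random_formula[OF n(1) \<Phi>] r(1) \<tau> n(2) this \<delta> a w \<theta> succ small]
            have "\<Phi> \<in> ?T n" unfolding aw by blast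
            then show ?thesis by blast
          qed blast
        qed (use \<theta> in simp)
        also have "\<dots> < e" using elim by (simp add: \<theta>_def)
        finally show ?case by simp
      qed
    qed
  qed
qed

end
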